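(* Let $G/G_0$ be a semisimple symmetric space of rank $k$, let $\mathfrak{g}=\mathfrak{g}_0\oplus\mathfrak{g}_1$ be a Cartan decomposition of $G/G_0$, let $\mathfrak{a}\subset\mathfrak{g}_1$ be a maximal $k$-dimensional abelian subspace and $\mathfrak{m}=\mathfrak{g}_1\cap\mathfrak{a}^\perp$. The integral manifolds of the $G/G_0$-exterior differential system, that is, of the Pfaffian system on $Y=G\times\mathfrak{m}$ associated with the Cartan tableau $\mathfrak{m}\subset\mathrm{Hom}(\mathfrak{a},\mathfrak{b})$, are the smooth $k$-dimensional immersed submanifolds $(g,V):M^k\to G\times\mathfrak{m}$ which satisfy $g^{-1}dg=df+[df,V]$, where $f:M^k\to\mathfrak{a}$ is a local diffeomorphism. Hence the integral manifolds of the $G/G_0$-exterior differential system coincide with the framed solutions of the $G/G_0$-system.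
   Context: **Setting.** $\mathfrak{g}$ and $\mathfrak{g}_0$ are the Lie algebras of $G$ and $G_0$, and $[\mathfrak{g}_0,\mathfrak{g}_0]\subset\mathfrak{g}_0$, $[\mathfrak{g}_0,\mathfrak{g}_1]\subset\mathfrak{g}_1$, $[\mathfrak{g}_1,\mathfrak{g}_1]\subset\mathfrak{g}_0$. Orthogonality is with respect to the Killing form. One has $\mathfrak{g}_1=\mathfrak{a}\oplus\mathfrak{m}$. Put $(\mathfrak{g}_0)_{\mathfrak{a}}=\{X\in\mathfrak{g}_0:[X,\mathfrak{a}]=0\}$ and $\mathfrak{b}=\mathfrak{g}_0\cap(\mathfrak{g}_0)_{\mathfrak{a}}^\perp$. $(A_1,\dots,A_k)$ is a basis of $\mathfrak{a}$ consisting of regular elements with respect to the $\mathrm{Ad}(G_0)$-action on $\mathfrak{g}_1$ (elements whose $\mathrm{Ad}(G_0)$-orbit is principal). The space $\mathfrak{m}$ is regarded as a subspace of $\mathrm{Hom}(\mathfrak{a},\mathfrak{b})$ (the Cartan tableau) via the injective map $X\mapsto-\mathrm{ad}_X|_{\mathfrak{a}}$. **The $G/G_0$-system.** It is the PDE system for maps $V:U\subset\mathfrak{a}\to\mathfrak{m}$: $[A_i,V_{x_j}]-[A_j,V_{x_i}]=[[A_i,V],[A_j,V]]$, $1\le i\neq j\le k$, where $x_i$ are the coordinates with respect to $(A_1,\dots,A_k)$ and $V_{x_i}=\partial V/\partial x_i$. A generalized solution is a pair $(f,V):M^k\to\mathfrak{a}\times\mathfrak{m}$, defined on a $k$-dimensional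 manifold $M^k$, such that $f$ is a local diffeomorphism and the $\mathfrak{g}$-valued 1-form $\theta=df+[df,V]$ on $M^k$ satisfies the Maurer–Cartan equation. Given a generalized solution $(f,V)$ and a map $g:M^k\to G$ (unique up to left multiplication by an element of $G$) such that $g^{-1}dg=\theta=df+[df,V]$, where $g^{-1}dg$ is the pull-back by $g$ of the Maurer–Cartan form of $G$, the pair $(g,V)$ is called a framed solution of the $G/G_0$-system. **The $G/G_0$-exterior differential system.** Let $\mathfrak{n}\subset\mathfrak{g}_0$ be such that $\mathfrak{g}_0=\mathfrak{b}\oplus\mathfrak{n}$, and decompose the Maurer–Cartan form of $G$ as $\theta_{\mathfrak{a}}+\theta_{\mathfrak{m}}+\theta_{\mathfrak{b}}+\theta_{\mathfrak{n}}$ according to $\mathfrak{g}=\mathfrak{a}\oplus\mathfrak{m}\oplus\mathfrak{b}\oplus\mathfrak{n}$. The Pfaffian system associated with the Cartan tableau is the system on $Y=G\times\mathfrak{m}$ (with $V$ the coordinate on the factor $\mathfrak{m}$) generated by the Pfaffian equations $\theta_{\mathfrak{b}}=[\theta_{\mathfrak{a}},V]$, $\theta_{\mathfrak{m}}=\theta_{\mathfrak{n}}=0$, with independence condition $\theta^1_{\mathfrak{a}}\wedge\cdots\wedge\theta^k_{\mathfrak{a}}\neq0$, where $\theta_{\mathfrak{a}}=\sum_i\theta^i_{\mathfrak{a}}A_i$. An integral manifold is a $k$-dimensional immersed submanifold of $Y$ on which these equations and the independence condition hold.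
   Formalization: One f on all of M is obtained from an integral manifold only for simply connected M; on general M, f exists near each point (a closed curve exp(a) with V=0 is an integral manifold but has no local diffeomorphism to a). Framed solutions are integral manifolds on every M. *)

theory Defs
  imports "HOL-Analysis.Analysis"
begin

section \<open>Smooth manifolds\<close>

text \<open>Smoothness between Euclidean spaces; only used on open sets \<open>S\<close>.\<close>

fun Ck_on :: "nat \<Rightarrow> 'a::euclidean_space set \<Rightarrow> ('a \<Rightarrow> 'b::real_normed_vector) \<Rightarrow> bool" where
  "Ck_on 0 S f \<longleftrightarrow> continuous_on S f"
| "Ck_on (Suc r) S f \<longleftrightarrow>
     (\<forall>x\<in>S. f differentiable (at x)) \<and>
     (\<forall>v. Ck_on r S (\<lambda>x. frechet_derivative f (at x) v))"

definition smooth_on :: "'a::euclidean_space set \<Rightarrow> ('a \<Rightarrow> 'b::real_normed_vector) \<Rightarrow> bool" where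
  "smooth_on S f \<longleftrightarrow> (\<forall>r. Ck_on r S f)"

type_synonym ('m, 'e) chart = "'m set \<times> ('m \<Rightarrow> 'e)"

text \<open>The underlying set of a manifold is a whole (Hausdorff, second countable) type. Atlases
  need not be maximal.\<close>

definition smooth_atlas ::
  "('m::{t2_space,second_countable_topology}, 'e::euclidean_space) chart set \<Rightarrow> bool" where
  "smooth_atlas \<A> \<longleftrightarrow>
     (\<Union>(U, \<phi>)\<in>\<A>. U) = UNIV \<and>
     (\<forall>(U, \<phi>)\<in>\<A>. open U \<and> open (\<phi> ` U) \<and> homeomorphism U (\<phi> ` U) \<phi> (inv_into U \<phi>)) \<and>
     (\<forall>(U, \<phi>)\<in>\<A>. \<forall>(U', \<psi>)\<in>\<A>. smooth_on (\<phi> ` (U \<inter> U')) (\<psi> \<circ> inv_into U \<phi>))"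

definition std_atlas :: "('e::euclidean_space, 'e) chart set" where
  "std_atlas = {(UNIV, id)}"

definition prod_atlas :: "('m, 'e) chart set \<Rightarrow> ('n, 'f) chart set \<Rightarrow> ('m \<times> 'n, 'e \<times> 'f) chart set" where
  "prod_atlas \<A> \<B> = {(U \<times> U', map_prod \<phi> \<psi>) | U \<phi> U' \<psi>. (U, \<phi>) \<in> \<A> \<and> (U', \<psi>) \<in> \<B>}"

text \<open>\<open>smooth_map \<A> W \<B> F\<close>: the map \<open>F\<close> is smooth on the open subset \<open>W\<close> of the manifold with
  atlas \<open>\<A>\<close>, with values in the manifold with atlas \<open>\<B>\<close>.\<close>

definition smooth_map ::
  "('m::topological_space, 'e::euclidean_space) chart set \<Rightarrow> 'm set \<Rightarrow>
   ('n::topological_space, 'f::euclidean_space) chart set \<Rightarrow> ('m \<Rightarrow> 'n) \<Rightarrow> bool" where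
  "smooth_map \<A> W \<B> F \<longleftrightarrow>
     continuous_on W F \<and>
     (\<forall>(U, \<phi>)\<in>\<A>. \<forall>(U', \<psi>)\<in>\<B>.
        smooth_on (\<phi> ` (U \<inter> W \<inter> F -` U')) (\<psi> \<circ> F \<circ> inv_into U \<phi>))"

definition smooth_at ::
  "('m::topological_space, 'e::euclidean_space) chart set \<Rightarrow> 'm \<Rightarrow> ('m \<Rightarrow> real) \<Rightarrow> bool" where
  "smooth_at \<A> p h \<longleftrightarrow> (\<exists>W. open W \<and> p \<in> W \<and> smooth_map \<A> W std_atlas h)"

text \<open>Tangent vectors at \<open>p\<close> are the operators \<open>h \<mapsto> \<partial>(h \<circ> \<phi>\<^sup>-\<^sup>1)(\<phi> p) u\<close> on functions that are smooth
  near \<open>p\<close>; on other functions they are set to \<open>0\<close>, so that equality of operators is equality of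
  tangent vectors.\<close>

type_synonym 'm tvec = "('m \<Rightarrow> real) \<Rightarrow> real"

definition coord_vector ::
  "('m::topological_space, 'e::euclidean_space) chart set \<Rightarrow> ('m, 'e) chart \<Rightarrow> 'm \<Rightarrow> 'e \<Rightarrow> 'm tvec" where
  "coord_vector \<A> c p u =
     (\<lambda>h. if smooth_at \<A> p h
          then frechet_derivative (h \<circ> inv_into (fst c) (snd c)) (at (snd c p)) u else 0)"

definition tangent_space ::
  "('m::topological_space, 'e::euclidean_space) chart set \<Rightarrow> 'm \<Rightarrow> 'm tvec set" where
  "tangent_space \<A> p = {coord_vector \<A> c p u | c u. c \<in> \<A> \<and> p \<in> fst c}"

definition pushforward ::
  "('n::topological_space, 'f::euclidean_space) chart set \<Rightarrow> ('m \<Rightarrow> 'n) \<Rightarrow> 'm \<Rightarrow> 'm tvec \<Rightarrow> 'n tvec" where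
  "pushforward \<B> F p v = (\<lambda>h. if smooth_at \<B> (F p) h then v (h \<circ> F) else 0)"

text \<open>\<open>dvec v f\<close> is the value \<open>df(v)\<close> for a vector-valued function \<open>f\<close>.\<close>

definition dvec :: "'m tvec \<Rightarrow> ('m \<Rightarrow> 'v::euclidean_space) \<Rightarrow> 'v" where
  "dvec v f = (\<Sum>b\<in>Basis. v (\<lambda>q. f q \<bullet> b) *\<^sub>R b)"

definition immersion ::
  "('m::topological_space, 'e::euclidean_space) chart set \<Rightarrow> 'm set \<Rightarrow>
   ('n::topological_space, 'f::euclidean_space) chart set \<Rightarrow> ('m \<Rightarrow> 'n) \<Rightarrow> bool" where
  "immersion \<A> W \<B> F \<longleftrightarrow>
     smooth_map \<A> W \<B> F \<and> (\<forall>p\<in>W. inj_on (pushforward \<B> F p) (tangent_space \<A> p))"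

definition local_diffeo ::
  "('m::topological_space, 'e::euclidean_space) chart set \<Rightarrow> 'm set \<Rightarrow>
   ('n::topological_space, 'f::euclidean_space) chart set \<Rightarrow> ('m \<Rightarrow> 'n) \<Rightarrow> bool" where
  "local_diffeo \<A> W \<B> F \<longleftrightarrow>
     (\<forall>p\<in>W. \<exists>U. open U \<and> p \<in> U \<and> U \<subseteq> W \<and> open (F ` U) \<and> inj_on F U \<and>
        smooth_map \<A> U \<B> F \<and> smooth_map \<B> (F ` U) \<A> (inv_into U F))"

text \<open>Vector-valued 1-forms; only their values \<open>\<eta> p v\<close> with \<open>v\<close> tangent at \<open>p\<close> matter.\<close>

type_synonym ('m, 'v) form1 = "'m \<Rightarrow> 'm tvec \<Rightarrow> 'v"

definition pullback ::
  "('n::topological_space, 'f::euclidean_space) chart set \<Rightarrow> ('m \<Rightarrow> 'n) \<Rightarrow> ('n, 'v) form1 \<Rightarrow> ('m, 'v) form1" where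
  "pullback \<B> F \<eta> = (\<lambda>p v. \<eta> (F p) (pushforward \<B> F p v))"

text \<open>The exterior derivative on the vectors with constant components \<open>u\<close>, \<open>w\<close> in the chart \<open>c\<close>,
  normalised by \<open>d\<eta>(X,Y) = X(\<eta>(Y)) - Y(\<eta>(X)) - \<eta>([X,Y])\<close>.\<close>

definition ext_deriv ::
  "('m::topological_space, 'e::euclidean_space) chart set \<Rightarrow> ('m, 'v::euclidean_space) form1 \<Rightarrow>
   ('m, 'e) chart \<Rightarrow> 'm \<Rightarrow> 'e \<Rightarrow> 'e \<Rightarrow> 'v" where
  "ext_deriv \<A> \<eta> c p u w =
     dvec (coord_vector \<A> c p u) (\<lambda>q. \<eta> q (coord_vector \<A> c q w)) -
     dvec (coord_vector \<A> c p w) (\<lambda>q. \<eta> q (coord_vector \<A> c q u))"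

section \<open>Lie groups\<close>

text \<open>The Lie algebra (the tangent space at the identity) is identified with a Euclidean space
  \<open>'l\<close> by the linear isomorphism \<open>lg_vec\<close>. The inner product of \<open>'l\<close> only serves to
  provide the topology and traces.\<close>

record ('g, 'e, 'l) lie_grp =
  lg_atlas :: "('g, 'e) chart set"
  lg_mult :: "'g \<Rightarrow> 'g \<Rightarrow> 'g"
  lg_one :: 'g
  lg_inv :: "'g \<Rightarrow> 'g"
  lg_vec :: "'l \<Rightarrow> 'g tvec"

definition lie_group ::
  "('g::{t2_space,second_countable_topology}, 'e::euclidean_space, 'l::euclidean_space) lie_grp \<Rightarrow> bool" where
  "lie_group G \<longleftrightarrow>
     smooth_atlas (lg_atlas G) \<and>
     group (lg_mult G) (lg_one G) (lg_inv G) \<and>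
     smooth_map (prod_atlas (lg_atlas G) (lg_atlas G)) UNIV (lg_atlas G) (\<lambda>(x, y). lg_mult G x y) \<and>
     smooth_map (lg_atlas G) UNIV (lg_atlas G) (lg_inv G) \<and>
     bij_betw (lg_vec G) UNIV (tangent_space (lg_atlas G) (lg_one G)) \<and>
     (\<forall>X Y h. lg_vec G (X + Y) h = lg_vec G X h + lg_vec G Y h) \<and>
     (\<forall>r X h. lg_vec G (r *\<^sub>R X) h = r * lg_vec G X h)"

definition left_field ::
  "('g::topological_space, 'e::euclidean_space, 'l) lie_grp \<Rightarrow> 'l \<Rightarrow> 'g \<Rightarrow> 'g tvec" where
  "left_field G X x = pushforward (lg_atlas G) (lg_mult G x) (lg_one G) (lg_vec G X)"

text \<open>The bracket is the value at the identity of the commutator of left-invariant vector fields.\<close>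

definition bracket ::
  "('g::topological_space, 'e::euclidean_space, 'l) lie_grp \<Rightarrow> 'l \<Rightarrow> 'l \<Rightarrow> 'l" where
  "bracket G X Y = inv (lg_vec G)
     (\<lambda>h. if smooth_at (lg_atlas G) (lg_one G) h
          then lg_vec G X (\<lambda>x. left_field G Y x h) - lg_vec G Y (\<lambda>x. left_field G X x h)
          else 0)"

text \<open>The Maurer--Cartan form; \<open>pullback (lg_atlas G) g (mc_form G)\<close> is \<open>g\<^sup>-\<^sup>1dg\<close>.\<close>

definition mc_form ::
  "('g::topological_space, 'e::euclidean_space, 'l) lie_grp \<Rightarrow> ('g, 'l) form1" where
  "mc_form G x v = inv (lg_vec G) (pushforward (lg_atlas G) (lg_mult G (lg_inv G x)) x v)"

text \<open>The derivative at the identity of a map \<open>F\<close> that fixes the identity.\<close>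

definition lie_deriv ::
  "('g::topological_space, 'e::euclidean_space, 'l) lie_grp \<Rightarrow> ('g \<Rightarrow> 'g) \<Rightarrow> 'l \<Rightarrow> 'l" where
  "lie_deriv G F X = inv (lg_vec G) (pushforward (lg_atlas G) F (lg_one G) (lg_vec G X))"

definition lie_conj :: "('g, 'e, 'l) lie_grp \<Rightarrow> 'g \<Rightarrow> 'g \<Rightarrow> 'g" where
  "lie_conj G x y = lg_mult G (lg_mult G x y) (lg_inv G x)"

definition Ad ::
  "('g::topological_space, 'e::euclidean_space, 'l) lie_grp \<Rightarrow> 'g \<Rightarrow> 'l \<Rightarrow> 'l" where
  "Ad G x = lie_deriv G (lie_conj G x)"

text \<open>The trace of \<open>ad X \<circ> ad Y\<close>.\<close>

definition killing ::
  "('g::topological_space, 'e::euclidean_space, 'l::euclidean_space) lie_grp \<Rightarrow> 'l \<Rightarrow> 'l \<Rightarrow> real" where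
  "killing G X Y = (\<Sum>b\<in>Basis. bracket G X (bracket G Y b) \<bullet> b)"

definition semisimple ::
  "('g::topological_space, 'e::euclidean_space, 'l::euclidean_space) lie_grp \<Rightarrow> bool" where
  "semisimple G \<longleftrightarrow> (\<forall>X. (\<forall>Y. killing G X Y = 0) \<longrightarrow> X = 0)"

text \<open>The Lie algebra of a closed subgroup: initial velocities of the smooth one-parameter
  subgroups contained in it.\<close>

definition subgroup_lie_algebra ::
  "('g::topological_space, 'e::euclidean_space, 'l) lie_grp \<Rightarrow> 'g set \<Rightarrow> 'l set" where
  "subgroup_lie_algebra G H =
     {X. \<exists>\<gamma> :: real \<Rightarrow> 'g.
           smooth_map std_atlas UNIV (lg_atlas G) \<gamma> \<and>
           (\<forall>s t. \<gamma> (s + t) = lg_mult G (\<gamma> s) (\<gamma> t)) \<and> range \<gamma> \<subseteq> H \<and>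
           pushforward (lg_atlas G) \<gamma> 0 (coord_vector std_atlas (UNIV, id) 0 1) = lg_vec G X}"

section \<open>Symmetric spaces\<close>

definition symmetric_space ::
  "('g::{t2_space,second_countable_topology}, 'e::euclidean_space, 'l::euclidean_space) lie_grp \<Rightarrow>
   'g set \<Rightarrow> ('g \<Rightarrow> 'g) \<Rightarrow> bool" where
  "symmetric_space G G0 \<sigma> \<longleftrightarrow>
     lie_group G \<and>
     smooth_map (lg_atlas G) UNIV (lg_atlas G) \<sigma> \<and>
     (\<forall>x y. \<sigma> (lg_mult G x y) = lg_mult G (\<sigma> x) (\<sigma> y)) \<and> \<sigma> \<circ> \<sigma> = id \<and>
     closed G0 \<and> lg_one G \<in> G0 \<and>
     (\<forall>x\<in>G0. \<forall>y\<in>G0. lg_mult G x y \<in> G0) \<and> (\<forall>x\<in>G0. lg_inv G x \<in> G0) \<and>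
     connected_component_set {x. \<sigma> x = x} (lg_one G) \<subseteq> G0 \<and> G0 \<subseteq> {x. \<sigma> x = x}"

definition cartan_decomposition ::
  "('g::topological_space, 'e::euclidean_space, 'l::euclidean_space) lie_grp \<Rightarrow> 'g set \<Rightarrow>
   ('g \<Rightarrow> 'g) \<Rightarrow> 'l set \<Rightarrow> 'l set \<Rightarrow> bool" where
  "cartan_decomposition G G0 \<sigma> \<gg>\<^sub>0 \<gg>\<^sub>1 \<longleftrightarrow>
     \<gg>\<^sub>0 = subgroup_lie_algebra G G0 \<and>
     \<gg>\<^sub>0 = {X. lie_deriv G \<sigma> X = X} \<and> \<gg>\<^sub>1 = {X. lie_deriv G \<sigma> X = - X}"

definition abelian_subspace ::
  "('g::topological_space, 'e::euclidean_space, 'l::euclidean_space) lie_grp \<Rightarrow> 'l set \<Rightarrow> bool" where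
  "abelian_subspace G \<aa> \<longleftrightarrow> subspace \<aa> \<and> (\<forall>X\<in>\<aa>. \<forall>Y\<in>\<aa>. bracket G X Y = 0)"

definition maximal_abelian ::
  "('g::topological_space, 'e::euclidean_space, 'l::euclidean_space) lie_grp \<Rightarrow> 'l set \<Rightarrow> 'l set \<Rightarrow> bool" where
  "maximal_abelian G \<gg>\<^sub>1 \<aa> \<longleftrightarrow>
     abelian_subspace G \<aa> \<and> \<aa> \<subseteq> \<gg>\<^sub>1 \<and>
     (\<forall>\<cc>. abelian_subspace G \<cc> \<and> \<aa> \<subseteq> \<cc> \<and> \<cc> \<subseteq> \<gg>\<^sub>1 \<longrightarrow> \<cc> = \<aa>)"

definition killing_perp ::
  "('g::topological_space, 'e::euclidean_space, 'l::euclidean_space) lie_grp \<Rightarrow> 'l set \<Rightarrow> 'l set" where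
  "killing_perp G S = {X. \<forall>Y\<in>S. killing G X Y = 0}"

definition centralizer_in ::
  "('g::topological_space, 'e::euclidean_space, 'l::euclidean_space) lie_grp \<Rightarrow> 'l set \<Rightarrow> 'l set \<Rightarrow> 'l set" where
  "centralizer_in G \<gg>\<^sub>0 \<aa> = {X\<in>\<gg>\<^sub>0. \<forall>A\<in>\<aa>. bracket G X A = 0}"

definition stabilizer ::
  "('g::topological_space, 'e::euclidean_space, 'l::euclidean_space) lie_grp \<Rightarrow> 'g set \<Rightarrow> 'l \<Rightarrow> 'g set" where
  "stabilizer G G0 X = {x\<in>G0. Ad G x X = X}"

text \<open>\<open>X\<close> is regular if its orbit is principal (Palais--Terng): the stabilizer of \<open>X\<close> is
  conjugate to a subgroup of the stabilizer of every point near \<open>X\<close>.\<close>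

definition regular_element ::
  "('g::topological_space, 'e::euclidean_space, 'l::euclidean_space) lie_grp \<Rightarrow> 'g set \<Rightarrow> 'l set \<Rightarrow> 'l \<Rightarrow> bool" where
  "regular_element G G0 \<gg>\<^sub>1 X \<longleftrightarrow>
     X \<in> \<gg>\<^sub>1 \<and>
     (\<exists>N. open N \<and> X \<in> N \<and>
        (\<forall>Y\<in>N \<inter> \<gg>\<^sub>1. \<exists>x\<in>G0. stabilizer G G0 X \<subseteq> lie_conj G x ` stabilizer G G0 Y))"

definition direct_sum :: "'l::real_vector set \<Rightarrow> 'l set \<Rightarrow> 'l set \<Rightarrow> bool" where
  "direct_sum U S T \<longleftrightarrow>
     subspace S \<and> subspace T \<and> S \<inter> T = {0} \<and> U = {x + y | x y. x \<in> S \<and> y \<in> T}"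

text \<open>The \<open>S\<close>-component of \<open>X\<close> with respect to a direct sum of \<open>S\<close> and \<open>T\<close>.\<close>

definition component :: "'l::real_vector set \<Rightarrow> 'l set \<Rightarrow> 'l \<Rightarrow> 'l" where
  "component S T X = (THE Y. Y \<in> S \<and> X - Y \<in> T)"

definition coords :: "('k \<Rightarrow> 'l::real_vector) \<Rightarrow> 'l \<Rightarrow> real ^ ('k::finite)" where
  "coords A X = (THE c. X = (\<Sum>i\<in>UNIV. (c $ i) *\<^sub>R A i))"

section \<open>Framed solutions of the \<open>G/G\<^sub>0\<close>-system\<close>

text \<open>In what follows \<open>\<M>\<close> is the atlas of a \<open>k\<close>-dimensional manifold, \<open>W\<close> an open subset
  of it and \<open>A\<close> a basis of \<open>\<aa>\<close>, whose coordinates are the global chart of \<open>\<aa>\<close>.\<close>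

definition local_diffeo_into ::
  "('m::topological_space, real ^ 'k) chart set \<Rightarrow> 'm set \<Rightarrow> ('k::finite \<Rightarrow> 'l::euclidean_space) \<Rightarrow>
   'l set \<Rightarrow> ('m \<Rightarrow> 'l) \<Rightarrow> bool" where
  "local_diffeo_into \<M> W A \<aa> f \<longleftrightarrow>
     (\<forall>p\<in>W. f p \<in> \<aa>) \<and> local_diffeo \<M> W std_atlas (\<lambda>p. coords A (f p))"

text \<open>\<open>\<theta> = df + [df, V]\<close>\<close>

definition theta ::
  "('g::topological_space, 'e::euclidean_space, 'l::euclidean_space) lie_grp \<Rightarrow>
   ('m \<Rightarrow> 'l) \<Rightarrow> ('m \<Rightarrow> 'l) \<Rightarrow> ('m, 'l) form1" where
  "theta G f V p v = dvec v f + bracket G (dvec v f) (V p)"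

text \<open>\<open>d\<eta> + (1/2)[\<eta> \<and> \<eta>] = 0\<close>\<close>

definition maurer_cartan_eq ::
  "('g::topological_space, 'e::euclidean_space, 'l::euclidean_space) lie_grp \<Rightarrow>
   ('m::topological_space, 'd::euclidean_space) chart set \<Rightarrow> 'm set \<Rightarrow> ('m, 'l) form1 \<Rightarrow> bool" where
  "maurer_cartan_eq G \<M> W \<eta> \<longleftrightarrow>
     (\<forall>c\<in>\<M>. \<forall>p\<in>W \<inter> fst c. \<forall>u w.
        ext_deriv \<M> \<eta> c p u w +
        bracket G (\<eta> p (coord_vector \<M> c p u)) (\<eta> p (coord_vector \<M> c p w)) = 0)"

definition generalized_solution ::
  "('g::topological_space, 'e::euclidean_space, 'l::euclidean_space) lie_grp \<Rightarrow>
   ('k::finite \<Rightarrow> 'l) \<Rightarrow> 'l set \<Rightarrow> 'l set \<Rightarrow>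
   ('m::topological_space, real ^ 'k) chart set \<Rightarrow> 'm set \<Rightarrow> ('m \<Rightarrow> 'l) \<Rightarrow> ('m \<Rightarrow> 'l) \<Rightarrow> bool" where
  "generalized_solution G A \<aa> \<mm> \<M> W f V \<longleftrightarrow>
     local_diffeo_into \<M> W A \<aa> f \<and>
     (\<forall>p\<in>W. V p \<in> \<mm>) \<and> smooth_map \<M> W std_atlas V \<and>
     maurer_cartan_eq G \<M> W (theta G f V)"

text \<open>\<open>g\<^sup>-\<^sup>1dg = df + [df, V]\<close>\<close>

definition framing_eq ::
  "('g::topological_space, 'e::euclidean_space, 'l::euclidean_space) lie_grp \<Rightarrow>
   ('m::topological_space, 'd::euclidean_space) chart set \<Rightarrow> 'm set \<Rightarrow>
   ('m \<Rightarrow> 'l) \<Rightarrow> ('m \<Rightarrow> 'g) \<Rightarrow> ('m \<Rightarrow> 'l) \<Rightarrow> bool" where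
  "framing_eq G \<M> W f g V \<longleftrightarrow>
     (\<forall>p\<in>W. \<forall>v\<in>tangent_space \<M> p. pullback (lg_atlas G) g (mc_form G) p v = theta G f V p v)"

definition framed_solution ::
  "('g::topological_space, 'e::euclidean_space, 'l::euclidean_space) lie_grp \<Rightarrow>
   ('k::finite \<Rightarrow> 'l) \<Rightarrow> 'l set \<Rightarrow> 'l set \<Rightarrow>
   ('m::topological_space, real ^ 'k) chart set \<Rightarrow> 'm set \<Rightarrow> ('m \<Rightarrow> 'g) \<Rightarrow> ('m \<Rightarrow> 'l) \<Rightarrow> bool" where
  "framed_solution G A \<aa> \<mm> \<M> W g V \<longleftrightarrow>
     (\<exists>f. generalized_solution G A \<aa> \<mm> \<M> W f V \<and>
          smooth_map \<M> W (lg_atlas G) g \<and> framing_eq G \<M> W f g V)"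

section \<open>The \<open>G/G\<^sub>0\<close>-exterior differential system\<close>

text \<open>\<open>Y = G \<times> \<mm>\<close> is embedded in \<open>G \<times> 'l\<close>, where \<open>'l\<close> is the Lie algebra; forms are written on
  \<open>G \<times> 'l\<close> and maps into \<open>Y\<close> are maps into \<open>G \<times> 'l\<close> whose second component lies in \<open>\<mm>\<close>.\<close>

definition Y_atlas ::
  "('g, 'e, 'l::euclidean_space) lie_grp \<Rightarrow> ('g \<times> 'l, 'e \<times> 'l) chart set" where
  "Y_atlas G = prod_atlas (lg_atlas G) std_atlas"

definition mc_Y ::
  "('g::topological_space, 'e::euclidean_space, 'l::euclidean_space) lie_grp \<Rightarrow> ('g \<times> 'l, 'l) form1" where
  "mc_Y G = pullback (lg_atlas G) fst (mc_form G)"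

definition theta_a ::
  "('g::topological_space, 'e::euclidean_space, 'l::euclidean_space) lie_grp \<Rightarrow>
   'l set \<Rightarrow> 'l set \<Rightarrow> 'l set \<Rightarrow> 'l set \<Rightarrow> ('g \<times> 'l, 'l) form1" where
  "theta_a G \<aa> \<mm> \<bb> \<nn> y w = component \<aa> (span (\<mm> \<union> \<bb> \<union> \<nn>)) (mc_Y G y w)"

definition theta_m ::
  "('g::topological_space, 'e::euclidean_space, 'l::euclidean_space) lie_grp \<Rightarrow>
   'l set \<Rightarrow> 'l set \<Rightarrow> 'l set \<Rightarrow> 'l set \<Rightarrow> ('g \<times> 'l, 'l) form1" where
  "theta_m G \<aa> \<mm> \<bb> \<nn> y w = component \<mm> (span (\<aa> \<union> \<bb> \<union> \<nn>)) (mc_Y G y w)"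

definition theta_b ::
  "('g::topological_space, 'e::euclidean_space, 'l::euclidean_space) lie_grp \<Rightarrow>
   'l set \<Rightarrow> 'l set \<Rightarrow> 'l set \<Rightarrow> 'l set \<Rightarrow> ('g \<times> 'l, 'l) form1" where
  "theta_b G \<aa> \<mm> \<bb> \<nn> y w = component \<bb> (span (\<aa> \<union> \<mm> \<union> \<nn>)) (mc_Y G y w)"

definition theta_n ::
  "('g::topological_space, 'e::euclidean_space, 'l::euclidean_space) lie_grp \<Rightarrow>
   'l set \<Rightarrow> 'l set \<Rightarrow> 'l set \<Rightarrow> 'l set \<Rightarrow> ('g \<times> 'l, 'l) form1" where
  "theta_n G \<aa> \<mm> \<bb> \<nn> y w = component \<nn> (span (\<aa> \<union> \<mm> \<union> \<bb>)) (mc_Y G y w)"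

text \<open>Element \<open>X\<close> of the Cartan tableau, as the map \<open>-ad X\<close>. The Pfaffian equation
  \<open>\<theta>\<^sub>\<bb> = [\<theta>\<^sub>\<aa>, V]\<close> reads \<open>\<theta>\<^sub>\<bb> = cartan_tableau V \<theta>\<^sub>\<aa>\<close>.\<close>

definition cartan_tableau ::
  "('g::topological_space, 'e::euclidean_space, 'l::euclidean_space) lie_grp \<Rightarrow> 'l \<Rightarrow> 'l \<Rightarrow> 'l" where
  "cartan_tableau G X A = - bracket G X A"

definition pfaffian_system ::
  "('g::topological_space, 'e::euclidean_space, 'l::euclidean_space) lie_grp \<Rightarrow>
   'l set \<Rightarrow> 'l set \<Rightarrow> 'l set \<Rightarrow> 'l set \<Rightarrow> ('g \<times> 'l, 'l) form1 set" where
  "pfaffian_system G \<aa> \<mm> \<bb> \<nn> =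
     {\<lambda>y w. theta_b G \<aa> \<mm> \<bb> \<nn> y w - cartan_tableau G (snd y) (theta_a G \<aa> \<mm> \<bb> \<nn> y w),
      theta_m G \<aa> \<mm> \<bb> \<nn>, theta_n G \<aa> \<mm> \<bb> \<nn>}"

definition immersed_in_Y ::
  "('g::topological_space, 'e::euclidean_space, 'l::euclidean_space) lie_grp \<Rightarrow> 'l set \<Rightarrow>
   ('m::topological_space, 'd::euclidean_space) chart set \<Rightarrow> 'm set \<Rightarrow> ('m \<Rightarrow> 'g) \<Rightarrow> ('m \<Rightarrow> 'l) \<Rightarrow> bool" where
  "immersed_in_Y G \<mm> \<M> W g V \<longleftrightarrow>
     (\<forall>p\<in>W. V p \<in> \<mm>) \<and> immersion \<M> W (Y_atlas G) (\<lambda>p. (g p, V p))"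

text \<open>The independence condition is \<open>(\<theta>\<^sub>\<aa>\<^sup>1 \<and> \<dots> \<and> \<theta>\<^sub>\<aa>\<^sup>k)(v\<^sub>1, \<dots>, v\<^sub>k) = det (\<theta>\<^sub>\<aa>\<^sup>i(v\<^sub>j)) \<noteq> 0\<close> for some
  tangent vectors \<open>v\<^sub>j\<close> at each point.\<close>

definition integral_manifold ::
  "('g::topological_space, 'e::euclidean_space, 'l::euclidean_space) lie_grp \<Rightarrow>
   ('k::finite \<Rightarrow> 'l) \<Rightarrow> 'l set \<Rightarrow> 'l set \<Rightarrow> 'l set \<Rightarrow> 'l set \<Rightarrow>
   ('m::topological_space, real ^ 'k) chart set \<Rightarrow> 'm set \<Rightarrow> ('m \<Rightarrow> 'g) \<Rightarrow> ('m \<Rightarrow> 'l) \<Rightarrow> bool" where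
  "integral_manifold G A \<aa> \<mm> \<bb> \<nn> \<M> W g V \<longleftrightarrow>
     immersed_in_Y G \<mm> \<M> W g V \<and>
     (\<forall>\<eta>\<in>pfaffian_system G \<aa> \<mm> \<bb> \<nn>. \<forall>p\<in>W. \<forall>v\<in>tangent_space \<M> p.
        pullback (Y_atlas G) (\<lambda>q. (g q, V q)) \<eta> p v = 0) \<and>
     (\<forall>p\<in>W. \<exists>v :: 'k \<Rightarrow> 'm tvec. (\<forall>j. v j \<in> tangent_space \<M> p) \<and>
        det (\<chi> i j. coords A (pullback (Y_atlas G) (\<lambda>q. (g q, V q)) (theta_a G \<aa> \<mm> \<bb> \<nn>) p (v j)) $ i) \<noteq> 0)"

end

theory Submission
  imports Defs
begin

text \<open>For an integral manifold, \<open>g\<^sup>-\<^sup>1dg = \<theta>\<^sub>\<aa> + [\<theta>\<^sub>\<aa>, V]\<close>. The Killing form is invariant, so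
  \<open>[\<aa>, \<gg>\<^sub>0] \<subseteq> \<mm>\<close>, and with \<open>[\<gg>\<^sub>0, \<gg>\<^sub>0] \<subseteq> \<gg>\<^sub>0\<close> the \<open>\<aa>\<close>-component of the Maurer--Cartan equation
  reduces to \<open>d\<theta>\<^sub>\<aa> = 0\<close>. By the Poincare lemma \<open>\<theta>\<^sub>\<aa> = df\<close> locally, and globally on a simply
  connected manifold; the independence condition and the inverse function theorem make \<open>f\<close> a local
  diffeomorphism. Conversely \<open>[\<aa>, \<mm>] \<subseteq> \<bb>\<close>, so \<open>g\<^sup>-\<^sup>1dg = df + [df, V]\<close> splits into
  \<open>\<theta>\<^sub>\<aa> = df\<close>, \<open>\<theta>\<^sub>\<bb> = [df, V]\<close> and \<open>\<theta>\<^sub>\<mm> = \<theta>\<^sub>\<nn> = 0\<close>.\<close>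

section \<open>Smooth functions on Euclidean spaces\<close>

text \<open>A closed form need not be exact, and this shapes the statement. For SU(2),
  \<open>V\<close> = 0 and \<open>g\<close> the inclusion of a one-parameter circle group tangent to
  \<aa>, the integral manifold is a circle, and a circle has no local diffeomorphism to a line.
  Hence the equivalences hold with one \<open>f\<close> near each point, and with a single
  \<open>f\<close> over a simply connected manifold. In the latter case no covering space is formed:
  a primitive is continued along paths, and its increment is shown to depend on the end points only.
  The symmetry of second derivatives enters the Lie theory twice. It makes the commutator of
  left-invariant fields a tangent vector, so that the bracket acts as a commutator of operators and
  the Jacobi identity follows. Applied to h \<circ> g for functions h on the group, it gives the
  structure equation of \<open>g\<^sup>-\<^sup>1dg\<close> directly on the source manifold, without
  differentiating the Maurer--Cartan form on the group itself.\<close>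

lemma Ck_on_subset: "Ck_on r S f \<Longrightarrow> T \<subseteq> S \<Longrightarrow> Ck_on r T f"
  by (induction r arbitrary: f) (auto intro: continuous_on_subset)

lemma frechet_derivative_cong_open:
  assumes "open S" "x \<in> S" "\<And>y. y \<in> S \<Longrightarrow> f y = g y"
  shows "frechet_derivative f (at x) = frechet_derivative g (at x)"
proof -
  have "(f has_derivative D) (at x) \<longleftrightarrow> (g has_derivative D) (at x)" for D
    using assms by (metis has_derivative_transform_within_open)
  then show ?thesis unfolding frechet_derivative_def by simp
qed

lemma differentiable_cong_open:
  assumes "open S" "x \<in> S" "\<And>y. y \<in> S \<Longrightarrow> f y = g y"
  shows "f differentiable (at x) \<longleftrightarrow> g differentiable (at x)"
  unfolding differentiable_def using assms by (metis has_derivative_transform_within_open)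

text \<open>Derivatives are taken \<open>at x\<close> in the ambient space, not within
  \<open>S\<close>; openness of \<open>S\<close> is what makes them depend on the values on
  \<open>S\<close> alone.\<close>

lemma Ck_on_cong:
  assumes "open S" "\<And>x. x \<in> S \<Longrightarrow> f x = g x"
  shows "Ck_on r S f \<longleftrightarrow> Ck_on r S g"
  using assms(2)
proof (induction r arbitrary: f g)
  case 0
  then show ?case by (auto intro: continuous_on_cong[THEN iffD1])
next
  case (Suc r)
  have "Ck_on r S (\<lambda>x. frechet_derivative f (at x) v) \<longleftrightarrow> Ck_on r S (\<lambda>x. frechet_derivative g (at x) v)" for v
    using Suc.prems by (intro Suc.IH) (metis frechet_derivative_cong_open assms(1))
  moreover have "f differentiable at x \<longleftrightarrow> g differentiable at x" if "x \<in> S" for x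
    using Suc.prems that assms(1) by (intro differentiable_cong_open) auto
  ultimately show ?case by simp
qed

text \<open>Lets a derivative computed by hand stand in for the chosen
  \<open>frechet_derivative\<close>; most closure properties below are inductions on
  \<open>r\<close> that end in this rule.\<close>

lemma Ck_on_SucI:
  assumes S: "open S" and D: "\<And>x. x \<in> S \<Longrightarrow> (f has_derivative D x) (at x)"
    and C: "\<And>v. Ck_on r S (\<lambda>x. D x v)"
  shows "Ck_on (Suc r) S f"
proof -
  have eq: "frechet_derivative f (at x) = D x" if "x \<in> S" for x
    using frechet_derivative_at[OF D[OF that]] by simp
  have "Ck_on r S (\<lambda>x. frechet_derivative f (at x) v)" for v
    by (rule Ck_on_cong[OF S, THEN iffD1, OF _ C]) (simp add: eq)
  then show ?thesis using D by (auto intro: differentiableI)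
qed

lemma Ck_on_SucD: "Ck_on (Suc r) S f \<Longrightarrow> Ck_on r S f"
proof (induction r arbitrary: f)
  case 0
  then show ?case
    by (simp add: continuous_at_imp_continuous_on differentiable_imp_continuous_within)
next
  case (Suc r)
  then show ?case by (metis Ck_on.simps(2))
qed

lemma Ck_on_imp_continuous_on: "Ck_on r S f \<Longrightarrow> continuous_on S f"
proof (induction r)
  case (Suc r)
  then show ?case using Ck_on_SucD by blast
qed simp

text \<open>Peeling off one derivative yields the levels \<open>Suc r\<close> only;
  \<open>Ck_on_SucD\<close> supplies level 0. With the index gone, smooth functions can be
  differentiated repeatedly without bookkeeping.\<close>

lemma smooth_on_iff_derivs:
  "smooth_on S f \<longleftrightarrow> (\<forall>x\<in>S. f differentiable (at x)) \<and>
     (\<forall>v. smooth_on S (\<lambda>x. frechet_derivative f (at x) v))"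
  unfolding smooth_on_def by (metis Ck_on.simps(2) Ck_on_SucD)

lemma smooth_on_differentiable: "smooth_on S f \<Longrightarrow> x \<in> S \<Longrightarrow> f differentiable (at x)"
  using smooth_on_iff_derivs by blast

lemma smooth_on_has_derivative:
  "smooth_on S f \<Longrightarrow> x \<in> S \<Longrightarrow> (f has_derivative frechet_derivative f (at x)) (at x)"
  using smooth_on_differentiable frechet_derivative_works by blast

lemma smooth_on_deriv: "smooth_on S f \<Longrightarrow> smooth_on S (\<lambda>x. frechet_derivative f (at x) v)"
  using smooth_on_iff_derivs by blast

lemma smooth_on_subset: "smooth_on S f \<Longrightarrow> T \<subseteq> S \<Longrightarrow> smooth_on T f"
  unfolding smooth_on_def using Ck_on_subset by blast

lemma smooth_on_imp_continuous_on: "smooth_on S f \<Longrightarrow> continuous_on S f"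
  unfolding smooth_on_def using Ck_on_imp_continuous_on by blast

lemma smooth_on_cong:
  assumes "open S" "\<And>x. x \<in> S \<Longrightarrow> f x = g x"
  shows "smooth_on S f \<longleftrightarrow> smooth_on S g"
  unfolding smooth_on_def using Ck_on_cong[of S f g] assms by simp

text \<open>Each level of \<open>Ck_on\<close> is a condition point by point on ambient derivatives,
  so it can be tested in a neighbourhood of each point.\<close>

lemma Ck_on_local:
  assumes "\<And>x. x \<in> S \<Longrightarrow> \<exists>T. open T \<and> x \<in> T \<and> Ck_on r T f"
  shows "Ck_on r S f"
  using assms
proof (induction r arbitrary: f)
  case 0
  then show ?case
    by simp (metis continuous_at_imp_continuous_on continuous_on_eq_continuous_at)
next
  case (Suc r)
  show ?case
    unfolding Ck_on.simps
  proof (intro conjI ballI allI)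
    show "f differentiable at x" if "x \<in> S" for x
      using Suc.prems[OF that] by auto
    show "Ck_on r S (\<lambda>x. frechet_derivative f (at x) v)" for v
      by (rule Suc.IH) (use Suc.prems in fastforce)
  qed
qed

lemma smooth_on_local:
  assumes "\<And>x. x \<in> S \<Longrightarrow> \<exists>T. open T \<and> x \<in> T \<and> smooth_on T f"
  shows "smooth_on S f"
  unfolding smooth_on_def
proof
  fix r show "Ck_on r S f"
    by (rule Ck_on_local) (use assms in \<open>unfold smooth_on_def, blast\<close>)
qed

lemma Ck_on_const: "Ck_on r S (\<lambda>x. c)"
proof (induction r arbitrary: c)
  case (Suc r)
  then show ?case by simp
qed simp

lemma smooth_on_const [simp]: "smooth_on S (\<lambda>x. c)"
  by (simp add: smooth_on_def Ck_on_const)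

lemma Ck_on_bounded_linear:
  assumes L: "bounded_linear L" and S: "open S"
  shows "Ck_on r S f \<Longrightarrow> Ck_on r S (\<lambda>x. L (f x))"
proof (induction r arbitrary: f)
  case 0
  then show ?case
    using L by (simp add: bounded_linear.continuous_on)
next
  case (Suc r)
  have D: "((\<lambda>x. L (f x)) has_derivative (\<lambda>v. L (frechet_derivative f (at x) v))) (at x)" if "x \<in> S" for x
    using Suc.prems that by (intro bounded_linear.has_derivative[OF L]) (simp add: frechet_derivative_works[symmetric])
  have "Ck_on r S (\<lambda>x. L (frechet_derivative f (at x) v))" for v
    using Suc by simp
  with D show ?case by (rule Ck_on_SucI[OF S])
qed

lemma smooth_on_bounded_linear:
  "bounded_linear L \<Longrightarrow> open S \<Longrightarrow> smooth_on S f \<Longrightarrow> smooth_on S (\<lambda>x. L (f x))"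
  by (simp add: smooth_on_def Ck_on_bounded_linear)

lemma Ck_on_ident: "open S \<Longrightarrow> Ck_on r S (\<lambda>x. x)"
proof (cases r)
  case (Suc n)
  assume "open S"
  then show ?thesis using Suc by (simp add: Ck_on_const)
qed simp

lemma smooth_on_ident: "open S \<Longrightarrow> smooth_on S (\<lambda>x. x)"
  by (simp add: smooth_on_def Ck_on_ident)

lemma smooth_on_linear: "bounded_linear L \<Longrightarrow> open S \<Longrightarrow> smooth_on S L"
  using smooth_on_bounded_linear[OF _ _ smooth_on_ident] by blast

lemma Ck_on_add:
  assumes S: "open S"
  shows "Ck_on r S f \<Longrightarrow> Ck_on r S g \<Longrightarrow> Ck_on r S (\<lambda>x. f x + g x)"
proof (induction r arbitrary: f g)
  case 0
  then show ?case by (simp add: continuous_on_add)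
next
  case (Suc r)
  have D: "((\<lambda>x. f x + g x) has_derivative (\<lambda>v. frechet_derivative f (at x) v + frechet_derivative g (at x) v)) (at x)" if "x \<in> S" for x
    using Suc.prems that by (intro has_derivative_add) (simp_all add: frechet_derivative_works[symmetric])
  have "Ck_on r S (\<lambda>x. frechet_derivative f (at x) v + frechet_derivative g (at x) v)" for v
    using Suc by simp
  with D show ?case by (rule Ck_on_SucI[OF S])
qed

lemma smooth_on_add:
  "open S \<Longrightarrow> smooth_on S f \<Longrightarrow> smooth_on S g \<Longrightarrow> smooth_on S (\<lambda>x. f x + g x)"
  by (simp add: smooth_on_def Ck_on_add)

lemma Ck_on_bilinear:
  assumes B: "bounded_bilinear B" and S: "open S"
  shows "Ck_on r S f \<Longrightarrow> Ck_on r S g \<Longrightarrow> Ck_on r S (\<lambda>x. B (f x) (g x))"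
proof (induction r arbitrary: f g)
  case 0
  then show ?case by (simp add: bounded_bilinear.continuous_on[OF B])
next
  case (Suc r)
  have D: "((\<lambda>x. B (f x) (g x)) has_derivative (\<lambda>v. B (f x) (frechet_derivative g (at x) v) + B (frechet_derivative f (at x) v) (g x))) (at x)" if "x \<in> S" for x
    using Suc.prems that by (intro bounded_bilinear.FDERIV[OF B]) (simp_all add: frechet_derivative_works[symmetric])
  have "Ck_on r S (\<lambda>x. B (f x) (frechet_derivative g (at x) v) + B (frechet_derivative f (at x) v) (g x))" for v
    \<comment> \<open>Each term of the product rule leaves one factor undifferentiated; that factor
      is lowered by one order before the induction hypothesis applies.\<close>
    using Suc.prems Ck_on_SucD[OF Suc.prems(1)] Ck_on_SucD[OF Suc.prems(2)]
    by (intro Ck_on_add[OF S] Suc.IH) simp_all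
  with D show ?case by (rule Ck_on_SucI[OF S])
qed

lemma smooth_on_bilinear:
  "bounded_bilinear B \<Longrightarrow> open S \<Longrightarrow> smooth_on S f \<Longrightarrow> smooth_on S g \<Longrightarrow> smooth_on S (\<lambda>x. B (f x) (g x))"
  by (simp add: smooth_on_def Ck_on_bilinear)

lemmas smooth_on_scaleR = smooth_on_bilinear[OF bounded_bilinear_scaleR]
lemmas smooth_on_mult = smooth_on_bilinear[OF bounded_bilinear_mult]

lemma Ck_on_sum:
  assumes "open S" "\<And>i. i \<in> I \<Longrightarrow> Ck_on r S (f i)"
  shows "Ck_on r S (\<lambda>x. \<Sum>i\<in>I. f i x)"
  using assms(2)
  by (induction I rule: infinite_finite_induct) (auto intro: Ck_on_const Ck_on_add[OF assms(1)])

lemma smooth_on_sum: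
  assumes "open S" "\<And>i. i \<in> I \<Longrightarrow> smooth_on S (f i)"
  shows "smooth_on S (\<lambda>x. \<Sum>i\<in>I. f i x)"
  using assms by (simp add: smooth_on_def Ck_on_sum)

lemma smooth_on_prod:
  fixes f :: "'i \<Rightarrow> 'a::euclidean_space \<Rightarrow> real"
  assumes "open S" "\<And>i. i \<in> I \<Longrightarrow> smooth_on S (f i)"
  shows "smooth_on S (\<lambda>x. \<Prod>i\<in>I. f i x)"
  using assms(2)
  by (induction I rule: infinite_finite_induct) (auto intro: smooth_on_mult[OF assms(1)])

text \<open>\<open>Ck_on\<close> controls derivatives in fixed directions only, whereas the chain
  rule differentiates \<open>g\<close> in the direction
  \<open>frechet_derivative f (at x) v\<close>, which moves with \<open>x\<close>. Expanding this
  direction in \<open>Basis\<close> leaves fixed directions with varying coefficients.\<close>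

lemma Ck_on_compose:
  fixes f :: "'a::euclidean_space \<Rightarrow> 'b::euclidean_space" and g :: "'b \<Rightarrow> 'c::real_normed_vector"
  assumes S: "open S" and T: "open T" and im: "f ` S \<subseteq> T"
  shows "Ck_on r S f \<Longrightarrow> Ck_on r T g \<Longrightarrow> Ck_on r S (\<lambda>x. g (f x))"
proof (induction r arbitrary: g)
  case 0
  then show ?case using im by (auto intro: continuous_on_compose2)
next
  case (Suc r)
  let ?D = "\<lambda>x v. \<Sum>b\<in>Basis. (frechet_derivative f (at x) v \<bullet> b) *\<^sub>R frechet_derivative g (at (f x)) b"
  have D: "((\<lambda>x. g (f x)) has_derivative ?D x) (at x)" if "x \<in> S" for x
  proof -
    have f: "(f has_derivative frechet_derivative f (at x)) (at x)"
      using Suc.prems that by (simp add: frechet_derivative_works[symmetric])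
    have g: "(g has_derivative frechet_derivative g (at (f x))) (at (f x))"
      using Suc.prems that im by (simp add: frechet_derivative_works[symmetric] image_subset_iff)
    have lin: "linear (frechet_derivative g (at (f x)))"
      using g has_derivative_linear by blast
    have "frechet_derivative g (at (f x)) w = (\<Sum>b\<in>Basis. (w \<bullet> b) *\<^sub>R frechet_derivative g (at (f x)) b)" for w
      by (subst euclidean_representation[of w, symmetric])
         (simp add: linear_sum[OF lin] linear_scale[OF lin])
    then have "?D x = (\<lambda>v. frechet_derivative g (at (f x)) (frechet_derivative f (at x) v))"
      by (intro ext) (rule sym)
    then show ?thesis
      using has_derivative_compose[OF f g] by (simp only:)
  qed
  have "Ck_on r S (\<lambda>x. frechet_derivative g (at (f x)) b)" for b
    using Suc.prems Ck_on_SucD[OF Suc.prems(1)]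
    by (intro Suc.IH[of "\<lambda>y. frechet_derivative g (at y) b"]) simp_all
  then have "Ck_on r S (\<lambda>x. ?D x v)" for v
    using Suc.prems
    by (intro Ck_on_sum[OF S] Ck_on_bilinear[OF bounded_bilinear_scaleR S]
         Ck_on_bounded_linear[OF bounded_linear_inner_left S]) simp_all
  with D show ?case by (rule Ck_on_SucI[OF S])
qed

lemma smooth_on_compose:
  fixes f :: "'a::euclidean_space \<Rightarrow> 'b::euclidean_space" and g :: "'b \<Rightarrow> 'c::real_normed_vector"
  assumes "open S" "open T" "f ` S \<subseteq> T" "smooth_on S f" "smooth_on T g"
  shows "smooth_on S (\<lambda>x. g (f x))"
  using assms Ck_on_compose by (metis smooth_on_def)

lemma smooth_on_Pair:
  assumes "open S" "smooth_on S f" "smooth_on S g"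
  shows "smooth_on S (\<lambda>x. (f x, g x))"
proof -
  have "bounded_linear (\<lambda>x::'b. (x, 0::'c))" "bounded_linear (\<lambda>y::'c. (0::'b, y))"
    by (simp_all add: bounded_linear_Pair bounded_linear_ident bounded_linear_zero)
  then have "smooth_on S (\<lambda>x. (f x, 0) + (0, g x))"
    using assms by (intro smooth_on_add smooth_on_bounded_linear[of "\<lambda>x. (x,0)"] smooth_on_bounded_linear[of "\<lambda>x. (0,x)"]) auto
  then show ?thesis by simp
qed

lemma smooth_on_componentwise:
  fixes f :: "'a::euclidean_space \<Rightarrow> 'b::euclidean_space"
  assumes "open S" "\<And>b. b \<in> Basis \<Longrightarrow> smooth_on S (\<lambda>x. f x \<bullet> b)"
  shows "smooth_on S f"
proof -
  have "smooth_on S (\<lambda>x. \<Sum>b\<in>Basis. (f x \<bullet> b) *\<^sub>R b)"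
    using assms by (intro smooth_on_sum smooth_on_scaleR) auto
  then show ?thesis by (simp add: euclidean_representation)
qed

text \<open>The derivative - v / x^2 is again a product of two copies of \<open>inverse\<close> and
  a constant, so the induction on the order feeds on itself.\<close>

lemma smooth_on_inverse: "smooth_on {x::real. x \<noteq> 0} inverse"
proof -
  let ?S = "{x::real. x \<noteq> 0}"
  have S: "open ?S" by (simp add: open_Collect_neq)
  have "Ck_on r ?S inverse" for r
  proof (induction r)
    case 0
    then show ?case by (simp add: continuous_on_inverse)
  next
    case (Suc r)
    have D: "(inverse has_derivative (\<lambda>v. - (inverse x * v * inverse x))) (at x)" if "x \<noteq> 0" for x :: real
      using that by (rule has_derivative_inverse')
    show ?case unfolding Ck_on.simps
    proof (intro conjI ballI allI)
      show "inverse differentiable at x" if "x \<in> ?S" for x :: real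
        using D[of x] that by (auto intro: differentiableI)
      fix v :: real
      have "Ck_on r ?S (\<lambda>x. (- v) * (inverse x * inverse x))"
        using Suc.IH by (intro Ck_on_bilinear[OF bounded_bilinear_mult S] Ck_on_const)
      then show "Ck_on r ?S (\<lambda>x. frechet_derivative inverse (at x) v)"
        by (rule Ck_on_cong[OF S, THEN iffD1, rotated])
           (use D in \<open>auto simp: frechet_derivative_at[OF D, symmetric]\<close>)
    qed
  qed
  then show ?thesis by (simp add: smooth_on_def)
qed

lemma smooth_on_divide:
  fixes f g :: "'a::euclidean_space \<Rightarrow> real"
  assumes "open S" "smooth_on S f" "smooth_on S g" "\<And>x. x \<in> S \<Longrightarrow> g x \<noteq> 0"
  shows "smooth_on S (\<lambda>x. f x / g x)"
  unfolding divide_inverse using assms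
  by (intro smooth_on_mult smooth_on_compose[OF _ _ _ _ smooth_on_inverse])
     (auto simp: open_Collect_neq)

section \<open>Second derivatives, closed 1-forms and local inverses\<close>

lemma has_real_derivative_along_line:
  fixes f :: "'a::euclidean_space \<Rightarrow> real"
  assumes "f differentiable (at (y + s *\<^sub>R u))"
  shows "((\<lambda>s. f (y + s *\<^sub>R u)) has_real_derivative frechet_derivative f (at (y + s *\<^sub>R u)) u) (at s)"
proof -
  have f: "(f has_derivative frechet_derivative f (at (y + s *\<^sub>R u))) (at (y + s *\<^sub>R u))"
    using assms frechet_derivative_works by blast
  have "((\<lambda>s. y + s *\<^sub>R u) has_derivative (\<lambda>h. h *\<^sub>R u)) (at s)"
    by (auto intro!: derivative_eq_intros)
  from has_derivative_compose[OF this f]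
  have "((\<lambda>s. f (y + s *\<^sub>R u)) has_derivative (\<lambda>h. frechet_derivative f (at (y + s *\<^sub>R u)) (h *\<^sub>R u))) (at s)" .
  moreover have "(\<lambda>h. frechet_derivative f (at (y + s *\<^sub>R u)) (h *\<^sub>R u)) = (\<lambda>h. frechet_derivative f (at (y + s *\<^sub>R u)) u * h)"
    using linear_scale[OF linear_frechet_derivative[OF assms]] by (simp add: mult.commute)
  ultimately show ?thesis by (simp add: has_field_derivative_def)
qed

text \<open>The mean value theorem is used twice: in direction \<open>u\<close> for the difference
  f(x + s u + e v) - f(x + s u), and in direction \<open>v\<close> for the derivative that this
  produces. The left-hand side is symmetric in \<open>u\<close> and \<open>v\<close>, the right-hand
  side is a mixed derivative in a definite order.\<close>

lemma second_difference_mvt: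
  fixes f :: "'a::euclidean_space \<Rightarrow> real"
  assumes e: "0 < e" and f: "smooth_on S f"
    and S: "\<And>s t. 0 \<le> s \<Longrightarrow> s \<le> e \<Longrightarrow> 0 \<le> t \<Longrightarrow> t \<le> e \<Longrightarrow> x + s *\<^sub>R u + t *\<^sub>R v \<in> S"
  shows "\<exists>s t. 0 \<le> s \<and> s \<le> e \<and> 0 \<le> t \<and> t \<le> e \<and>
    f (x + e *\<^sub>R u + e *\<^sub>R v) - f (x + e *\<^sub>R u) - f (x + e *\<^sub>R v) + f x =
    e * e * frechet_derivative (\<lambda>y. frechet_derivative f (at y) u) (at (x + s *\<^sub>R u + t *\<^sub>R v)) v"
proof -
  let ?D = "\<lambda>y. frechet_derivative f (at y) u"
  have d: "f differentiable (at (x + s *\<^sub>R u + t *\<^sub>R v))" "?D differentiable (at (x + s *\<^sub>R u + t *\<^sub>R v))"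
    if "0 \<le> s" "s \<le> e" "0 \<le> t" "t \<le> e" for s t
    using S[OF that] f smooth_on_deriv[OF f] smooth_on_differentiable by blast+
  have 1: "((\<lambda>s. f (x + s *\<^sub>R u + t *\<^sub>R v)) has_real_derivative ?D (x + s *\<^sub>R u + t *\<^sub>R v)) (at s)"
    if "0 \<le> s" "s \<le> e" "0 \<le> t" "t \<le> e" for s t
    using has_real_derivative_along_line[of f "x + t *\<^sub>R v" s u] d(1)[OF that] by (simp add: add_ac)
  have "\<exists>z>0. z < e \<and> (f (x + e *\<^sub>R u + e *\<^sub>R v) - f (x + e *\<^sub>R u)) - (f (x + 0 *\<^sub>R u + e *\<^sub>R v) - f (x + 0 *\<^sub>R u))
      = (e - 0) * (?D (x + z *\<^sub>R u + e *\<^sub>R v) - ?D (x + z *\<^sub>R u))"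
    using 1[of _ e] 1[of _ 0] e by (intro MVT2) (auto intro!: DERIV_diff)
  then obtain s where s: "0 < s" "s < e"
    and eq1: "f (x + e *\<^sub>R u + e *\<^sub>R v) - f (x + e *\<^sub>R u) - f (x + e *\<^sub>R v) + f x
      = e * (?D (x + s *\<^sub>R u + e *\<^sub>R v) - ?D (x + s *\<^sub>R u))" by auto
  have "\<exists>z>0. z < e \<and> ?D (x + s *\<^sub>R u + e *\<^sub>R v) - ?D (x + s *\<^sub>R u + 0 *\<^sub>R v)
      = (e - 0) * frechet_derivative ?D (at (x + s *\<^sub>R u + z *\<^sub>R v)) v"
    using s d(2) e by (intro MVT2 has_real_derivative_along_line) auto
  then obtain t where "0 < t" "t < e" "?D (x + s *\<^sub>R u + e *\<^sub>R v) - ?D (x + s *\<^sub>R u)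
      = e * frechet_derivative ?D (at (x + s *\<^sub>R u + t *\<^sub>R v)) v" by auto
  with eq1 s show ?thesis
    by (intro exI[of _ s] exI[of _ t]) (simp add: mult.assoc)
qed

text \<open>The second difference is symmetric in \<open>u\<close> and \<open>v\<close>, so
  arbitrarily close to \<open>x\<close> there are two points at which one mixed derivative takes the
  same value as the other. Continuity excludes this if the two differ at \<open>x\<close>.\<close>

lemma smooth_on_second_derivative_commute_real:
  fixes f :: "'a::euclidean_space \<Rightarrow> real"
  assumes S: "open S" and f: "smooth_on S f" and x: "x \<in> S"
  shows "frechet_derivative (\<lambda>y. frechet_derivative f (at y) u) (at x) v =
    frechet_derivative (\<lambda>y. frechet_derivative f (at y) v) (at x) u"
proof (rule ccontr)
  define E1 where "E1 = (\<lambda>x. frechet_derivative (\<lambda>y. frechet_derivative f (at y) u) (at x) v)"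
  define E2 where "E2 = (\<lambda>x. frechet_derivative (\<lambda>y. frechet_derivative f (at y) v) (at x) u)"
  assume "\<not> ?thesis"
  then have pos: "0 < \<bar>E1 x - E2 x\<bar> / 2" by (simp add: E1_def E2_def)
  have "continuous_on S E1" "continuous_on S E2"
    unfolding E1_def E2_def by (intro smooth_on_imp_continuous_on smooth_on_deriv f)+
  then have "isCont E1 x" "isCont E2 x"
    using S x continuous_on_eq_continuous_at by blast+
  then obtain d1 d2 where d: "0 < d1" "\<And>y. dist y x < d1 \<Longrightarrow> dist (E1 y) (E1 x) < \<bar>E1 x - E2 x\<bar> / 2"
      "0 < d2" "\<And>y. dist y x < d2 \<Longrightarrow> dist (E2 y) (E2 x) < \<bar>E1 x - E2 x\<bar> / 2"
    unfolding continuous_at_eps_delta using pos by metis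
  obtain d3 where d3: "0 < d3" "ball x d3 \<subseteq> S" using S x open_contains_ball by blast
  define r where "r = min d1 (min d2 d3)"
  have r: "0 < r" "r \<le> d1" "r \<le> d2" "r \<le> d3" using d d3 by (auto simp: r_def)
  \<comment> \<open>The summand 1 keeps \<open>N\<close> positive when \<open>u\<close> and
    \<open>v\<close> vanish; side length \<open>r / N\<close> puts the parallelogram inside the ball
    of radius \<open>r\<close>.\<close>
  define N where "N = norm u + norm v + 1"
  have N: "N > 0" unfolding N_def using norm_ge_zero[of u] norm_ge_zero[of v] by linarith
  define e where "e = r / N"
  have e: "0 < e" using r N by (simp add: e_def)
  \<comment> \<open>The condition on the norms lets one estimate serve for both orders of
    \<open>u\<close> and \<open>v\<close>.\<close>
  have near: "dist (x + s *\<^sub>R a + t *\<^sub>R b) x < r"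
    if "0 \<le> s" "s \<le> e" "0 \<le> t" "t \<le> e" "norm a + norm b = norm u + norm v" for s t a b
  proof -
    have "dist (x + s *\<^sub>R a + t *\<^sub>R b) x \<le> norm (s *\<^sub>R a) + norm (t *\<^sub>R b)"
      using norm_triangle_ineq[of "s *\<^sub>R a" "t *\<^sub>R b"] by (simp add: dist_norm add.assoc)
    also have "\<dots> \<le> e * norm a + e * norm b"
      using that by (intro add_mono) (auto intro: mult_right_mono)
    also have "\<dots> = e * (norm u + norm v)" using that by (simp add: distrib_left[symmetric])
    also have "\<dots> < e * N" using e by (simp add: N_def)
    also have "\<dots> = r" using N by (simp add: e_def)
    finally show ?thesis .
  qed
  have inS: "x + s *\<^sub>R a + t *\<^sub>R b \<in> S"
    if "0 \<le> s" "s \<le> e" "0 \<le> t" "t \<le> e" "norm a + norm b = norm u + norm v" for s t a b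
    using near[OF that] r d3 by (auto simp: dist_commute subset_iff)
  obtain s t where st: "0 \<le> s" "s \<le> e" "0 \<le> t" "t \<le> e"
    "f (x + e *\<^sub>R u + e *\<^sub>R v) - f (x + e *\<^sub>R u) - f (x + e *\<^sub>R v) + f x = e * e * E1 (x + s *\<^sub>R u + t *\<^sub>R v)"
    using second_difference_mvt[OF e f inS, of u v] unfolding E1_def by auto
  obtain s' t' where st': "0 \<le> s'" "s' \<le> e" "0 \<le> t'" "t' \<le> e"
    "f (x + e *\<^sub>R v + e *\<^sub>R u) - f (x + e *\<^sub>R v) - f (x + e *\<^sub>R u) + f x = e * e * E2 (x + s' *\<^sub>R v + t' *\<^sub>R u)"
    using second_difference_mvt[OF e f inS, of v u] unfolding E2_def by auto
  have "e * e * E1 (x + s *\<^sub>R u + t *\<^sub>R v) = e * e * E2 (x + s' *\<^sub>R v + t' *\<^sub>R u)"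
    using st(5) st'(5) unfolding add.assoc[of x "e *\<^sub>R v"] add.commute[of "e *\<^sub>R v"] add.assoc[of x "e *\<^sub>R u", symmetric]
    by linarith
  then have "E1 (x + s *\<^sub>R u + t *\<^sub>R v) = E2 (x + s' *\<^sub>R v + t' *\<^sub>R u)" using e by simp
  moreover have "dist (E1 (x + s *\<^sub>R u + t *\<^sub>R v)) (E1 x) < \<bar>E1 x - E2 x\<bar> / 2"
    using near[OF st(1-4), of u v] r by (intro d(2)) auto
  moreover have "dist (E2 (x + s' *\<^sub>R v + t' *\<^sub>R u)) (E2 x) < \<bar>E1 x - E2 x\<bar> / 2"
    using near[OF st'(1-4), of v u] r by (intro d(4)) auto
  \<comment> \<open>No number is closer than half the gap to both ends of an interval.\<close>
  moreover have "\<not> (\<bar>a - p\<bar> < \<bar>p - q\<bar> / 2 \<and> \<bar>a - q\<bar> < \<bar>p - q\<bar> / 2)" for a p q :: real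
    by (auto simp: abs_if field_simps split: if_splits)
  ultimately show False unfolding dist_real_def by metis
qed

lemma frechet_derivative_bounded_linear:
  assumes "bounded_linear L" "f differentiable (at x)"
  shows "frechet_derivative (\<lambda>y. L (f y)) (at x) = (\<lambda>v. L (frechet_derivative f (at x) v))"
  using bounded_linear.has_derivative[OF assms(1)] assms(2) frechet_derivative_works frechet_derivative_at by metis

lemma smooth_on_second_derivative_commute:
  fixes f :: "'a::euclidean_space \<Rightarrow> 'b::euclidean_space"
  assumes S: "open S" and f: "smooth_on S f" and x: "x \<in> S"
  shows "frechet_derivative (\<lambda>y. frechet_derivative f (at y) u) (at x) v =
    frechet_derivative (\<lambda>y. frechet_derivative f (at y) v) (at x) u"
proof (rule euclidean_eqI)
  fix b :: 'b assume b: "b \<in> Basis"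
  let ?L = "\<lambda>z::'b. z \<bullet> b"
  have L: "bounded_linear ?L" by (rule bounded_linear_inner_left)
  have *: "frechet_derivative (\<lambda>y. frechet_derivative f (at y) u) (at x) v \<bullet> b
     = frechet_derivative (\<lambda>y. frechet_derivative (\<lambda>z. f z \<bullet> b) (at y) u) (at x) v" for u v
  proof -
    have "frechet_derivative (\<lambda>y. frechet_derivative f (at y) u) (at x) v \<bullet> b
      = frechet_derivative (\<lambda>y. frechet_derivative f (at y) u \<bullet> b) (at x) v"
      using frechet_derivative_bounded_linear[OF L smooth_on_differentiable[OF smooth_on_deriv[OF f] x]] by simp
    also have "frechet_derivative (\<lambda>y. frechet_derivative f (at y) u \<bullet> b) (at x) =
       frechet_derivative (\<lambda>y. frechet_derivative (\<lambda>z. f z \<bullet> b) (at y) u) (at x)"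
      using frechet_derivative_bounded_linear[OF L smooth_on_differentiable[OF f]]
      by (intro frechet_derivative_cong_open[OF S x]) simp
    finally show ?thesis .
  qed
  show "frechet_derivative (\<lambda>y. frechet_derivative f (at y) u) (at x) v \<bullet> b =
    frechet_derivative (\<lambda>y. frechet_derivative f (at y) v) (at x) u \<bullet> b"
    unfolding * by (rule smooth_on_second_derivative_commute_real[OF S _ x])
      (rule smooth_on_bounded_linear[OF L S f])
qed

lemma smooth_onI_has_derivative:
  assumes S: "open S" and D: "\<And>x. x \<in> S \<Longrightarrow> (f has_derivative D x) (at x)"
    and sm: "\<And>v. smooth_on S (\<lambda>x. D x v)"
  shows "smooth_on S f"
  unfolding smooth_on_def
proof
  fix r
  have "Ck_on (Suc r) S f"
    using D sm by (intro Ck_on_SucI[OF S]) (auto simp: smooth_on_def)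
  then show "Ck_on r S f" by (rule Ck_on_SucD)
qed


text \<open>Homotopy operator for the contraction of \<open>S\<close> to \<open>c\<close> along
  segments: f x is the integral over t in [0,1] of \<Theta> (c + t (x - c)) (x - c).\<close>

lemma poincare_lemma:
  fixes \<Theta> :: "'a::euclidean_space \<Rightarrow> 'a \<Rightarrow> 'b::euclidean_space"
  assumes S: "open S" "convex S" "c \<in> S"
    and lin: "\<And>x. x \<in> S \<Longrightarrow> linear (\<Theta> x)"
    and sm: "\<And>w. smooth_on S (\<lambda>x. \<Theta> x w)"
    and closed: "\<And>x u w. x \<in> S \<Longrightarrow>
      frechet_derivative (\<lambda>y. \<Theta> y w) (at x) u = frechet_derivative (\<lambda>y. \<Theta> y u) (at x) w"
  shows "\<exists>f. \<forall>x\<in>S. (f has_derivative \<Theta> x) (at x)"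
proof -
  define \<gamma> where "\<gamma> = (\<lambda>x t. c + t *\<^sub>R (x - c))"
  define F where "F = (\<lambda>x t. \<Theta> (\<gamma> x t) (x - c))"
  \<comment> \<open>The derivative of \<open>F x t\<close> with respect to \<open>x\<close> in
    direction \<open>h\<close>. Its second term arises as t times the derivative of \<Theta> applied
    to \<open>x - c\<close>, taken in direction \<open>h\<close>; closedness swaps the two vectors,
    and the sum becomes the t-derivative of t \<Theta> (\<gamma> x t) h.\<close>
  define DF where "DF = (\<lambda>x t h. \<Theta> (\<gamma> x t) h + t *\<^sub>R frechet_derivative (\<lambda>y. \<Theta> y h) (at (\<gamma> x t)) (x - c))"
  have \<gamma>S: "\<gamma> x t \<in> S" if "x \<in> S" "t \<in> {0..1}" for x t
  proof -
    have "\<gamma> x t = (1 - t) *\<^sub>R c + t *\<^sub>R x" by (simp add: \<gamma>_def algebra_simps)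
    then show ?thesis using convexD[OF S(2,3) that(1), of "1 - t" t] that(2) by simp
  qed
  \<comment> \<open>Smoothness of \<Theta> is assumed for each fixed second argument; expanding
    \<open>h\<close> in \<open>Basis\<close> reduces a moving argument such as \<open>x - c\<close>
    to these.\<close>
  have expand: "\<Theta> y h = (\<Sum>b\<in>Basis. (h \<bullet> b) *\<^sub>R \<Theta> y b)" if "y \<in> S" for y h
    using linear_sum[OF lin[OF that], of "\<lambda>b. (h \<bullet> b) *\<^sub>R b" Basis] linear_scale[OF lin[OF that]]
    by (simp add: euclidean_representation)
  have has: "((\<lambda>y. \<Theta> y w) has_derivative frechet_derivative (\<lambda>y. \<Theta> y w) (at x)) (at x)" if "x \<in> S" for x w
    using smooth_on_has_derivative[OF sm that] .
  have lin': "linear (frechet_derivative (\<lambda>y. \<Theta> y w) (at x))" if "x \<in> S" for x w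
    using has[OF that] has_derivative_linear by blast
  \<comment> \<open>Linearity in \<open>h\<close> is obtained by exchanging the two vectors through
    closedness, since a derivative is linear in its direction.\<close>
  have expand': "frechet_derivative (\<lambda>y. \<Theta> y h) (at y) u = (\<Sum>b\<in>Basis. (h \<bullet> b) *\<^sub>R frechet_derivative (\<lambda>y. \<Theta> y b) (at y) u)"
    if y: "y \<in> S" for y h u
  proof -
    have "frechet_derivative (\<lambda>y. \<Theta> y u) (at y) h
      = (\<Sum>b\<in>Basis. (h \<bullet> b) *\<^sub>R frechet_derivative (\<lambda>y. \<Theta> y u) (at y) b)"
      using linear_sum[OF lin'[OF y, of u], of "\<lambda>b. (h \<bullet> b) *\<^sub>R b" Basis] linear_scale[OF lin'[OF y, of u]]
      by (simp add: euclidean_representation)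
    then show ?thesis by (simp add: closed[OF y, of u])
  qed
  have Dx: "((\<lambda>x. F x t) has_derivative DF x t) (at x)" if x: "x \<in> S" and t: "t \<in> {0..1}" for x t
  proof -
    have \<gamma>': "((\<lambda>x. \<gamma> x t) has_derivative (\<lambda>h. t *\<^sub>R h)) (at x)"
      unfolding \<gamma>_def by (auto intro!: derivative_eq_intros)
    have "((\<lambda>x. \<Theta> (\<gamma> x t) b) has_derivative (\<lambda>h. frechet_derivative (\<lambda>y. \<Theta> y b) (at (\<gamma> x t)) (t *\<^sub>R h))) (at x)" for b
      using has_derivative_compose[OF \<gamma>' has[OF \<gamma>S[OF x t]]] .
    then have "((\<lambda>x. \<Sum>b\<in>Basis. ((x - c) \<bullet> b) *\<^sub>R \<Theta> (\<gamma> x t) b) has_derivative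
       (\<lambda>h. \<Sum>b\<in>Basis. ((x - c) \<bullet> b) *\<^sub>R frechet_derivative (\<lambda>y. \<Theta> y b) (at (\<gamma> x t)) (t *\<^sub>R h) + (h \<bullet> b) *\<^sub>R \<Theta> (\<gamma> x t) b)) (at x)"
      by (intro has_derivative_sum has_derivative_scaleR) (auto intro!: derivative_eq_intros)
    moreover have "(\<lambda>h. \<Sum>b\<in>Basis. ((x - c) \<bullet> b) *\<^sub>R frechet_derivative (\<lambda>y. \<Theta> y b) (at (\<gamma> x t)) (t *\<^sub>R h) + (h \<bullet> b) *\<^sub>R \<Theta> (\<gamma> x t) b) = DF x t"
    proof
      fix h
      have "(\<Sum>b\<in>Basis. ((x - c) \<bullet> b) *\<^sub>R frechet_derivative (\<lambda>y. \<Theta> y b) (at (\<gamma> x t)) (t *\<^sub>R h))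
        = t *\<^sub>R frechet_derivative (\<lambda>y. \<Theta> y h) (at (\<gamma> x t)) (x - c)"
        using expand'[OF \<gamma>S[OF x t], of "x - c" "t *\<^sub>R h"] closed[OF \<gamma>S[OF x t], of "x - c" h]
          linear_scale[OF lin'[OF \<gamma>S[OF x t], of "x - c"], of t h] by simp
      then show "(\<Sum>b\<in>Basis. ((x - c) \<bullet> b) *\<^sub>R frechet_derivative (\<lambda>y. \<Theta> y b) (at (\<gamma> x t)) (t *\<^sub>R h) + (h \<bullet> b) *\<^sub>R \<Theta> (\<gamma> x t) b) = DF x t h"
        by (simp add: DF_def sum.distrib expand[OF \<gamma>S[OF x t], of h])
    qed
    ultimately have *: "((\<lambda>x. \<Sum>b\<in>Basis. ((x - c) \<bullet> b) *\<^sub>R \<Theta> (\<gamma> x t) b) has_derivative DF x t) (at x)"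
      by simp
    show ?thesis
      by (rule has_derivative_transform_within_open[OF * S(1) x])
         (simp add: F_def expand[OF \<gamma>S[OF _ t], of _ "_ - c"])
  qed
  have cont\<gamma>: "continuous_on (S \<times> {0..1}) (\<lambda>(x, t). \<gamma> x t)"
    unfolding \<gamma>_def split_beta by (intro continuous_intros)
  have im\<gamma>: "(\<lambda>(x, t). \<gamma> x t) ` (S \<times> {0..1}) \<subseteq> S" using \<gamma>S by auto
  have cont\<Theta>: "continuous_on (S \<times> {0..1}) (\<lambda>(x, t). \<Theta> (\<gamma> x t) h)" for h
    using continuous_on_compose2[OF smooth_on_imp_continuous_on[OF sm[of h]] cont\<gamma> im\<gamma>]
    by (simp add: split_beta)
  have contD: "continuous_on (S \<times> {0..1}) (\<lambda>(x, t). frechet_derivative (\<lambda>y. \<Theta> y h) (at (\<gamma> x t)) u)" for h u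
    using continuous_on_compose2[OF smooth_on_imp_continuous_on[OF smooth_on_deriv[OF sm[of h], of u]] cont\<gamma> im\<gamma>]
    by (simp add: split_beta)
  have contDF: "continuous_on (S \<times> {0..1}) (\<lambda>(x, t). DF x t h)" for h
  proof -
    have "continuous_on (S \<times> {0..1}) (\<lambda>p. \<Theta> (\<gamma> (fst p) (snd p)) h +
       snd p *\<^sub>R (\<Sum>b\<in>Basis. ((fst p - c) \<bullet> b) *\<^sub>R frechet_derivative (\<lambda>y. \<Theta> y h) (at (\<gamma> (fst p) (snd p))) b))"
      using cont\<Theta>[of h] contD[of h] by (intro continuous_intros) (auto simp: split_beta)
    then show ?thesis
    proof (rule continuous_on_eq)
      fix p assume "p \<in> S \<times> {0..1::real}"
      then obtain x t where p: "p = (x, t)" and that: "x \<in> S" "t \<in> {0..1}" by auto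
      have "DF x t h = \<Theta> (\<gamma> x t) h +
       t *\<^sub>R (\<Sum>b\<in>Basis. ((x - c) \<bullet> b) *\<^sub>R frechet_derivative (\<lambda>y. \<Theta> y h) (at (\<gamma> x t)) b)"
      using expand'[OF \<gamma>S[OF that], of "x - c" h] closed[OF \<gamma>S[OF that]] by (simp add: DF_def)
      then show "\<Theta> (\<gamma> (fst p) (snd p)) h +
          snd p *\<^sub>R (\<Sum>b\<in>Basis. ((fst p - c) \<bullet> b) *\<^sub>R frechet_derivative (\<lambda>y. \<Theta> y h) (at (\<gamma> (fst p) (snd p))) b)
        = (case p of (x, t) \<Rightarrow> DF x t h)"
        by (simp only: p fst_conv snd_conv prod.case)
    qed
  qed
  have contF: "continuous_on {0..1} (F x)" if x: "x \<in> S" for x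
  proof -
    have "continuous_on {0..1} (\<lambda>t. (\<lambda>(x, t). \<Theta> (\<gamma> x t) b) (x, t))" for b
      by (rule continuous_on_compose2[OF cont\<Theta>]) (use x in \<open>auto intro!: continuous_intros\<close>)
    then show ?thesis unfolding F_def by simp
  qed
  \<comment> \<open>\<open>leibniz_rule\<close> asks for a derivative that is continuous as an
    element of the space of bounded linear maps.\<close>
  define fx where "fx = (\<lambda>x t. Blinfun (DF x t))"
  have fx: "blinfun_apply (fx x t) = DF x t" if "x \<in> S" "t \<in> {0..1}" for x t
    unfolding fx_def using has_derivative_bounded_linear[OF Dx[OF that]] bounded_linear_Blinfun_apply by blast
  define f where "f = (\<lambda>x. integral (cbox 0 1) (F x))"
  have "(f has_derivative \<Theta> x) (at x)" if x: "x \<in> S" for x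
  proof -
    have cfx: "continuous_on (S \<times> cbox 0 1) (\<lambda>(x, t). fx x t)"
    proof (rule continuous_on_blinfun_componentwise)
      fix i :: 'a
      have "continuous_on (S \<times> cbox 0 1) (\<lambda>(x, t). DF x t i)" using contDF by simp
      then show "continuous_on (S \<times> cbox 0 1) (\<lambda>p. blinfun_apply (case p of (x, t) \<Rightarrow> fx x t) i)"
        by (rule continuous_on_eq) (use fx in auto)
    qed
    have "(f has_derivative integral (cbox 0 1) (fx x)) (at x within S)"
      unfolding f_def
    proof (rule leibniz_rule[OF _ _ cfx x S(2)])
      show "((\<lambda>x. F x t) has_derivative blinfun_apply (fx x t)) (at x within S)" if "x \<in> S" "t \<in> cbox 0 1" for x t
        using Dx[of x t] fx[of x t] that has_derivative_at_withinI by fastforce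
      show "F x integrable_on cbox 0 1" if "x \<in> S" for x
        using contF[OF that] by (intro integrable_continuous) simp
    qed
    then have D: "(f has_derivative integral (cbox 0 1) (fx x)) (at x)"
      unfolding at_within_open[OF x S(1)] .
    have "blinfun_apply (integral (cbox 0 1) (fx x)) h = \<Theta> x h" for h
    proof -
      have "continuous_on (cbox 0 1) (\<lambda>t. (\<lambda>(x, t). fx x t) (x, t))"
        by (rule continuous_on_compose2[OF cfx]) (use x in \<open>auto intro!: continuous_intros\<close>)
      then have int: "fx x integrable_on cbox 0 1" by (intro integrable_continuous) simp
      have "blinfun_apply (integral (cbox 0 1) (fx x)) h = integral (cbox 0 1) (\<lambda>t. blinfun_apply (fx x t) h)"
        using integral_linear[OF int blinfun.bounded_linear_left[of h]] by (simp add: o_def)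
      also have "\<dots> = integral {0..1} (\<lambda>t. DF x t h)"
        unfolding cbox_interval by (rule integral_cong) (simp add: fx[OF x])
      \<comment> \<open>The integrand is the derivative of t \<Theta> (\<gamma> x t) h; at t = 0 the
        factor t kills it, at t = 1 the point is \<open>x\<close>.\<close>
      also have "\<dots> = 1 *\<^sub>R \<Theta> (\<gamma> x 1) h - 0 *\<^sub>R \<Theta> (\<gamma> x 0) h"
      proof (rule integral_unique, rule fundamental_theorem_of_calculus)
        fix t :: real assume t: "t \<in> {0..1}"
        have \<gamma>': "((\<lambda>t. \<gamma> x t) has_derivative (\<lambda>s. s *\<^sub>R (x - c))) (at t)"
          unfolding \<gamma>_def by (auto intro!: derivative_eq_intros)
        have "((\<lambda>t. \<Theta> (\<gamma> x t) h) has_derivative (\<lambda>s. frechet_derivative (\<lambda>y. \<Theta> y h) (at (\<gamma> x t)) (s *\<^sub>R (x - c)))) (at t)"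
          using has_derivative_compose[OF \<gamma>' has[OF \<gamma>S[OF x t]]] .
        then have "((\<lambda>t. \<Theta> (\<gamma> x t) h) has_vector_derivative frechet_derivative (\<lambda>y. \<Theta> y h) (at (\<gamma> x t)) (x - c)) (at t)"
          using linear_scale[OF lin'[OF \<gamma>S[OF x t]]] by (simp add: has_vector_derivative_def)
        then have "((\<lambda>t. t *\<^sub>R \<Theta> (\<gamma> x t) h) has_vector_derivative
            t *\<^sub>R frechet_derivative (\<lambda>y. \<Theta> y h) (at (\<gamma> x t)) (x - c) + 1 *\<^sub>R \<Theta> (\<gamma> x t) h) (at t)"
          by (intro has_vector_derivative_scaleR) auto
        then show "((\<lambda>t. t *\<^sub>R \<Theta> (\<gamma> x t) h) has_vector_derivative DF x t h) (at t within {0..1})"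
          unfolding DF_def by (simp add: add.commute has_vector_derivative_at_within)
      qed simp
      finally show ?thesis by (simp add: \<gamma>_def)
    qed
    then have "blinfun_apply (integral (cbox 0 1) (fx x)) = \<Theta> x" by (rule ext)
    with D show ?thesis by simp
  qed
  then show ?thesis by blast
qed

section \<open>The inverse function theorem with a smooth inverse\<close>

lemma smooth_on_vec:
  fixes f :: "'a::euclidean_space \<Rightarrow> real ^ 'k"
  assumes "open S" "\<And>k. smooth_on S (\<lambda>x. f x $ k)"
  shows "smooth_on S f"
proof (rule smooth_on_componentwise[OF assms(1)])
  fix b :: "real ^ 'k" assume "b \<in> Basis"
  then obtain k where "b = axis k 1" by (auto simp: Basis_vec_def)
  then show "smooth_on S (\<lambda>x. f x \<bullet> b)" using assms(2) by (simp add: inner_axis)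
qed

lemma smooth_on_vec_nth:
  fixes f :: "'a::euclidean_space \<Rightarrow> real ^ 'k"
  shows "open S \<Longrightarrow> smooth_on S f \<Longrightarrow> smooth_on S (\<lambda>x. f x $ k)"
  by (rule smooth_on_bounded_linear[OF bounded_linear_vec_nth])

lemma smooth_on_det:
  fixes M :: "'a::euclidean_space \<Rightarrow> real ^ 'k ^ 'k"
  assumes "open S" "\<And>i j. smooth_on S (\<lambda>x. M x $ i $ j)"
  shows "smooth_on S (\<lambda>x. det (M x))"
  unfolding det_def using assms
  by (intro smooth_on_sum smooth_on_mult smooth_on_prod smooth_on_const) auto

text \<open>\<open>inverse_function_theorem\<close> gives an inverse \<open>g\<close> whose
  derivative inverts that of \<open>F\<close>. Smoothness is bootstrapped: the derivative of
  \<open>g\<close> at \<open>y\<close> is \<open>N (g y)\<close>, where \<open>N\<close> is smooth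
  by Cramer's rule, so each order of differentiability of \<open>g\<close> yields the next.\<close>

lemma smooth_local_inverse:
  fixes F :: "real ^ 'k \<Rightarrow> real ^ 'k"
  assumes S: "open S" and F: "smooth_on S F" and x0: "x0 \<in> S"
    and inj: "inj (frechet_derivative F (at x0))"
  shows "\<exists>U. open U \<and> x0 \<in> U \<and> U \<subseteq> S \<and> open (F ` U) \<and> inj_on F U \<and> smooth_on (F ` U) (inv_into U F)"
proof -
  let ?D = "\<lambda>x. frechet_derivative F (at x)"
  have D: "(F has_derivative ?D x) (at x)" if "x \<in> S" for x
    using smooth_on_has_derivative[OF F that] .
  define F' where "F' = (\<lambda>x. Blinfun (?D x))"
  have F': "blinfun_apply (F' x) = ?D x" if "x \<in> S" for x
    unfolding F'_def using has_derivative_bounded_linear[OF D[OF that]] bounded_linear_Blinfun_apply by blast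
  have cF': "continuous_on S F'"
  proof (rule continuous_on_blinfun_componentwise)
    fix i
    have "continuous_on S (\<lambda>x. ?D x i)" using smooth_on_imp_continuous_on[OF smooth_on_deriv[OF F]] .
    then show "continuous_on S (\<lambda>x. blinfun_apply (F' x) i)"
      by (rule continuous_on_eq) (simp add: F')
  qed
  obtain L where L: "linear L" "L \<circ> ?D x0 = id"
    using linear_injective_left_inverse[OF has_derivative_linear[OF D[OF x0]] inj] by blast
  have "Blinfun L o\<^sub>L F' x0 = id_blinfun"
    using L by (intro blinfun_eqI) (simp add: F'[OF x0] bounded_linear_Blinfun_apply linear_conv_bounded_linear fun_eq_iff)
  then obtain U V g g' where U: "open U" "U \<subseteq> S" "x0 \<in> U" "open V" "homeomorphism U V F g"
    and g: "\<And>y. y \<in> V \<Longrightarrow> (g has_derivative (g' y)) (at y)"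
    and g': "\<And>y. y \<in> V \<Longrightarrow> g' y = inv (blinfun_apply (F' (g y)))"
    and bij: "\<And>y. y \<in> V \<Longrightarrow> bij (blinfun_apply (F' (g y)))"
    using inverse_function_theorem[of S F F' x0 "Blinfun L"] S D F' cF' x0 by metis
  have FU: "F ` U = V" and gV: "g ` V = U" and gF: "\<And>x. x \<in> U \<Longrightarrow> g (F x) = x"
    using U(5) by (auto simp: homeomorphism_def)
  have injU: "inj_on F U" by (rule inj_on_inverseI[of _ g]) (rule gF)
  define M where "M = (\<lambda>x. matrix (?D x))"
  \<comment> \<open>On the open set \<open>T\<close> the Jacobian is invertible, and
    \<open>N x v\<close> below, Cramer's formula for the solution z of \<open>M x *v z = v\<close>,
    is a smooth quotient.\<close>
  define T where "T = S \<inter> {x. det (M x) \<noteq> 0}"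
  define N where "N = (\<lambda>x v. \<chi> k. det (\<chi> i j. if j = k then v $ i else M x $ i $ j) / det (M x))"
  have M: "smooth_on S (\<lambda>x. M x $ i $ j)" for i j
    unfolding M_def matrix_def using smooth_on_vec_nth[OF S smooth_on_deriv[OF F]] by simp
  have "open T"
  proof -
    have "continuous_on S (\<lambda>x. det (M x))"
      by (rule smooth_on_imp_continuous_on[OF smooth_on_det[OF S M]])
    then have "open (S \<inter> (\<lambda>x. det (M x)) -` (- {0}))"
      using S by (intro continuous_open_preimage) auto
    moreover have "S \<inter> (\<lambda>x. det (M x)) -` (- {0}) = T" by (auto simp: T_def)
    ultimately show ?thesis by simp
  qed
  have N: "smooth_on T (\<lambda>x. N x v)" for v
  proof (rule smooth_on_vec[OF \<open>open T\<close>])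
    fix k
    have MT: "smooth_on T (\<lambda>x. M x $ i $ j)" for i j
      using smooth_on_subset[OF M] by (auto simp: T_def)
    have "smooth_on T (\<lambda>x. (\<chi> i j. if j = k then v $ i else M x $ i $ j) $ i $ j)" for i j
      using MT by (cases "j = k") auto
    then show "smooth_on T (\<lambda>x. N x v $ k)"
      unfolding N_def vec_lambda_beta using MT
      by (intro smooth_on_divide smooth_on_det \<open>open T\<close>) (auto simp: T_def)
  qed
  have gT: "g ` V \<subseteq> T" and g'N: "g' y v = N (g y) v" if "y \<in> V" for y v
  proof -
    have *: "det (M x) \<noteq> 0" "\<And>z. M x *v z = ?D x z" if "x \<in> U" for x
    proof -
      have "x \<in> S" using that U by blast
      have lin: "linear (?D x)" using D[OF \<open>x \<in> S\<close>] has_derivative_linear by blast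
      then have 1: "M x *v z = ?D x z" for z
        unfolding M_def by (metis matrix_works scalar_mult_eq_scaleR linear_linear scalar_mult_eq_scaleR matrix_vector_mul)
      have "bij (?D x)" using bij[of "F x"] that FU gF[OF that] F'[OF \<open>x \<in> S\<close>] by auto
      then have "inj ((*v) (M x))" using 1 by (metis (no_types, lifting) bij_is_inj ext)
      then have "invertible (M x)"
        by (metis invertible_left_inverse matrix_left_invertible_injective)
      then show "det (M x) \<noteq> 0" by (simp add: invertible_det_nz)
      show "\<And>z. M x *v z = ?D x z" by (rule 1)
    qed
    show "g ` V \<subseteq> T" using * gV U by (auto simp: T_def)
    have gy: "g y \<in> U" "g y \<in> S" using that gV U by blast+
    have "?D (g y) (g' y v) = v"
      using g'[OF that] bij[OF that] F'[OF gy(2)] by (simp add: bij_is_surj surj_f_inv_f)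
    then have "M (g y) *v (g' y v) = v" using *(2)[OF gy(1)] by simp
    then show "g' y v = N (g y) v"
      using cramer[OF *(1)[OF gy(1)], of "g' y v" v] by (simp add: N_def)
  qed
  have "Ck_on r V g" for r
  proof (induction r)
    case 0
    show ?case using U(5) by (simp add: homeomorphism_def)
  next
    case (Suc r)
    show ?case
    proof (rule Ck_on_SucI[OF \<open>open V\<close> g])
      fix v
      have "g ` V \<subseteq> T" using gT by blast
      then have "Ck_on r V (\<lambda>y. N (g y) v)"
        using Ck_on_compose[OF \<open>open V\<close> \<open>open T\<close> _ Suc, of "\<lambda>x. N x v"] N by (simp add: smooth_on_def)
      then show "Ck_on r V (\<lambda>y. g' y v)"
        by (rule Ck_on_cong[OF \<open>open V\<close>, THEN iffD1, rotated]) (simp add: g'N)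
    qed
  qed
  then have "smooth_on V g" by (simp add: smooth_on_def)
  moreover have "g y = inv_into U F y" if "y \<in> V" for y
    using that gF injU FU gV by (metis imageI image_iff inv_into_f_f)
  ultimately have "smooth_on V (inv_into U F)"
    using smooth_on_cong[OF \<open>open V\<close>, of g "inv_into U F"] by simp
  then show ?thesis using U FU injU by blast
qed

section \<open>Smooth maps between manifolds\<close>

lemma smooth_atlasD:
  assumes "smooth_atlas \<A>" "(U, \<phi>) \<in> \<A>"
  shows "open U" "open (\<phi> ` U)" "inj_on \<phi> U" "continuous_on U \<phi>" "continuous_on (\<phi> ` U) (inv_into U \<phi>)"
proof -
  have *: "open U \<and> open (\<phi> ` U) \<and> homeomorphism U (\<phi> ` U) \<phi> (inv_into U \<phi>)"
    using assms unfolding smooth_atlas_def by blast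
  then show "open U" "open (\<phi> ` U)" "continuous_on U \<phi>" "continuous_on (\<phi> ` U) (inv_into U \<phi>)"
    by (auto simp: homeomorphism_def)
  show "inj_on \<phi> U"
    using * by (intro inj_on_inverseI[of _ "inv_into U \<phi>"]) (auto simp: homeomorphism_def)
qed

lemma smooth_atlas_transition:
  assumes "smooth_atlas \<A>" "(U, \<phi>) \<in> \<A>" "(U', \<psi>) \<in> \<A>"
  shows "smooth_on (\<phi> ` (U \<inter> U')) (\<psi> \<circ> inv_into U \<phi>)"
  using assms unfolding smooth_atlas_def by blast

lemma ex_chart:
  assumes "smooth_atlas \<A>"
  obtains U \<phi> where "(U, \<phi>) \<in> \<A>" "p \<in> U"
  using assms unfolding smooth_atlas_def by fast

lemma chart_image_open:
  assumes "smooth_atlas \<A>" "(U, \<phi>) \<in> \<A>" "open W" "W \<subseteq> U"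
  shows "open (\<phi> ` W)"
proof -
  note c = smooth_atlasD[OF assms(1,2)]
  have "open (\<phi> ` U \<inter> inv_into U \<phi> -` W)"
    by (rule continuous_open_preimage[OF c(5,2) assms(3)])
  moreover have "\<phi> ` U \<inter> inv_into U \<phi> -` W = \<phi> ` W"
    using assms(4) c(3) by (force simp: inv_into_f_f)
  ultimately show ?thesis by simp
qed

lemma smooth_map_continuous_on: "smooth_map \<A> W \<B> F \<Longrightarrow> continuous_on W F"
  by (simp add: smooth_map_def)

lemma smooth_mapD:
  assumes "smooth_map \<A> W \<B> F" "(U, \<phi>) \<in> \<A>" "(U', \<psi>) \<in> \<B>"
    and "N \<subseteq> U \<inter> W" "F ` N \<subseteq> U'"
  shows "smooth_on (\<phi> ` N) (\<psi> \<circ> F \<circ> inv_into U \<phi>)"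
proof (rule smooth_on_subset)
  show "smooth_on (\<phi> ` (U \<inter> W \<inter> F -` U')) (\<psi> \<circ> F \<circ> inv_into U \<phi>)"
    using assms unfolding smooth_map_def by blast
qed (use assms in auto)

lemma open_preimage_continuous_on:
  assumes "continuous_on W F" "open W" "open T"
  shows "open (W \<inter> F -` T)"
  using assms continuous_open_preimage by blast

text \<open>One pair of charts around each point suffices, because transition maps carry smoothness
  to all other pairs. Continuity of \<open>F\<close> is read off from the local expression.\<close>

lemma smooth_mapI:
  assumes A: "smooth_atlas \<A>" and B: "smooth_atlas \<B>"
    and loc: "\<And>p. p \<in> W \<Longrightarrow> \<exists>U \<phi> U' \<psi> N. (U, \<phi>) \<in> \<A> \<and> (U', \<psi>) \<in> \<B> \<and> open N \<and> p \<in> N \<and> N \<subseteq> U \<and>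
        F ` N \<subseteq> U' \<and> smooth_on (\<phi> ` N) (\<psi> \<circ> F \<circ> inv_into U \<phi>)"
  shows "smooth_map \<A> W \<B> F"
proof -
  have cont: "\<exists>N. open N \<and> p \<in> N \<and> continuous_on N F" if p: "p \<in> W" for p
  proof -
    obtain U \<phi> U' \<psi> N where c: "(U, \<phi>) \<in> \<A>" "(U', \<psi>) \<in> \<B>" and N: "open N" "p \<in> N" "N \<subseteq> U" "F ` N \<subseteq> U'"
      and sm: "smooth_on (\<phi> ` N) (\<psi> \<circ> F \<circ> inv_into U \<phi>)"
      using loc[OF p] by blast
    note cA = smooth_atlasD[OF A c(1)] and cB = smooth_atlasD[OF B c(2)]
    have "continuous_on N (\<lambda>q. (\<psi> \<circ> F \<circ> inv_into U \<phi>) (\<phi> q))"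
      by (rule continuous_on_compose2[OF smooth_on_imp_continuous_on[OF sm]])
        (use continuous_on_subset[OF cA(4) N(3)] in auto)
    then have "continuous_on N (\<lambda>q. inv_into U' \<psi> ((\<psi> \<circ> F \<circ> inv_into U \<phi>) (\<phi> q)))"
      by (rule continuous_on_compose2[OF cB(5)]) (use N cA(3) in \<open>auto simp: subset_iff\<close>)
    then have "continuous_on N F"
      by (rule continuous_on_eq) (use N cA(3) cB(3) in \<open>auto simp: subset_iff\<close>)
    with N show ?thesis by blast
  qed
  have contF: "continuous_on W F"
    using cont by (metis continuous_at_imp_continuous_on continuous_on_eq_continuous_at)
  show ?thesis
    unfolding smooth_map_def
  proof (intro conjI contF ballI, clarify)
    fix U1 \<phi>1 U1' \<psi>1 assume c1: "(U1, \<phi>1) \<in> \<A>" "(U1', \<psi>1) \<in> \<B>"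
    note cA1 = smooth_atlasD[OF A c1(1)] and cB1 = smooth_atlasD[OF B c1(2)]
    show "smooth_on (\<phi>1 ` (U1 \<inter> W \<inter> F -` U1')) (\<psi>1 \<circ> F \<circ> inv_into U1 \<phi>1)"
    proof (rule smooth_on_local)
      fix x assume "x \<in> \<phi>1 ` (U1 \<inter> W \<inter> F -` U1')"
      then obtain p where p: "x = \<phi>1 p" "p \<in> U1" "p \<in> W" "F p \<in> U1'" by blast
      obtain U \<phi> U' \<psi> N where c: "(U, \<phi>) \<in> \<A>" "(U', \<psi>) \<in> \<B>" and N: "open N" "p \<in> N" "N \<subseteq> U" "F ` N \<subseteq> U'"
        and sm: "smooth_on (\<phi> ` N) (\<psi> \<circ> F \<circ> inv_into U \<phi>)"
        using loc[OF p(3)] by blast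
      obtain N' where N': "open N'" "p \<in> N'" "continuous_on N' F"
        using cont[OF p(3)] by blast
      note cA = smooth_atlasD[OF A c(1)] and cB = smooth_atlasD[OF B c(2)]
      \<comment> \<open>\<open>N'\<close> supplies continuity of \<open>F\<close>, which makes the
        set of points that \<open>F\<close> sends into \<open>U1'\<close> open near
        \<open>p\<close>; on \<open>Q\<close> both pairs of charts are available.\<close>
      define Q where "Q = (N \<inter> N' \<inter> F -` U1') \<inter> U1"
      have "open (N \<inter> N' \<inter> F -` U1')"
        using N(1) N'(1) cB1(1) by (intro open_preimage_continuous_on continuous_on_subset[OF N'(3)] open_Int) auto
      then have Q: "open Q" "p \<in> Q" "Q \<subseteq> N" "Q \<subseteq> U1" "F ` Q \<subseteq> U1'"
        unfolding Q_def using N N' p cA1(1) by auto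
      have Qsub: "Q \<subseteq> U" "F ` Q \<subseteq> U'" using Q N by blast+
      have o: "open (\<phi>1 ` Q)" "open (\<phi> ` Q)" using chart_image_open A c c1 Q(1,4) Qsub(1) by metis+
      have s1: "smooth_on (\<phi>1 ` Q) (\<phi> \<circ> inv_into U1 \<phi>1)"
        by (rule smooth_on_subset[OF smooth_atlas_transition[OF A c1(1) c(1)]]) (use Q Qsub in auto)
      have s2: "smooth_on (\<phi> ` Q) (\<psi> \<circ> F \<circ> inv_into U \<phi>)"
        by (rule smooth_on_subset[OF sm]) (use Q in auto)
      have s3: "smooth_on (\<psi> ` (U' \<inter> U1')) (\<psi>1 \<circ> inv_into U' \<psi>)"
        by (rule smooth_atlas_transition[OF B c(2) c1(2)])
      have o3: "open (\<psi> ` (U' \<inter> U1'))" using cB(1) cB1(1) by (intro chart_image_open[OF B c(2)]) auto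
      have s4: "smooth_on (\<phi> ` Q) (\<lambda>y. (\<psi>1 \<circ> inv_into U' \<psi>) ((\<psi> \<circ> F \<circ> inv_into U \<phi>) y))"
        by (rule smooth_on_compose[OF o(2) o3 _ s2 s3]) (use Q Qsub cA(3) in \<open>auto simp: subset_iff\<close>)
      \<comment> \<open>The expression in the new charts factors into a transition map, the old
        expression and another transition map.\<close>
      have "smooth_on (\<phi>1 ` Q) (\<lambda>z. (\<psi>1 \<circ> inv_into U' \<psi>) ((\<psi> \<circ> F \<circ> inv_into U \<phi>) ((\<phi> \<circ> inv_into U1 \<phi>1) z)))"
        by (rule smooth_on_compose[OF o(1) o(2) _ s1 s4]) (use Q cA1(3) in \<open>auto simp: subset_iff\<close>)
      moreover have "(\<psi>1 \<circ> inv_into U' \<psi>) ((\<psi> \<circ> F \<circ> inv_into U \<phi>) ((\<phi> \<circ> inv_into U1 \<phi>1) z)) = (\<psi>1 \<circ> F \<circ> inv_into U1 \<phi>1) z"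
        if "z \<in> \<phi>1 ` Q" for z
        using that Q Qsub cA(3) cA1(3) cB(3) by (auto simp: subset_iff)
      ultimately have "smooth_on (\<phi>1 ` Q) (\<psi>1 \<circ> F \<circ> inv_into U1 \<phi>1)"
        using smooth_on_cong[OF o(1)] by (metis (no_types, lifting))
      then show "\<exists>T. open T \<and> x \<in> T \<and> smooth_on T (\<psi>1 \<circ> F \<circ> inv_into U1 \<phi>1)"
        using o(1) Q(2) p(1) by blast
    qed
  qed
qed

lemma smooth_map_subset: "smooth_map \<A> W \<B> F \<Longrightarrow> W' \<subseteq> W \<Longrightarrow> smooth_map \<A> W' \<B> F"
  unfolding smooth_map_def
  by (auto intro: continuous_on_subset) (blast intro: smooth_on_subset)

text \<open>Converse of \<open>smooth_mapI\<close>, for any given charts around \<open>p\<close> and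
  \<open>F p\<close>: on the preimage of \<open>U'\<close> the map stays inside one chart.\<close>

lemma smooth_map_chartD:
  assumes A: "smooth_atlas \<A>" and B: "smooth_atlas \<B>" and F: "smooth_map \<A> W \<B> F" and W: "open W" "p \<in> W"
    and c: "(U, \<phi>) \<in> \<A>" "(U', \<psi>) \<in> \<B>" "p \<in> U" "F p \<in> U'"
  obtains N where "open N" "p \<in> N" "N \<subseteq> U" "N \<subseteq> W" "F ` N \<subseteq> U'" "open (\<phi> ` N)"
    "smooth_on (\<phi> ` N) (\<psi> \<circ> F \<circ> inv_into U \<phi>)"
proof
  let ?N = "(W \<inter> F -` U') \<inter> U"
  show o: "open ?N"
    using smooth_map_continuous_on[OF F] W smooth_atlasD(1)[OF A c(1)] smooth_atlasD(1)[OF B c(2)]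
    by (intro open_Int open_preimage_continuous_on)
  show "p \<in> ?N" "?N \<subseteq> U" "?N \<subseteq> W" "F ` ?N \<subseteq> U'" using W c by auto
  then show "open (\<phi> ` ?N)" "smooth_on (\<phi> ` ?N) (\<psi> \<circ> F \<circ> inv_into U \<phi>)"
    using chart_image_open[OF A c(1) o] smooth_mapD[OF F c(1,2)] by auto
qed

lemma smooth_map_local:
  assumes A: "smooth_atlas \<A>" and B: "smooth_atlas \<B>"
    and loc: "\<And>p. p \<in> W \<Longrightarrow> \<exists>N. open N \<and> p \<in> N \<and> smooth_map \<A> N \<B> F"
  shows "smooth_map \<A> W \<B> F"
proof (rule smooth_mapI[OF A B])
  fix p assume "p \<in> W"
  then obtain N where N: "open N" "p \<in> N" "smooth_map \<A> N \<B> F" using loc by blast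
  obtain U \<phi> where c: "(U, \<phi>) \<in> \<A>" "p \<in> U" using ex_chart[OF A] .
  obtain U' \<psi> where c': "(U', \<psi>) \<in> \<B>" "F p \<in> U'" using ex_chart[OF B] .
  from smooth_map_chartD[OF A B N(3,1,2) c(1) c'(1) c(2) c'(2)]
  show "\<exists>U \<phi> U' \<psi> N. (U, \<phi>) \<in> \<A> \<and> (U', \<psi>) \<in> \<B> \<and> open N \<and> p \<in> N \<and> N \<subseteq> U \<and>
        F ` N \<subseteq> U' \<and> smooth_on (\<phi> ` N) (\<psi> \<circ> F \<circ> inv_into U \<phi>)"
    using c(1) c'(1) by metis
qed

lemma smooth_map_cong:
  assumes A: "smooth_atlas \<A>" and B: "smooth_atlas \<B>" and W: "open W"
    and F: "smooth_map \<A> W \<B> F" and eq: "\<And>p. p \<in> W \<Longrightarrow> F p = F' p"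
  shows "smooth_map \<A> W \<B> F'"
proof (rule smooth_mapI[OF A B])
  fix p assume p: "p \<in> W"
  obtain U \<phi> where c: "(U, \<phi>) \<in> \<A>" "p \<in> U" using ex_chart[OF A] .
  obtain U' \<psi> where c': "(U', \<psi>) \<in> \<B>" "F p \<in> U'" using ex_chart[OF B] .
  obtain N where N: "open N" "p \<in> N" "N \<subseteq> U" "N \<subseteq> W" "F ` N \<subseteq> U'" "open (\<phi> ` N)"
    "smooth_on (\<phi> ` N) (\<psi> \<circ> F \<circ> inv_into U \<phi>)"
    using smooth_map_chartD[OF A B F W p c(1) c'(1) c(2) c'(2)] .
  have "(\<psi> \<circ> F \<circ> inv_into U \<phi>) x = (\<psi> \<circ> F' \<circ> inv_into U \<phi>) x" if "x \<in> \<phi> ` N" for x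
    using that N(3,4) eq smooth_atlasD(3)[OF A c(1)] by (auto simp: subset_iff)
  then have "smooth_on (\<phi> ` N) (\<psi> \<circ> F' \<circ> inv_into U \<phi>)"
    using smooth_on_cong[OF N(6)] N(7) by blast
  moreover have "F' ` N \<subseteq> U'" using N(4,5) eq by force
  ultimately show "\<exists>U \<phi> U' \<psi> N. (U, \<phi>) \<in> \<A> \<and> (U', \<psi>) \<in> \<B> \<and> open N \<and> p \<in> N \<and> N \<subseteq> U \<and>
        F' ` N \<subseteq> U' \<and> smooth_on (\<phi> ` N) (\<psi> \<circ> F' \<circ> inv_into U \<phi>)"
    using c(1) c'(1) N by metis
qed

lemma smooth_map_compose:
  assumes A: "smooth_atlas \<A>" and B: "smooth_atlas \<B>" and C: "smooth_atlas \<C>"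
    and W: "open W" and W': "open W'" and im: "F ` W \<subseteq> W'"
    and F: "smooth_map \<A> W \<B> F" and G: "smooth_map \<B> W' \<C> G"
  shows "smooth_map \<A> W \<C> (G \<circ> F)"
proof (rule smooth_mapI[OF A C])
  fix p assume p: "p \<in> W"
  obtain U \<phi> where c: "(U, \<phi>) \<in> \<A>" "p \<in> U" using ex_chart[OF A] .
  obtain U' \<psi> where c': "(U', \<psi>) \<in> \<B>" "F p \<in> U'" using ex_chart[OF B] .
  obtain U'' \<xi> where c'': "(U'', \<xi>) \<in> \<C>" "G (F p) \<in> U''" using ex_chart[OF C] .
  obtain N where N: "open N" "p \<in> N" "N \<subseteq> U" "N \<subseteq> W" "F ` N \<subseteq> U'" "open (\<phi> ` N)"
    "smooth_on (\<phi> ` N) (\<psi> \<circ> F \<circ> inv_into U \<phi>)"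
    using smooth_map_chartD[OF A B F W p c(1) c'(1) c(2) c'(2)] .
  have "F p \<in> W'" using im p by auto
  then obtain N' where N': "open N'" "F p \<in> N'" "N' \<subseteq> U'" "N' \<subseteq> W'" "G ` N' \<subseteq> U''" "open (\<psi> ` N')"
    "smooth_on (\<psi> ` N') (\<xi> \<circ> G \<circ> inv_into U' \<psi>)"
    using smooth_map_chartD[OF B C G W' _ c'(1) c''(1) c'(2) c''(2)] by blast
  define Q where "Q = N \<inter> F -` N'"
  have Q: "open Q" "p \<in> Q" "Q \<subseteq> N" "F ` Q \<subseteq> N'"
    unfolding Q_def using N N' smooth_map_continuous_on[OF F] continuous_on_subset
    by (auto intro!: open_preimage_continuous_on)
  have oQ: "open (\<phi> ` Q)" using chart_image_open[OF A c(1) Q(1)] Q N by auto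
  have s1: "smooth_on (\<phi> ` Q) (\<psi> \<circ> F \<circ> inv_into U \<phi>)" by (rule smooth_on_subset[OF N(7)]) (use Q in auto)
  have "smooth_on (\<phi> ` Q) (\<lambda>x. (\<xi> \<circ> G \<circ> inv_into U' \<psi>) ((\<psi> \<circ> F \<circ> inv_into U \<phi>) x))"
    by (rule smooth_on_compose[OF oQ N'(6) _ s1 N'(7)])
      (use Q N(3) smooth_atlasD(3)[OF A c(1)] in \<open>auto simp: subset_iff\<close>)
  moreover have "(\<xi> \<circ> G \<circ> inv_into U' \<psi>) ((\<psi> \<circ> F \<circ> inv_into U \<phi>) x) = (\<xi> \<circ> (G \<circ> F) \<circ> inv_into U \<phi>) x"
    if "x \<in> \<phi> ` Q" for x
    using that Q N(3) N'(3) smooth_atlasD(3)[OF A c(1)] smooth_atlasD(3)[OF B c'(1)] by (auto simp: subset_iff)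
  ultimately have "smooth_on (\<phi> ` Q) (\<xi> \<circ> (G \<circ> F) \<circ> inv_into U \<phi>)"
    using smooth_on_cong[OF oQ] by (metis (no_types, lifting))
  moreover have "(G \<circ> F) ` Q \<subseteq> U''" using Q N'(5) by auto
  ultimately show "\<exists>U \<phi> U' \<psi> N. (U, \<phi>) \<in> \<A> \<and> (U', \<psi>) \<in> \<C> \<and> open N \<and> p \<in> N \<and> N \<subseteq> U \<and>
        (G \<circ> F) ` N \<subseteq> U' \<and> smooth_on (\<phi> ` N) (\<psi> \<circ> (G \<circ> F) \<circ> inv_into U \<phi>)"
    using c(1) c''(1) Q(1,2) Q(3) N(3)
    by (intro exI[of _ U] exI[of _ \<phi>] exI[of _ U''] exI[of _ \<xi>] exI[of _ Q]) auto
qed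

lemma smooth_map_id:
  assumes A: "smooth_atlas \<A>"
  shows "smooth_map \<A> W \<A> (\<lambda>p. p)"
  unfolding smooth_map_def using smooth_atlas_transition[OF A]
  by (auto simp: o_def) (blast intro: smooth_on_subset)

lemma smooth_map_const:
  "smooth_map \<A> W \<B> (\<lambda>p. q)"
  unfolding smooth_map_def by (auto simp: o_def)

lemma inv_into_UNIV_id [simp]: "inv_into UNIV id = id"
  by (simp add: inv_id)

lemma smooth_atlas_std: "smooth_atlas (std_atlas :: ('e::euclidean_space, 'e) chart set)"
  unfolding smooth_atlas_def std_atlas_def
  by (auto simp: homeomorphism_def smooth_on_ident id_def o_def)

lemma std_atlas_iff: "(U, \<phi>) \<in> std_atlas \<longleftrightarrow> U = UNIV \<and> \<phi> = id"
  by (auto simp: std_atlas_def)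

lemma smooth_map_std_std_iff:
  "smooth_map std_atlas W std_atlas f \<longleftrightarrow> smooth_on W f"
  by (auto simp: smooth_map_def std_atlas_def smooth_on_imp_continuous_on)

lemma inv_into_map_prod:
  assumes "inj_on \<phi> U" "inj_on \<psi> U'" "x \<in> \<phi> ` U" "y \<in> \<psi> ` U'"
  shows "inv_into (U \<times> U') (map_prod \<phi> \<psi>) (x, y) = (inv_into U \<phi> x, inv_into U' \<psi> y)"
proof -
  obtain a b where "x = \<phi> a" "a \<in> U" "y = \<psi> b" "b \<in> U'" using assms by auto
  moreover have "inj_on (map_prod \<phi> \<psi>) (U \<times> U')" using assms by (simp add: map_prod_inj_on)
  ultimately show ?thesis
    using inv_into_f_f[of "map_prod \<phi> \<psi>" "U \<times> U'" "(a, b)"] assms by simp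
qed

lemma map_prod_image_Times: "map_prod \<phi> \<psi> ` (U \<times> U') = \<phi> ` U \<times> \<psi> ` U'"
  by (rule map_prod_surj_on) auto

lemma smooth_on_map_prod:
  assumes "open S" "open T" "smooth_on S f" "smooth_on T g"
  shows "smooth_on (S \<times> T) (\<lambda>p. (f (fst p), g (snd p)))"
  using assms
  by (intro smooth_on_Pair open_Times smooth_on_compose[OF _ assms(1) _ _ assms(3)]
        smooth_on_compose[OF _ assms(2) _ _ assms(4)] smooth_on_linear)
    (auto intro: bounded_linear_fst bounded_linear_snd)

lemma smooth_atlas_prod:
  assumes A: "smooth_atlas \<A>" and B: "smooth_atlas \<B>"
  shows "smooth_atlas (prod_atlas \<A> \<B>)"
  unfolding smooth_atlas_def
proof (intro conjI)
  show "(\<Union>(U, \<phi>)\<in>prod_atlas \<A> \<B>. U) = UNIV"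
  proof (intro equalityI subset_UNIV subsetI)
    fix p :: "'a \<times> 'c"
    obtain U \<phi> where "(U, \<phi>) \<in> \<A>" "fst p \<in> U" using ex_chart[OF A] .
    moreover obtain U' \<psi> where "(U', \<psi>) \<in> \<B>" "snd p \<in> U'" using ex_chart[OF B] .
    ultimately have "(U \<times> U', map_prod \<phi> \<psi>) \<in> prod_atlas \<A> \<B>" "p \<in> U \<times> U'"
      by (auto simp: prod_atlas_def mem_Times_iff)
    then show "p \<in> (\<Union>(U, \<phi>)\<in>prod_atlas \<A> \<B>. U)" by blast
  qed
  show "\<forall>(U, \<phi>)\<in>prod_atlas \<A> \<B>. open U \<and> open (\<phi> ` U) \<and> homeomorphism U (\<phi> ` U) \<phi> (inv_into U \<phi>)"
  proof clarify
    fix P \<pi> assume "(P, \<pi>) \<in> prod_atlas \<A> \<B>"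
    then obtain U \<phi> U' \<psi> where P: "P = U \<times> U'" "\<pi> = map_prod \<phi> \<psi>" and c: "(U, \<phi>) \<in> \<A>" "(U', \<psi>) \<in> \<B>"
      by (auto simp: prod_atlas_def)
    note cA = smooth_atlasD[OF A c(1)] and cB = smooth_atlasD[OF B c(2)]
    have inv: "inv_into P \<pi> z = (inv_into U \<phi> (fst z), inv_into U' \<psi> (snd z))" if "z \<in> \<phi> ` U \<times> \<psi> ` U'" for z
      using inv_into_map_prod[OF cA(3) cB(3), of "fst z" "snd z"] that by (auto simp: P)
    have "homeomorphism P (\<pi> ` P) \<pi> (inv_into P \<pi>)"
    proof (rule homeomorphismI)
      show "continuous_on P \<pi>"
        unfolding P map_prod_def split_beta
        by (intro continuous_intros continuous_on_compose2[OF cA(4)] continuous_on_compose2[OF cB(4)]) auto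
      have "continuous_on (\<phi> ` U \<times> \<psi> ` U') (\<lambda>z. (inv_into U \<phi> (fst z), inv_into U' \<psi> (snd z)))"
        by (intro continuous_intros continuous_on_compose2[OF cA(5)] continuous_on_compose2[OF cB(5)]) auto
      then show "continuous_on (\<pi> ` P) (inv_into P \<pi>)"
        unfolding P map_prod_image_Times by (rule continuous_on_eq) (use inv P in auto)
      show "inv_into P \<pi> (\<pi> x) = x" if "x \<in> P" for x
        using that inv[of "\<pi> x"] cA(3) cB(3) by (auto simp: P)
      then show "inv_into P \<pi> ` \<pi> ` P \<subseteq> P" by force
      show "\<pi> (inv_into P \<pi> y) = y" if "y \<in> \<pi> ` P" for y
        using that by (simp add: f_inv_into_f)
    qed auto
    then show "open P \<and> open (\<pi> ` P) \<and> homeomorphism P (\<pi> ` P) \<pi> (inv_into P \<pi>)"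
      using cA cB by (simp add: P open_Times map_prod_image_Times)
  qed
  show "\<forall>(U, \<phi>)\<in>prod_atlas \<A> \<B>. \<forall>(U', \<psi>)\<in>prod_atlas \<A> \<B>. smooth_on (\<phi> ` (U \<inter> U')) (\<psi> \<circ> inv_into U \<phi>)"
  proof clarify
    fix P \<pi> P1 \<pi>1 assume "(P, \<pi>) \<in> prod_atlas \<A> \<B>" "(P1, \<pi>1) \<in> prod_atlas \<A> \<B>"
    then obtain U \<phi> U' \<psi> U1 \<phi>1 U1' \<psi>1 where P: "P = U \<times> U'" "\<pi> = map_prod \<phi> \<psi>" "P1 = U1 \<times> U1'" "\<pi>1 = map_prod \<phi>1 \<psi>1"
      and c: "(U, \<phi>) \<in> \<A>" "(U', \<psi>) \<in> \<B>" "(U1, \<phi>1) \<in> \<A>" "(U1', \<psi>1) \<in> \<B>"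
      by (auto simp: prod_atlas_def)
    note cA = smooth_atlasD[OF A c(1)] and cB = smooth_atlasD[OF B c(2)]
    have im: "\<pi> ` (P \<inter> P1) = \<phi> ` (U \<inter> U1) \<times> \<psi> ` (U' \<inter> U1')"
      unfolding P Times_Int_Times map_prod_image_Times ..
    have o: "open (\<phi> ` (U \<inter> U1))" "open (\<psi> ` (U' \<inter> U1'))"
      using cA(1) cB(1) smooth_atlasD(1)[OF A c(3)] smooth_atlasD(1)[OF B c(4)]
      by (auto intro!: chart_image_open[OF A c(1)] chart_image_open[OF B c(2)] open_Int)
    have "smooth_on (\<phi> ` (U \<inter> U1) \<times> \<psi> ` (U' \<inter> U1')) (\<lambda>p. ((\<phi>1 \<circ> inv_into U \<phi>) (fst p), (\<psi>1 \<circ> inv_into U' \<psi>) (snd p)))"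
      by (rule smooth_on_map_prod[OF o smooth_atlas_transition[OF A c(1,3)] smooth_atlas_transition[OF B c(2,4)]])
    moreover have "((\<phi>1 \<circ> inv_into U \<phi>) (fst p), (\<psi>1 \<circ> inv_into U' \<psi>) (snd p)) = (\<pi>1 \<circ> inv_into P \<pi>) p"
      if "p \<in> \<phi> ` (U \<inter> U1) \<times> \<psi> ` (U' \<inter> U1')" for p
      using that inv_into_map_prod[OF cA(3) cB(3), of "fst p" "snd p"] by (auto simp: P)
    ultimately show "smooth_on (\<pi> ` (P \<inter> P1)) (\<pi>1 \<circ> inv_into P \<pi>)"
      unfolding im using smooth_on_cong[OF open_Times[OF o]] by (metis (no_types, lifting))
  qed
qed

lemma smooth_map_Pair:
  assumes A: "smooth_atlas \<A>" and B: "smooth_atlas \<B>" and C: "smooth_atlas \<C>" and W: "open W"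
    and F: "smooth_map \<A> W \<B> F" and G: "smooth_map \<A> W \<C> G"
  shows "smooth_map \<A> W (prod_atlas \<B> \<C>) (\<lambda>p. (F p, G p))"
proof (rule smooth_mapI[OF A smooth_atlas_prod[OF B C]])
  fix p assume p: "p \<in> W"
  obtain U \<phi> where c: "(U, \<phi>) \<in> \<A>" "p \<in> U" using ex_chart[OF A] .
  obtain U' \<psi> where c': "(U', \<psi>) \<in> \<B>" "F p \<in> U'" using ex_chart[OF B] .
  obtain U'' \<xi> where c'': "(U'', \<xi>) \<in> \<C>" "G p \<in> U''" using ex_chart[OF C] .
  obtain N where N: "open N" "p \<in> N" "N \<subseteq> U" "F ` N \<subseteq> U'"
    "smooth_on (\<phi> ` N) (\<psi> \<circ> F \<circ> inv_into U \<phi>)"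
    using smooth_map_chartD[OF A B F W p c(1) c'(1) c(2) c'(2)] by metis
  obtain N' where N': "open N'" "p \<in> N'" "N' \<subseteq> U" "G ` N' \<subseteq> U''"
    "smooth_on (\<phi> ` N') (\<xi> \<circ> G \<circ> inv_into U \<phi>)"
    using smooth_map_chartD[OF A C G W p c(1) c''(1) c(2) c''(2)] by metis
  have o: "open (\<phi> ` (N \<inter> N'))" using chart_image_open[OF A c(1), of "N \<inter> N'"] N N' by auto
  have "smooth_on (\<phi> ` (N \<inter> N')) (\<lambda>x. ((\<psi> \<circ> F \<circ> inv_into U \<phi>) x, (\<xi> \<circ> G \<circ> inv_into U \<phi>) x))"
    by (intro smooth_on_Pair o smooth_on_subset[OF N(5)] smooth_on_subset[OF N'(5)]) auto
  then have "smooth_on (\<phi> ` (N \<inter> N')) (map_prod \<psi> \<xi> \<circ> (\<lambda>p. (F p, G p)) \<circ> inv_into U \<phi>)"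
    by (simp add: o_def)
  moreover have "(U' \<times> U'', map_prod \<psi> \<xi>) \<in> prod_atlas \<B> \<C>"
    using c' c'' by (auto simp: prod_atlas_def)
  ultimately show "\<exists>U \<phi> U' \<psi> N. (U, \<phi>) \<in> \<A> \<and> (U', \<psi>) \<in> prod_atlas \<B> \<C> \<and> open N \<and> p \<in> N \<and> N \<subseteq> U \<and>
        (\<lambda>p. (F p, G p)) ` N \<subseteq> U' \<and> smooth_on (\<phi> ` N) (\<psi> \<circ> (\<lambda>p. (F p, G p)) \<circ> inv_into U \<phi>)"
    using c(1) N N'
    by (intro exI[of _ U] exI[of _ \<phi>] exI[of _ "U' \<times> U''"] exI[of _ "map_prod \<psi> \<xi>"] exI[of _ "N \<inter> N'"]) auto
qed

lemma smooth_map_fst_snd: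
  assumes A: "smooth_atlas \<A>" and B: "smooth_atlas \<B>"
  shows "smooth_map (prod_atlas \<A> \<B>) W \<A> fst" "smooth_map (prod_atlas \<A> \<B>) W \<B> snd"
proof -
  have "\<exists>P \<pi> U \<phi> U' \<psi>. (P, \<pi>) \<in> prod_atlas \<A> \<B> \<and> (U, \<phi>) \<in> \<A> \<and> (U', \<psi>) \<in> \<B> \<and> open P \<and> p \<in> P \<and>
      fst ` P \<subseteq> U \<and> snd ` P \<subseteq> U' \<and> smooth_on (\<pi> ` P) (\<phi> \<circ> fst \<circ> inv_into P \<pi>) \<and> smooth_on (\<pi> ` P) (\<psi> \<circ> snd \<circ> inv_into P \<pi>)"
    for p
  proof -
    obtain U \<phi> where c: "(U, \<phi>) \<in> \<A>" "fst p \<in> U" using ex_chart[OF A] .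
    obtain U' \<psi> where c': "(U', \<psi>) \<in> \<B>" "snd p \<in> U'" using ex_chart[OF B] .
    note cA = smooth_atlasD[OF A c(1)] and cB = smooth_atlasD[OF B c'(1)]
    let ?P = "U \<times> U'" and ?\<pi> = "map_prod \<phi> \<psi>"
    have o: "open (\<phi> ` U \<times> \<psi> ` U')" using cA cB by (simp add: open_Times)
    have eq: "fst z = (\<phi> \<circ> fst \<circ> inv_into ?P ?\<pi>) z" "snd z = (\<psi> \<circ> snd \<circ> inv_into ?P ?\<pi>) z"
      if "z \<in> \<phi> ` U \<times> \<psi> ` U'" for z
      using that inv_into_map_prod[OF cA(3) cB(3), of "fst z" "snd z"] by (auto simp: f_inv_into_f)
    have "smooth_on (\<phi> ` U \<times> \<psi> ` U') fst" "smooth_on (\<phi> ` U \<times> \<psi> ` U') snd"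
      using o by (simp_all add: smooth_on_linear bounded_linear_fst bounded_linear_snd)
    then have "smooth_on (?\<pi> ` ?P) (\<phi> \<circ> fst \<circ> inv_into ?P ?\<pi>)" "smooth_on (?\<pi> ` ?P) (\<psi> \<circ> snd \<circ> inv_into ?P ?\<pi>)"
      unfolding map_prod_image_Times using smooth_on_cong[OF o] eq by blast+
    moreover have "(?P, ?\<pi>) \<in> prod_atlas \<A> \<B>" using c c' by (auto simp: prod_atlas_def)
    ultimately show ?thesis using c c' cA cB
      by (intro exI[of _ ?P] exI[of _ ?\<pi>] exI[of _ U] exI[of _ \<phi>] exI[of _ U'] exI[of _ \<psi>])
        (auto simp: open_Times mem_Times_iff)
  qed
  note * = this
  show "smooth_map (prod_atlas \<A> \<B>) W \<A> fst"
  proof (rule smooth_mapI[OF smooth_atlas_prod[OF A B] A])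
    fix p
    obtain P \<pi> U \<phi> U' \<psi> where "(P, \<pi>) \<in> prod_atlas \<A> \<B>" "(U, \<phi>) \<in> \<A>" "(U', \<psi>) \<in> \<B>" "open P" "p \<in> P"
      "fst ` P \<subseteq> U" "snd ` P \<subseteq> U'"
      "smooth_on (\<pi> ` P) (\<phi> \<circ> fst \<circ> inv_into P \<pi>)" "smooth_on (\<pi> ` P) (\<psi> \<circ> snd \<circ> inv_into P \<pi>)"
      using *[of p] by (elim exE conjE)
    then show "\<exists>P \<pi> U \<phi> N. (P, \<pi>) \<in> prod_atlas \<A> \<B> \<and> (U, \<phi>) \<in> \<A> \<and> open N \<and> p \<in> N \<and> N \<subseteq> P \<and>
        fst ` N \<subseteq> U \<and> smooth_on (\<pi> ` N) (\<phi> \<circ> fst \<circ> inv_into P \<pi>)"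
      by (intro exI[of _ P] exI[of _ \<pi>] exI[of _ U] exI[of _ \<phi>] conjI order_refl)
  qed
  show "smooth_map (prod_atlas \<A> \<B>) W \<B> snd"
  proof (rule smooth_mapI[OF smooth_atlas_prod[OF A B] B])
    fix p
    obtain P \<pi> U \<phi> U' \<psi> where "(P, \<pi>) \<in> prod_atlas \<A> \<B>" "(U, \<phi>) \<in> \<A>" "(U', \<psi>) \<in> \<B>" "open P" "p \<in> P"
      "fst ` P \<subseteq> U" "snd ` P \<subseteq> U'"
      "smooth_on (\<pi> ` P) (\<phi> \<circ> fst \<circ> inv_into P \<pi>)" "smooth_on (\<pi> ` P) (\<psi> \<circ> snd \<circ> inv_into P \<pi>)"
      using *[of p] by (elim exE conjE)
    then show "\<exists>P \<pi> U \<phi> N. (P, \<pi>) \<in> prod_atlas \<A> \<B> \<and> (U, \<phi>) \<in> \<B> \<and> open N \<and> p \<in> N \<and> N \<subseteq> P \<and>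
        snd ` N \<subseteq> U \<and> smooth_on (\<pi> ` N) (\<phi> \<circ> snd \<circ> inv_into P \<pi>)"
      by (intro exI[of _ P] exI[of _ \<pi>] exI[of _ U'] exI[of _ \<psi>] conjI order_refl)
  qed
qed

text \<open>The coordinate expressions of a chart and of its inverse are transition maps of the
  atlas.\<close>

lemma smooth_map_chart:
  assumes A: "smooth_atlas \<A>" and c: "(U, \<phi>) \<in> \<A>"
  shows "smooth_map \<A> U std_atlas \<phi>" "smooth_map std_atlas (\<phi> ` U) \<A> (inv_into U \<phi>)"
proof -
  note cA = smooth_atlasD[OF A c]
  show "smooth_map \<A> U std_atlas \<phi>"
    unfolding smooth_map_def
  proof (intro conjI cA ballI, clarify)
    fix U1 \<phi>1 V \<psi> assume c1: "(U1, \<phi>1) \<in> \<A>" "(V, \<psi>) \<in> (std_atlas :: ('b, 'b) chart set)"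
    then show "smooth_on (\<phi>1 ` (U1 \<inter> U \<inter> \<phi> -` V)) (\<psi> \<circ> \<phi> \<circ> inv_into U1 \<phi>1)"
      using smooth_atlas_transition[OF A c1(1) c] by (simp add: std_atlas_iff)
  qed
  show "smooth_map std_atlas (\<phi> ` U) \<A> (inv_into U \<phi>)"
    unfolding smooth_map_def
  proof (intro conjI cA ballI, clarify)
    fix U1 \<phi>1 V \<psi> assume c1: "(U1, \<phi>1) \<in> \<A>" "(V, \<psi>) \<in> (std_atlas :: ('b, 'b) chart set)"
    have "smooth_on (\<phi> ` (U \<inter> U1)) (\<phi>1 \<circ> inv_into U \<phi>)" by (rule smooth_atlas_transition[OF A c c1(1)])
    moreover have "\<phi> ` U \<inter> inv_into U \<phi> -` U1 \<subseteq> \<phi> ` (U \<inter> U1)" using cA(3) by auto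
    ultimately show "smooth_on (\<psi> ` (V \<inter> \<phi> ` U \<inter> inv_into U \<phi> -` U1)) (\<phi>1 \<circ> inv_into U \<phi> \<circ> inv_into V \<psi>)"
      using c1(2) by (auto simp: std_atlas_iff intro: smooth_on_subset)
  qed
qed

section \<open>Tangent vectors\<close>

lemma smooth_map_std_iff:
  assumes A: "smooth_atlas \<A>" and W: "open W"
  shows "smooth_map \<A> W std_atlas f \<longleftrightarrow> (\<forall>(U, \<phi>)\<in>\<A>. smooth_on (\<phi> ` (U \<inter> W)) (f \<circ> inv_into U \<phi>))"
proof
  assume "smooth_map \<A> W std_atlas f"
  then show "\<forall>(U, \<phi>)\<in>\<A>. smooth_on (\<phi> ` (U \<inter> W)) (f \<circ> inv_into U \<phi>)"
    by (auto simp: smooth_map_def std_atlas_def)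
next
  assume *: "\<forall>(U, \<phi>)\<in>\<A>. smooth_on (\<phi> ` (U \<inter> W)) (f \<circ> inv_into U \<phi>)"
  show "smooth_map \<A> W std_atlas f"
  proof (rule smooth_mapI[OF A smooth_atlas_std])
    fix p assume p: "p \<in> W"
    obtain U \<phi> where c: "(U, \<phi>) \<in> \<A>" "p \<in> U" using ex_chart[OF A] .
    have "open (U \<inter> W)" using smooth_atlasD(1)[OF A c(1)] W by auto
    moreover have "smooth_on (\<phi> ` (U \<inter> W)) (id \<circ> f \<circ> inv_into U \<phi>)" using * c by auto
    ultimately show "\<exists>U \<phi> U' \<psi> N. (U, \<phi>) \<in> \<A> \<and> (U', \<psi>) \<in> std_atlas \<and> open N \<and> p \<in> N \<and> N \<subseteq> U \<and>
        f ` N \<subseteq> U' \<and> smooth_on (\<phi> ` N) (\<psi> \<circ> f \<circ> inv_into U \<phi>)"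
      using c p
      by (intro exI[of _ U] exI[of _ \<phi>] exI[of _ UNIV] exI[of _ id] exI[of _ "U \<inter> W"]) (auto simp: std_atlas_iff)
  qed
qed

lemma smooth_map_bounded_linear:
  assumes A: "smooth_atlas \<A>" and W: "open W" and L: "bounded_linear L"
    and f: "smooth_map \<A> W std_atlas f"
  shows "smooth_map \<A> W std_atlas (\<lambda>p. L (f p))"
  unfolding smooth_map_std_iff[OF A W]
proof clarify
  fix U \<phi> assume c: "(U, \<phi>) \<in> \<A>"
  have o: "open (\<phi> ` (U \<inter> W))" using chart_image_open[OF A c] smooth_atlasD(1)[OF A c] W by (simp add: open_Int)
  show "smooth_on (\<phi> ` (U \<inter> W)) ((\<lambda>p. L (f p)) \<circ> inv_into U \<phi>)"
    using smooth_on_bounded_linear[OF L o, of "f \<circ> inv_into U \<phi>"] f[unfolded smooth_map_std_iff[OF A W]] c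
    by (auto simp: o_def)
qed

lemma smooth_map_sum:
  assumes A: "smooth_atlas \<A>" and W: "open W"
    and f: "\<And>i. i \<in> I \<Longrightarrow> smooth_map \<A> W std_atlas (f i)"
  shows "smooth_map \<A> W std_atlas (\<lambda>p. \<Sum>i\<in>I. f i p)"
  unfolding smooth_map_std_iff[OF A W]
proof clarify
  fix U \<phi> assume c: "(U, \<phi>) \<in> \<A>"
  have o: "open (\<phi> ` (U \<inter> W))" using chart_image_open[OF A c] smooth_atlasD(1)[OF A c] W by (simp add: open_Int)
  show "smooth_on (\<phi> ` (U \<inter> W)) ((\<lambda>p. \<Sum>i\<in>I. f i p) \<circ> inv_into U \<phi>)"
    using smooth_on_sum[OF o, of I "\<lambda>i. f i \<circ> inv_into U \<phi>"] f[unfolded smooth_map_std_iff[OF A W]] c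
    by (auto simp: o_def)
qed

lemma smooth_map_add:
  assumes A: "smooth_atlas \<A>" and W: "open W"
    and f: "smooth_map \<A> W std_atlas f" "smooth_map \<A> W std_atlas g"
  shows "smooth_map \<A> W std_atlas (\<lambda>p. f p + g p)"
proof -
  have "smooth_map \<A> W std_atlas (\<lambda>p. \<Sum>b\<in>{True, False}. (if b then f else g) p)"
    by (rule smooth_map_sum[OF A W]) (simp add: f)
  then show ?thesis by simp
qed

lemma smooth_atI: "smooth_map \<A> W std_atlas h \<Longrightarrow> open W \<Longrightarrow> p \<in> W \<Longrightarrow> smooth_at \<A> p h"
  unfolding smooth_at_def by blast

lemma smooth_at_chart:
  assumes A: "smooth_atlas \<A>" and h: "smooth_at \<A> p h" and c: "(U, \<phi>) \<in> \<A>" "p \<in> U"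
  obtains N where "open N" "p \<in> N" "N \<subseteq> U" "open (\<phi> ` N)" "smooth_on (\<phi> ` N) (h \<circ> inv_into U \<phi>)"
proof -
  obtain W where W: "open W" "p \<in> W" "smooth_map \<A> W std_atlas h" using h by (auto simp: smooth_at_def)
  have "(UNIV, id) \<in> (std_atlas :: (real, real) chart set)" by (simp add: std_atlas_iff)
  then obtain N where N: "open N" "p \<in> N" "N \<subseteq> U" "N \<subseteq> W" "h ` N \<subseteq> UNIV" "open (\<phi> ` N)"
    "smooth_on (\<phi> ` N) (id \<circ> h \<circ> inv_into U \<phi>)"
    by (rule smooth_map_chartD[OF A smooth_atlas_std W(3,1,2) c(1) _ c(2) UNIV_I])
  from N(7) have "smooth_on (\<phi> ` N) (h \<circ> inv_into U \<phi>)" by (simp only: id_o)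
  then show ?thesis by (rule that[OF N(1,2,3,6)])
qed

lemma smooth_at_has_derivative:
  assumes A: "smooth_atlas \<A>" and h: "smooth_at \<A> p h" and c: "(U, \<phi>) \<in> \<A>" "p \<in> U"
  shows "((h \<circ> inv_into U \<phi>) has_derivative frechet_derivative (h \<circ> inv_into U \<phi>) (at (\<phi> p))) (at (\<phi> p))"
proof -
  obtain N where N: "open N" "p \<in> N" "N \<subseteq> U" "open (\<phi> ` N)" "smooth_on (\<phi> ` N) (h \<circ> inv_into U \<phi>)"
    by (rule smooth_at_chart[OF A h c])
  show ?thesis by (rule smooth_on_has_derivative[OF N(5) imageI[OF N(2)]])
qed

lemma smooth_at_cong:
  assumes A: "smooth_atlas \<A>" and N: "open N" "p \<in> N" "\<And>q. q \<in> N \<Longrightarrow> h q = h' q" and h: "smooth_at \<A> p h"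
  shows "smooth_at \<A> p h'"
proof -
  obtain W where W: "open W" "p \<in> W" "smooth_map \<A> W std_atlas h" using h by (auto simp: smooth_at_def)
  have "smooth_map \<A> (W \<inter> N) std_atlas h'"
    by (rule smooth_map_cong[OF A smooth_atlas_std _ smooth_map_subset[OF W(3)]]) (use W N in auto)
  then show ?thesis using W N by (intro smooth_atI[of _ "W \<inter> N"]) auto
qed

lemma smooth_at_compose:
  assumes A: "smooth_atlas \<A>" and B: "smooth_atlas \<B>" and F: "smooth_map \<A> W \<B> F" and W: "open W" "p \<in> W"
    and h: "smooth_at \<B> (F p) h"
  shows "smooth_at \<A> p (h \<circ> F)"
proof -
  obtain W' where W': "open W'" "F p \<in> W'" "smooth_map \<B> W' std_atlas h" using h by (auto simp: smooth_at_def)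
  have o: "open (W \<inter> F -` W')" using open_preimage_continuous_on[OF smooth_map_continuous_on[OF F] W(1) W'(1)] .
  have "smooth_map \<A> (W \<inter> F -` W') std_atlas (h \<circ> F)"
    by (rule smooth_map_compose[OF A B smooth_atlas_std o W'(1) _ smooth_map_subset[OF F] W'(3)]) auto
  then show ?thesis by (rule smooth_atI[OF _ o]) (use W W' in auto)
qed

lemma smooth_at_add:
  assumes A: "smooth_atlas \<A>" and "smooth_at \<A> p h" "smooth_at \<A> p h'"
  shows "smooth_at \<A> p (\<lambda>q. h q + h' q)"
proof -
  obtain W W' where W: "open W" "p \<in> W" "smooth_map \<A> W std_atlas h" "open W'" "p \<in> W'" "smooth_map \<A> W' std_atlas h'"
    using assms by (auto simp: smooth_at_def)
  then have "smooth_map \<A> (W \<inter> W') std_atlas (\<lambda>q. h q + h' q)"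
    by (intro smooth_map_add A open_Int) (auto elim: smooth_map_subset)
  then show ?thesis using W by (intro smooth_atI[of _ "W \<inter> W'"]) auto
qed

lemma smooth_at_cmult:
  assumes A: "smooth_atlas \<A>" and "smooth_at \<A> p h"
  shows "smooth_at \<A> p (\<lambda>q. r * h q)"
proof -
  obtain W where W: "open W" "p \<in> W" "smooth_map \<A> W std_atlas h" using assms by (auto simp: smooth_at_def)
  show ?thesis by (rule smooth_atI[OF smooth_map_bounded_linear[OF A W(1) bounded_linear_mult_right W(3)] W(1,2)])
qed

section \<open>Coordinate vectors and push-forwards\<close>

lemma coord_vector_apply:
  "smooth_at \<A> p h \<Longrightarrow> coord_vector \<A> (U, \<phi>) p u h = frechet_derivative (h \<circ> inv_into U \<phi>) (at (\<phi> p)) u"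
  by (simp add: coord_vector_def)

text \<open>Locality has to cover the default value as well: smoothness near \<open>p\<close> is
  itself a local property, so both sides take the value 0 together.\<close>

lemma coord_vector_local:
  assumes A: "smooth_atlas \<A>" and c: "(U, \<phi>) \<in> \<A>" "p \<in> U"
    and N: "open N" "p \<in> N" "\<And>q. q \<in> N \<Longrightarrow> h q = h' q"
  shows "coord_vector \<A> (U, \<phi>) p u h = coord_vector \<A> (U, \<phi>) p u h'"
proof (cases "smooth_at \<A> p h")
  case True
  then have True': "smooth_at \<A> p h'" using smooth_at_cong[OF A N(1,2), of h h'] N(3) by blast
  note cA = smooth_atlasD[OF A c(1)]
  have o: "open (\<phi> ` (N \<inter> U))" using chart_image_open[OF A c(1)] N cA(1) by (simp add: open_Int)
  have "frechet_derivative (h \<circ> inv_into U \<phi>) (at (\<phi> p)) = frechet_derivative (h' \<circ> inv_into U \<phi>) (at (\<phi> p))"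
    using N c cA(3) by (intro frechet_derivative_cong_open[OF o]) auto
  then show ?thesis using True True' by (simp add: coord_vector_apply)
next
  case False
  then have "\<not> smooth_at \<A> p h'" using smooth_at_cong[OF A N(1,2), of h' h] N(3) by metis
  with False show ?thesis by (simp add: coord_vector_def)
qed

text \<open>Chain rule for h \<circ> F in the charts: components transform by the Jacobian. Where
  \<open>h\<close> is not smooth near \<open>F p\<close>, both operators are 0 by definition, even
  if h \<circ> F happens to be smooth.\<close>

lemma pushforward_coord_vector:
  assumes A: "smooth_atlas \<A>" and B: "smooth_atlas \<B>" and F: "smooth_map \<A> W \<B> F" and W: "open W" "p \<in> W"
    and c: "(U, \<phi>) \<in> \<A>" "p \<in> U" "(U', \<psi>) \<in> \<B>" "F p \<in> U'"
  shows "pushforward \<B> F p (coord_vector \<A> (U, \<phi>) p u) =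
    coord_vector \<B> (U', \<psi>) (F p) (frechet_derivative (\<psi> \<circ> F \<circ> inv_into U \<phi>) (at (\<phi> p)) u)"
proof
  fix h
  let ?K = "\<psi> \<circ> F \<circ> inv_into U \<phi>"
  show "pushforward \<B> F p (coord_vector \<A> (U, \<phi>) p u) h =
    coord_vector \<B> (U', \<psi>) (F p) (frechet_derivative ?K (at (\<phi> p)) u) h"
  proof (cases "smooth_at \<B> (F p) h")
    case True
    have hF: "smooth_at \<A> p (h \<circ> F)" by (rule smooth_at_compose[OF A B F W True])
    obtain N where N: "open N" "p \<in> N" "N \<subseteq> U" "F ` N \<subseteq> U'" "open (\<phi> ` N)" "smooth_on (\<phi> ` N) ?K"
      using smooth_map_chartD[OF A B F W c(1,3,2,4)] by metis
    note cA = smooth_atlasD[OF A c(1)] and cB = smooth_atlasD[OF B c(3)]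
    have K: "(?K has_derivative frechet_derivative ?K (at (\<phi> p))) (at (\<phi> p))"
      using smooth_on_has_derivative[OF N(6)] N(2) by blast
    have Kp: "?K (\<phi> p) = \<psi> (F p)" using cA(3) c by simp
    have "((\<lambda>x. (h \<circ> inv_into U' \<psi>) (?K x)) has_derivative
        (\<lambda>u. frechet_derivative (h \<circ> inv_into U' \<psi>) (at (\<psi> (F p))) (frechet_derivative ?K (at (\<phi> p)) u))) (at (\<phi> p))"
      using has_derivative_compose[OF K] smooth_at_has_derivative[OF B True c(3,4)] unfolding Kp by metis
    moreover have "(h \<circ> inv_into U' \<psi>) (?K x) = (h \<circ> F \<circ> inv_into U \<phi>) x" if "x \<in> \<phi> ` N" for x
      using that N(3,4) cA(3) cB(3) by (auto simp: subset_iff)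
    ultimately have "((h \<circ> F \<circ> inv_into U \<phi>) has_derivative
        (\<lambda>u. frechet_derivative (h \<circ> inv_into U' \<psi>) (at (\<psi> (F p))) (frechet_derivative ?K (at (\<phi> p)) u))) (at (\<phi> p))"
      using has_derivative_transform_within_open[OF _ N(5)] N(2) by (metis (no_types, lifting) imageI)
    from frechet_derivative_at[OF this, symmetric] show ?thesis
      using True hF by (simp add: pushforward_def coord_vector_apply fun_eq_iff)
  next
    case False
    then show ?thesis by (simp add: pushforward_def coord_vector_def)
  qed
qed

lemma pushforward_id:
  assumes A: "smooth_atlas \<A>" and c: "(U, \<phi>) \<in> \<A>" "p \<in> U"
  shows "pushforward \<A> (\<lambda>q. q) p (coord_vector \<A> (U, \<phi>) p u) = coord_vector \<A> (U, \<phi>) p u"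
  by (simp add: fun_eq_iff pushforward_def coord_vector_def o_def)

text \<open>A change of charts is the push-forward along the identity map, seen in two
  charts.\<close>

lemma coord_vector_change:
  assumes A: "smooth_atlas \<A>" and c: "(U, \<phi>) \<in> \<A>" "p \<in> U" "(U', \<psi>) \<in> \<A>" "p \<in> U'"
  shows "coord_vector \<A> (U, \<phi>) p u = coord_vector \<A> (U', \<psi>) p (frechet_derivative (\<psi> \<circ> inv_into U \<phi>) (at (\<phi> p)) u)"
proof -
  have "pushforward \<A> (\<lambda>q. q) p (coord_vector \<A> (U, \<phi>) p u)
    = coord_vector \<A> (U', \<psi>) p (frechet_derivative (\<psi> \<circ> (\<lambda>q. q) \<circ> inv_into U \<phi>) (at (\<phi> p)) u)"
    by (rule pushforward_coord_vector[OF A A smooth_map_id[OF A] open_UNIV UNIV_I c])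
  moreover have "\<psi> \<circ> (\<lambda>q. q) \<circ> inv_into U \<phi> = \<psi> \<circ> inv_into U \<phi>" by (simp add: o_def)
  ultimately show ?thesis by (simp only: pushforward_id[OF A c(1,2)])
qed

text \<open>By the transformation rule, the vectors that \<open>tangent_space\<close> collects from
  all charts already come from any single one.\<close>

lemma tangent_space_eq:
  assumes A: "smooth_atlas \<A>" and c: "(U, \<phi>) \<in> \<A>" "p \<in> U"
  shows "tangent_space \<A> p = range (coord_vector \<A> (U, \<phi>) p)"
proof -
  have "coord_vector \<A> c' p u \<in> range (coord_vector \<A> (U, \<phi>) p)" if "c' \<in> \<A>" "p \<in> fst c'" for c' u
    using coord_vector_change[OF A, of "fst c'" "snd c'" p U \<phi> u] that c by auto
  then show ?thesis using c by (auto simp: tangent_space_def)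
qed

lemma coord_vector_in_tangent_space:
  "(U, \<phi>) \<in> \<A> \<Longrightarrow> p \<in> U \<Longrightarrow> coord_vector \<A> (U, \<phi>) p u \<in> tangent_space \<A> p"
  unfolding tangent_space_def by (rule CollectI, rule exI[of _ "(U, \<phi>)"], rule exI[of _ u]) simp

lemma tangent_spaceE:
  assumes "v \<in> tangent_space \<A> p"
  obtains U \<phi> u where "(U, \<phi>) \<in> \<A>" "p \<in> U" "v = coord_vector \<A> (U, \<phi>) p u"
proof -
  obtain c u where "c \<in> \<A>" "p \<in> fst c" "v = coord_vector \<A> c p u"
    using assms by (auto simp: tangent_space_def)
  then show ?thesis using that[of "fst c" "snd c" u] by simp
qed

lemma pushforward_in_tangent_space:
  assumes A: "smooth_atlas \<A>" and B: "smooth_atlas \<B>" and F: "smooth_map \<A> W \<B> F" and W: "open W" "p \<in> W"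
    and v: "v \<in> tangent_space \<A> p"
  shows "pushforward \<B> F p v \<in> tangent_space \<B> (F p)"
proof -
  obtain U \<phi> u where c: "(U, \<phi>) \<in> \<A>" "p \<in> U" "v = coord_vector \<A> (U, \<phi>) p u" using tangent_spaceE[OF v] .
  obtain U' \<psi> where c': "(U', \<psi>) \<in> \<B>" "F p \<in> U'" using ex_chart[OF B] .
  show ?thesis
    unfolding c(3) pushforward_coord_vector[OF A B F W c(1,2) c'] using coord_vector_in_tangent_space[OF c'] .
qed

text \<open>Smoothness of \<open>G\<close> turns a function smooth near \<open>G (F p)\<close> into
  one smooth near \<open>F p\<close>, so for such a function the default value 0 of the inner
  push-forward is never met.\<close>

lemma pushforward_compose:
  assumes B: "smooth_atlas \<B>" and C: "smooth_atlas \<C>" and G: "smooth_map \<B> W \<C> G" and W: "open W" "F p \<in> W"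
  shows "pushforward \<C> G (F p) (pushforward \<B> F p v) = pushforward \<C> (G \<circ> F) p v"
proof
  fix h
  show "pushforward \<C> G (F p) (pushforward \<B> F p v) h = pushforward \<C> (G \<circ> F) p v h"
    using smooth_at_compose[OF B C G W, of h] by (simp add: pushforward_def o_assoc)
qed

lemma tangent_vector_local:
  assumes A: "smooth_atlas \<A>" and v: "v \<in> tangent_space \<A> p"
    and N: "open N" "p \<in> N" "\<And>q. q \<in> N \<Longrightarrow> h q = h' q"
  shows "v h = v h'"
proof -
  obtain U \<phi> u where c: "(U, \<phi>) \<in> \<A>" "p \<in> U" "v = coord_vector \<A> (U, \<phi>) p u" using tangent_spaceE[OF v] .
  show ?thesis unfolding c(3) by (rule coord_vector_local[OF A c(1,2) N])
qed

lemma tangent_vector_not_smooth: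
  "v \<in> tangent_space \<A> p \<Longrightarrow> \<not> smooth_at \<A> p h \<Longrightarrow> v h = 0"
  by (auto simp: tangent_space_def coord_vector_def)

lemma pushforward_ident:
  "v \<in> tangent_space \<A> p \<Longrightarrow> pushforward \<A> (\<lambda>q. q) p v = v"
proof
  fix h assume "v \<in> tangent_space \<A> p"
  then show "pushforward \<A> (\<lambda>q. q) p v h = v h"
    using tangent_vector_not_smooth[of v \<A> p h] by (cases "smooth_at \<A> p h") (simp_all add: pushforward_def o_def)
qed

lemma tangent_vector_add:
  assumes A: "smooth_atlas \<A>" and v: "v \<in> tangent_space \<A> p" and h: "smooth_at \<A> p h" "smooth_at \<A> p h'"
  shows "v (\<lambda>q. h q + h' q) = v h + v h'"
proof -
  obtain U \<phi> u where c: "(U, \<phi>) \<in> \<A>" "p \<in> U" "v = coord_vector \<A> (U, \<phi>) p u" using tangent_spaceE[OF v] .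
  have "((\<lambda>x. (h \<circ> inv_into U \<phi>) x + (h' \<circ> inv_into U \<phi>) x) has_derivative
     (\<lambda>u. frechet_derivative (h \<circ> inv_into U \<phi>) (at (\<phi> p)) u + frechet_derivative (h' \<circ> inv_into U \<phi>) (at (\<phi> p)) u)) (at (\<phi> p))"
    by (rule has_derivative_add[OF smooth_at_has_derivative[OF A h(1) c(1,2)] smooth_at_has_derivative[OF A h(2) c(1,2)]])
  from frechet_derivative_at[OF this, symmetric] show ?thesis
    using h smooth_at_add[OF A h] by (simp add: c(3) coord_vector_apply o_def fun_eq_iff)
qed

lemma tangent_vector_cmult:
  assumes A: "smooth_atlas \<A>" and v: "v \<in> tangent_space \<A> p" and h: "smooth_at \<A> p h"
  shows "v (\<lambda>q. r * h q) = r * v h"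
proof -
  obtain U \<phi> u where c: "(U, \<phi>) \<in> \<A>" "p \<in> U" "v = coord_vector \<A> (U, \<phi>) p u" using tangent_spaceE[OF v] .
  have "((\<lambda>x. r * (h \<circ> inv_into U \<phi>) x) has_derivative
     (\<lambda>u. r * frechet_derivative (h \<circ> inv_into U \<phi>) (at (\<phi> p)) u)) (at (\<phi> p))"
    by (rule has_derivative_mult_right[OF smooth_at_has_derivative[OF A h c(1,2)]])
  from frechet_derivative_at[OF this, symmetric] show ?thesis
    using h smooth_at_cmult[OF A h] by (simp add: c(3) coord_vector_apply o_def fun_eq_iff)
qed

lemma tangent_vector_diff:
  assumes A: "smooth_atlas \<A>" and v: "v \<in> tangent_space \<A> p" and h: "smooth_at \<A> p h" "smooth_at \<A> p h'"
  shows "v (\<lambda>q. h q - h' q) = v h - v h'"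
  using tangent_vector_add[OF A v h(1) smooth_at_cmult[OF A h(2), of "- 1"]] tangent_vector_cmult[OF A v h(2), of "- 1"]
  by (simp only: mult_minus1 add_uminus_conv_diff)

lemma linear_coord_vector:
  assumes A: "smooth_atlas \<A>" and c: "(U, \<phi>) \<in> \<A>" "p \<in> U"
  shows "linear (\<lambda>u. coord_vector \<A> (U, \<phi>) p u h)"
proof (cases "smooth_at \<A> p h")
  case True
  then show ?thesis
    using has_derivative_linear[OF smooth_at_has_derivative[OF A True c]] by (simp add: coord_vector_apply)
qed (simp add: coord_vector_def linear_conv_bounded_linear bounded_linear_zero)

lemma smooth_at_chart_component:
  assumes A: "smooth_atlas \<A>" and c: "(U, \<phi>) \<in> \<A>" "p \<in> U"
  shows "smooth_at \<A> p (\<lambda>q. \<phi> q \<bullet> b)"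
  using smooth_map_bounded_linear[OF A smooth_atlasD(1)[OF A c(1)] bounded_linear_inner_left smooth_map_chart(1)[OF A c(1)]]
    smooth_atlasD(1)[OF A c(1)] c(2) by (rule smooth_atI)

text \<open>The functions \<open>\<phi> q \<bullet> b\<close> are the coordinates; evaluating the
  operator on them recovers its components.\<close>

lemma coord_vector_chart_component:
  assumes A: "smooth_atlas \<A>" and c: "(U, \<phi>) \<in> \<A>" "p \<in> U"
  shows "coord_vector \<A> (U, \<phi>) p u (\<lambda>q. \<phi> q \<bullet> b) = u \<bullet> b"
proof -
  have "((\<lambda>x. x \<bullet> b) has_derivative (\<lambda>u. u \<bullet> b)) (at (\<phi> p))"
    by (auto intro!: derivative_eq_intros)
  then have "(((\<lambda>q. \<phi> q \<bullet> b) \<circ> inv_into U \<phi>) has_derivative (\<lambda>u. u \<bullet> b)) (at (\<phi> p))"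
    by (rule has_derivative_transform_within_open[OF _ smooth_atlasD(2)[OF A c(1)]])
      (use c in \<open>auto simp: f_inv_into_f\<close>)
  from frechet_derivative_at[OF this, symmetric] show ?thesis
    by (simp add: coord_vector_apply[OF smooth_at_chart_component[OF A c]] fun_eq_iff)
qed

lemma dvec_coord_vector:
  fixes f :: "'m::{t2_space,second_countable_topology} \<Rightarrow> 'v::euclidean_space"
  assumes A: "smooth_atlas \<A>" and c: "(U, \<phi>) \<in> \<A>" "p \<in> U" and f: "smooth_map \<A> W std_atlas f" "open W" "p \<in> W"
  shows "dvec (coord_vector \<A> (U, \<phi>) p u) f = frechet_derivative (f \<circ> inv_into U \<phi>) (at (\<phi> p)) u"
proof -
  have sm: "smooth_at \<A> p (\<lambda>q. f q \<bullet> b)" for b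
    by (rule smooth_atI[OF smooth_map_bounded_linear[OF A f(2) bounded_linear_inner_left f(1)] f(2,3)])
  have "smooth_on (\<phi> ` (U \<inter> W)) (f \<circ> inv_into U \<phi>)"
    using f(1) c(1) unfolding smooth_map_std_iff[OF A f(2)] by blast
  then have d: "(f \<circ> inv_into U \<phi>) differentiable at (\<phi> p)" using smooth_on_differentiable c f by blast
  have "coord_vector \<A> (U, \<phi>) p u (\<lambda>q. f q \<bullet> b) = frechet_derivative (f \<circ> inv_into U \<phi>) (at (\<phi> p)) u \<bullet> b" for b
    using frechet_derivative_bounded_linear[OF bounded_linear_inner_left d, of b]
    by (simp add: coord_vector_apply[OF sm] o_def fun_eq_iff)
  then show ?thesis by (simp add: dvec_def euclidean_representation)
qed

lemma dvec_local:
  assumes A: "smooth_atlas \<A>" and v: "v \<in> tangent_space \<A> p"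
    and N: "open N" "p \<in> N" "\<And>q. q \<in> N \<Longrightarrow> f q = f' q"
  shows "dvec v f = dvec v f'"
proof -
  have "v (\<lambda>q. f q \<bullet> b) = v (\<lambda>q. f' q \<bullet> b)" for b
    by (rule tangent_vector_local[OF A v N(1,2)]) (simp add: N(3))
  then show ?thesis by (simp add: dvec_def)
qed

section \<open>Left-invariant vector fields\<close>

lemma frechet_derivative_expand:
  fixes f :: "'a::euclidean_space \<Rightarrow> 'b::real_normed_vector"
  assumes "f differentiable (at x)"
  shows "frechet_derivative f (at x) w = (\<Sum>b\<in>Basis. (w \<bullet> b) *\<^sub>R frechet_derivative f (at x) b)"
  using linear_sum[OF linear_frechet_derivative[OF assms], of "\<lambda>b. (w \<bullet> b) *\<^sub>R b" Basis]
    linear_scale[OF linear_frechet_derivative[OF assms]]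
  by (simp add: euclidean_representation)

text \<open>The direction \<eta> b moves together with the base point. Expansion in
  \<open>Basis\<close> and the product rule separate the derivative of the field from the second
  derivative of \<open>f\<close>; the latter is the part that cancels in commutators.\<close>

lemma has_derivative_along_field:
  fixes f :: "'a::euclidean_space \<Rightarrow> real"
  assumes S: "open S" "a \<in> S" and f: "smooth_on S f" and \<eta>: "smooth_on S \<eta>"
  shows "((\<lambda>b. frechet_derivative f (at b) (\<eta> b)) has_derivative
    (\<lambda>\<xi>. frechet_derivative f (at a) (frechet_derivative \<eta> (at a) \<xi>) +
          frechet_derivative (\<lambda>b. frechet_derivative f (at b) (\<eta> a)) (at a) \<xi>)) (at a)"
proof -
  let ?D = "\<lambda>c b. frechet_derivative f (at b) c"
  have df: "f differentiable (at b)" if "b \<in> S" for b using smooth_on_differentiable[OF f that] .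
  have D: "(?D c has_derivative frechet_derivative (?D c) (at a)) (at a)" for c
    by (rule smooth_on_has_derivative[OF smooth_on_deriv[OF f] S(2)])
  have \<eta>': "((\<lambda>b. \<eta> b \<bullet> c) has_derivative (\<lambda>\<xi>. frechet_derivative \<eta> (at a) \<xi> \<bullet> c)) (at a)" for c
    using bounded_linear.has_derivative[OF bounded_linear_inner_left smooth_on_has_derivative[OF \<eta> S(2)]] .
  have 1: "((\<lambda>b. \<Sum>c\<in>Basis. (\<eta> b \<bullet> c) * ?D c b) has_derivative
    (\<lambda>\<xi>. \<Sum>c\<in>Basis. (\<eta> a \<bullet> c) * frechet_derivative (?D c) (at a) \<xi> + (frechet_derivative \<eta> (at a) \<xi> \<bullet> c) * ?D c a)) (at a)"
    by (rule has_derivative_sum) (rule has_derivative_mult[OF \<eta>' D])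
  have "((\<lambda>b. \<Sum>c\<in>Basis. (\<eta> a \<bullet> c) * ?D c b) has_derivative
    (\<lambda>\<xi>. \<Sum>c\<in>Basis. (\<eta> a \<bullet> c) * frechet_derivative (?D c) (at a) \<xi>)) (at a)"
    by (intro has_derivative_sum has_derivative_mult_right D)
  then have "((\<lambda>b. ?D (\<eta> a) b) has_derivative
    (\<lambda>\<xi>. \<Sum>c\<in>Basis. (\<eta> a \<bullet> c) * frechet_derivative (?D c) (at a) \<xi>)) (at a)"
  proof (rule has_derivative_transform_within_open[OF _ S])
    fix b assume "b \<in> S"
    then show "(\<Sum>c\<in>Basis. (\<eta> a \<bullet> c) * ?D c b) = ?D (\<eta> a) b"
      using frechet_derivative_expand[OF df, of b "\<eta> a"] by simp
  qed
  from frechet_derivative_at[OF this]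
  have 2: "frechet_derivative (?D (\<eta> a)) (at a) \<xi> = (\<Sum>c\<in>Basis. (\<eta> a \<bullet> c) * frechet_derivative (?D c) (at a) \<xi>)" for \<xi>
    by (rule fun_cong[OF sym])
  have 3: "frechet_derivative f (at a) (frechet_derivative \<eta> (at a) \<xi>) = (\<Sum>c\<in>Basis. (frechet_derivative \<eta> (at a) \<xi> \<bullet> c) * ?D c a)" for \<xi>
    using frechet_derivative_expand[OF df[OF S(2)], of "frechet_derivative \<eta> (at a) \<xi>"] by simp
  have "((\<lambda>b. frechet_derivative f (at b) (\<eta> b)) has_derivative
    (\<lambda>\<xi>. \<Sum>c\<in>Basis. (\<eta> a \<bullet> c) * frechet_derivative (?D c) (at a) \<xi> + (frechet_derivative \<eta> (at a) \<xi> \<bullet> c) * ?D c a)) (at a)"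
  proof (rule has_derivative_transform_within_open[OF 1 S])
    fix b assume "b \<in> S"
    then show "(\<Sum>c\<in>Basis. (\<eta> b \<bullet> c) * ?D c b) = frechet_derivative f (at b) (\<eta> b)"
      using frechet_derivative_expand[OF df, of b "\<eta> b"] by simp
  qed
  then show ?thesis unfolding 2 3 sum.distrib[symmetric] by (simp only: add.commute)
qed

section \<open>Lie groups: left translation and the Maurer--Cartan form\<close>

locale lie =
  fixes G :: "('g::{t2_space,second_countable_topology}, 'e::euclidean_space, 'l::euclidean_space) lie_grp"
  assumes lie_group: "lie_group G"
begin

abbreviation "\<A> \<equiv> lg_atlas G"
abbreviation "mul \<equiv> lg_mult G"
abbreviation "e \<equiv> lg_one G"
abbreviation "lvec \<equiv> lg_vec G"

lemma atlas: "smooth_atlas \<A>"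
  using lie_group by (simp add: lie_group_def)

lemma group_laws:
  "mul (mul x y) z = mul x (mul y z)" "mul e x = x" "mul x e = x"
  "mul (lg_inv G x) x = e" "mul x (lg_inv G x) = e"
proof -
  interpret group mul e "lg_inv G" using lie_group by (simp add: lie_group_def)
  show "mul (mul x y) z = mul x (mul y z)" "mul e x = x" "mul x e = x"
    "mul (lg_inv G x) x = e" "mul x (lg_inv G x) = e"
    by (simp_all add: assoc)
qed

lemma inv_mul_cancel: "mul (lg_inv G x) (mul x y) = y"
  by (simp add: group_laws(1)[symmetric] group_laws)

lemma smooth_mul:
  assumes "smooth_atlas \<B>" "open W" "smooth_map \<B> W \<A> F" "smooth_map \<B> W \<A> H"
  shows "smooth_map \<B> W \<A> (\<lambda>p. mul (F p) (H p))"
proof -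
  have "smooth_map (prod_atlas \<A> \<A>) UNIV \<A> (\<lambda>(x, y). mul x y)"
    using lie_group by (simp add: lie_group_def)
  from smooth_map_compose[OF assms(1) smooth_atlas_prod[OF atlas atlas] atlas assms(2) open_UNIV subset_UNIV
      smooth_map_Pair[OF assms(1) atlas atlas assms(2-4)] this]
  show ?thesis by (simp add: o_def)
qed

lemma smooth_inv: "smooth_map \<A> UNIV \<A> (lg_inv G)"
  using lie_group by (simp add: lie_group_def)

lemma smooth_left_mul: "smooth_map \<A> UNIV \<A> (mul x)"
  by (rule smooth_mul[OF atlas open_UNIV smooth_map_const smooth_map_id[OF atlas]])

lemma vec_tangent: "lvec X \<in> tangent_space \<A> e"
  using lie_group by (auto simp: lie_group_def bij_betw_def)

lemma vec_linear: "lvec (X + Y) h = lvec X h + lvec Y h" "lvec (r *\<^sub>R X) h = r * lvec X h"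
  using lie_group by (auto simp: lie_group_def)

lemma inj_vec: "inj lvec"
  using lie_group by (auto simp: lie_group_def bij_betw_def)

lemma inv_vec [simp]: "inv lvec (lvec X) = X"
  by (rule inv_f_f[OF inj_vec])

lemma vec_inv: "v \<in> tangent_space \<A> e \<Longrightarrow> lvec (inv lvec v) = v"
  using lie_group by (auto simp: lie_group_def bij_betw_def intro!: f_inv_into_f)

lemma linear_vec: "linear (\<lambda>X. lvec X h)"
  by (rule linearI) (simp_all add: vec_linear)

lemma left_field_apply: "left_field G X x h = (if smooth_at \<A> x h then lvec X (h \<circ> mul x) else 0)"
  by (simp add: left_field_def pushforward_def group_laws)

lemma linear_left_field: "linear (\<lambda>X. left_field G X x h)"
  unfolding left_field_apply using linear_vec[of "h \<circ> mul x"]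
  by (cases "smooth_at \<A> x h") (simp_all add: linear_conv_bounded_linear bounded_linear_zero)

lemma left_field_one: "left_field G X e = lvec X"
proof -
  have "mul e = (\<lambda>x. x)" by (simp add: fun_eq_iff group_laws)
  then show ?thesis unfolding left_field_def using pushforward_ident[OF vec_tangent] by simp
qed

lemma left_field_tangent: "left_field G X x \<in> tangent_space \<A> x"
  using pushforward_in_tangent_space[OF atlas atlas smooth_left_mul open_UNIV UNIV_I vec_tangent, of x X]
  by (simp add: left_field_def group_laws)

lemma pushforward_left_field: "pushforward \<A> (mul x) y (left_field G X y) = left_field G X (mul x y)"
proof -
  have "pushforward \<A> (mul x) (mul y e) (pushforward \<A> (mul y) e (lvec X)) = pushforward \<A> (mul x \<circ> mul y) e (lvec X)"
    by (rule pushforward_compose[OF atlas atlas smooth_left_mul open_UNIV UNIV_I])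
  moreover have "mul x \<circ> mul y = mul (mul x y)" by (simp add: fun_eq_iff group_laws)
  ultimately show ?thesis by (simp add: left_field_def group_laws)
qed

lemma left_field_left_mul:
  assumes "smooth_at \<A> (mul x y) h"
  shows "left_field G X (mul x y) h = left_field G X y (h \<circ> mul x)"
  using assms by (simp add: pushforward_left_field[symmetric] pushforward_def)

text \<open>Translation by the inverse of \<open>x\<close> returns the invariant field to its value
  at the identity. Together with \<open>left_field_mc\<close> this identifies each tangent space
  with the Lie algebra.\<close>

lemma mc_left_field: "mc_form G x (left_field G X x) = X"
  using pushforward_left_field[of "lg_inv G x" x X] by (simp add: mc_form_def group_laws left_field_one)

lemma left_field_mc:
  assumes v: "v \<in> tangent_space \<A> x"
  shows "left_field G (mc_form G x v) x = v"
proof -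
  have "pushforward \<A> (mul (lg_inv G x)) x v \<in> tangent_space \<A> e"
    using pushforward_in_tangent_space[OF atlas atlas smooth_left_mul open_UNIV UNIV_I v, of "lg_inv G x"]
    by (simp add: group_laws)
  then have "left_field G (mc_form G x v) x = pushforward \<A> (mul x) e (pushforward \<A> (mul (lg_inv G x)) x v)"
    by (simp add: left_field_def mc_form_def vec_inv)
  also have "\<dots> = pushforward \<A> (mul x \<circ> mul (lg_inv G x)) x v"
    using pushforward_compose[OF atlas atlas smooth_left_mul open_UNIV UNIV_I, of x "mul (lg_inv G x)" x v]
    by (simp add: group_laws)
  also have "mul x \<circ> mul (lg_inv G x) = (\<lambda>y. y)"
    by (simp add: fun_eq_iff group_laws(1)[symmetric] group_laws)
  finally show ?thesis using pushforward_ident[OF v] by simp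
qed

text \<open>Tests vanishing in the Lie algebra at an arbitrary point instead of the identity; the
  structure equation is checked in this way at \<open>g p\<close>.\<close>

lemma left_field_eq_0D:
  assumes "\<And>h. smooth_at \<A> x h \<Longrightarrow> left_field G X x h = 0"
  shows "X = 0"
proof -
  have "left_field G X x h = left_field G 0 x h" for h
    using assms[of h] linear_0[OF linear_left_field, of x h] by (cases "smooth_at \<A> x h") (auto simp: left_field_apply)
  then have "left_field G X x = left_field G 0 x" by (rule ext)
  then show ?thesis by (metis mc_left_field)
qed

text \<open>In two charts, h (x y) is a function \<open>H\<close> of the coordinates of
  \<open>x\<close> and of \<open>y\<close>, smooth because the multiplication is jointly smooth. The
  invariant field applied to \<open>h\<close> is a partial derivative of \<open>H\<close> in the
  second variable, taken at the identity, hence smooth in the first variable.\<close>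

lemma smooth_left_field:
  assumes W: "open W" and h: "smooth_map \<A> W std_atlas h"
  shows "smooth_map \<A> W std_atlas (\<lambda>x. left_field G X x h)"
proof (rule smooth_mapI[OF atlas smooth_atlas_std])
  fix x0 assume x0: "x0 \<in> W"
  obtain U \<phi> where c: "(U, \<phi>) \<in> \<A>" "x0 \<in> U" using ex_chart[OF atlas] .
  obtain U1 \<phi>1 where c1: "(U1, \<phi>1) \<in> \<A>" "e \<in> U1" using ex_chart[OF atlas] .
  note cA = smooth_atlasD[OF atlas c(1)] and cA1 = smooth_atlasD[OF atlas c1(1)]
  obtain u where u: "lvec X = coord_vector \<A> (U1, \<phi>1) e u"
    using vec_tangent[of X] unfolding tangent_space_eq[OF atlas c1] by blast
  define T where "T = \<phi> ` U \<times> \<phi>1 ` U1"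
  define P where "P = (\<lambda>z. mul (inv_into U \<phi> (fst z)) (inv_into U1 \<phi>1 (snd z)))"
  have T: "open T" unfolding T_def using cA(2) cA1(2) by (rule open_Times)
  have "smooth_map std_atlas T \<A> (inv_into U \<phi> \<circ> fst)"
    using T by (intro smooth_map_compose[OF smooth_atlas_std smooth_atlas_std atlas _ cA(2) _ _ smooth_map_chart(2)[OF atlas c(1)]])
      (auto simp: T_def smooth_map_std_std_iff smooth_on_linear bounded_linear_fst)
  moreover have "smooth_map std_atlas T \<A> (inv_into U1 \<phi>1 \<circ> snd)"
    using T by (intro smooth_map_compose[OF smooth_atlas_std smooth_atlas_std atlas _ cA1(2) _ _ smooth_map_chart(2)[OF atlas c1(1)]])
      (auto simp: T_def smooth_map_std_std_iff smooth_on_linear bounded_linear_snd)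
  ultimately have P: "smooth_map std_atlas T \<A> P"
    using smooth_mul[OF smooth_atlas_std T] by (simp add: P_def o_def)
  \<comment> \<open>Smoothness of \<open>h\<close> is known on \<open>W\<close>, so the coordinates
    are restricted to pairs whose product lies there.\<close>
  define S where "S = T \<inter> P -` W"
  have S: "open S"
    unfolding S_def by (rule open_preimage_continuous_on[OF smooth_map_continuous_on[OF P] T W])
  define H where "H = h \<circ> P"
  have "smooth_map std_atlas S std_atlas H"
    unfolding H_def
    by (rule smooth_map_compose[OF smooth_atlas_std atlas smooth_atlas_std S W _ smooth_map_subset[OF P] h]) (auto simp: S_def)
  then have H: "smooth_on S H" by (simp add: smooth_map_std_std_iff)
  define N where "N = W \<inter> U"
  have N: "open N" "x0 \<in> N" "N \<subseteq> U" "N \<subseteq> W" using W cA(1) x0 c(2) by (auto simp: N_def)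
  have oN: "open (\<phi> ` N)" by (rule chart_image_open[OF atlas c(1) N(1,3)])
  have inS: "(\<phi> x, \<phi>1 e) \<in> S" if "x \<in> N" for x
    using that N c1 cA(3) cA1(3) by (auto simp: S_def T_def P_def group_laws subset_iff)
  have eq: "left_field G X x h = frechet_derivative H (at (\<phi> x, \<phi>1 e)) (0, u)" if x: "x \<in> N" for x
  proof -
    have xW: "x \<in> W" "x \<in> U" using x N by auto
    have sx: "smooth_at \<A> x h" by (rule smooth_atI[OF h W xW(1)])
    have "smooth_at \<A> (mul x e) h" using sx by (simp add: group_laws)
    then have se: "smooth_at \<A> e (h \<circ> mul x)"
      by (rule smooth_at_compose[OF atlas atlas smooth_left_mul open_UNIV UNIV_I])
    have "left_field G X x h = frechet_derivative (h \<circ> mul x \<circ> inv_into U1 \<phi>1) (at (\<phi>1 e)) u"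
      using sx se by (simp add: left_field_apply u coord_vector_apply)
    also have "h \<circ> mul x \<circ> inv_into U1 \<phi>1 = (\<lambda>b. H (\<phi> x, b))"
      using xW(2) cA(3) by (simp add: H_def P_def o_def)
    also have "frechet_derivative (\<lambda>b. H (\<phi> x, b)) (at (\<phi>1 e)) = (\<lambda>u. frechet_derivative H (at (\<phi> x, \<phi>1 e)) (0, u))"
    proof -
      have "((\<lambda>b. (\<phi> x, b)) has_derivative (\<lambda>u. (0, u))) (at (\<phi>1 e))"
        by (auto intro!: derivative_eq_intros)
      from has_derivative_compose[OF this smooth_on_has_derivative[OF H inS[OF x]]]
      show ?thesis by (rule frechet_derivative_at[symmetric])
    qed
    finally show ?thesis .
  qed
  have "smooth_on (\<phi> ` N) (\<lambda>a. (a, \<phi>1 e))"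
    by (intro smooth_on_Pair smooth_on_ident smooth_on_const oN)
  then have "smooth_on (\<phi> ` N) (\<lambda>a. frechet_derivative H (at (a, \<phi>1 e)) (0, u))"
    by (rule smooth_on_compose[OF oN S _ _ smooth_on_deriv[OF H, of "(0, u)"], rotated]) (use inS in auto)
  moreover have "frechet_derivative H (at (a, \<phi>1 e)) (0, u) = (id \<circ> (\<lambda>x. left_field G X x h) \<circ> inv_into U \<phi>) a"
    if "a \<in> \<phi> ` N" for a
    using that eq N(3) cA(3) by (auto simp: subset_iff)
  ultimately have "smooth_on (\<phi> ` N) (id \<circ> (\<lambda>x. left_field G X x h) \<circ> inv_into U \<phi>)"
    using smooth_on_cong[OF oN, of "\<lambda>a. frechet_derivative H (at (a, \<phi>1 e)) (0, u)"] by blast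
  then show "\<exists>U \<phi> U' \<psi> N. (U, \<phi>) \<in> \<A> \<and> (U', \<psi>) \<in> std_atlas \<and> open N \<and> x0 \<in> N \<and> N \<subseteq> U \<and>
        (\<lambda>x. left_field G X x h) ` N \<subseteq> U' \<and> smooth_on (\<phi> ` N) (\<psi> \<circ> (\<lambda>x. left_field G X x h) \<circ> inv_into U \<phi>)"
    using c N by (intro exI[of _ U] exI[of _ \<phi>] exI[of _ UNIV] exI[of _ id] exI[of _ N]) (simp add: std_atlas_iff)
qed

lemma smooth_at_left_field: "smooth_at \<A> x h \<Longrightarrow> smooth_at \<A> x (\<lambda>x. left_field G X x h)"
  unfolding smooth_at_def using smooth_left_field by blast

end

section \<open>The Lie bracket as a commutator of invariant fields\<close>

context lie
begin

abbreviation "br \<equiv> bracket G"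

text \<open>In a chart, both iterated derivatives contain the same second-order term, by the symmetry
  of second derivatives; what is left is a tangent vector.\<close>

lemma lie_commutator_tangent:
  "(\<lambda>h. if smooth_at \<A> e h then lvec X (\<lambda>x. left_field G Y x h) - lvec Y (\<lambda>x. left_field G X x h) else 0)
    \<in> tangent_space \<A> e" (is "?B \<in> _")
proof -
  obtain U \<phi> where c: "(U, \<phi>) \<in> \<A>" "e \<in> U" using ex_chart[OF atlas] .
  note cA = smooth_atlasD[OF atlas c(1)]
  \<comment> \<open>The chart components of the invariant field of \<open>X\<close>, as a vector
    field on the chart image.\<close>
  define \<eta> where "\<eta> = (\<lambda>X a. \<Sum>b\<in>Basis. left_field G X (inv_into U \<phi> a) (\<lambda>q. \<phi> q \<bullet> b) *\<^sub>R b)"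
  have \<eta>: "left_field G X x = coord_vector \<A> (U, \<phi>) x (\<eta> X (\<phi> x))" if x: "x \<in> U" for X x
  proof -
    obtain u where u: "left_field G X x = coord_vector \<A> (U, \<phi>) x u"
      using left_field_tangent[of X x] unfolding tangent_space_eq[OF atlas c(1) x] by blast
    have "\<eta> X (\<phi> x) = u"
      using x cA(3) by (simp add: \<eta>_def u coord_vector_chart_component[OF atlas c(1) x] euclidean_representation)
    with u show ?thesis by simp
  qed
  have sm: "smooth_on (\<phi> ` U) (\<eta> X)" for X
    unfolding \<eta>_def
  proof (intro smooth_on_sum smooth_on_scaleR smooth_on_const cA(2))
    fix b
    have "smooth_map \<A> U std_atlas (\<lambda>x. left_field G X x (\<lambda>q. \<phi> q \<bullet> b))"
      by (rule smooth_left_field[OF cA(1) smooth_map_bounded_linear[OF atlas cA(1) bounded_linear_inner_left smooth_map_chart(1)[OF atlas c(1)]]])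
    then show "smooth_on (\<phi> ` U) (\<lambda>a. left_field G X (inv_into U \<phi> a) (\<lambda>q. \<phi> q \<bullet> b))"
      using c(1) unfolding smooth_map_std_iff[OF atlas cA(1)] by (auto simp: o_def)
  qed
  \<comment> \<open>The coordinate formula for the commutator of two vector fields, evaluated at the
    identity.\<close>
  define w where "w = frechet_derivative (\<eta> Y) (at (\<phi> e)) (\<eta> X (\<phi> e)) - frechet_derivative (\<eta> X) (at (\<phi> e)) (\<eta> Y (\<phi> e))"
  have "?B h = coord_vector \<A> (U, \<phi>) e w h" for h
  proof (cases "smooth_at \<A> e h")
    case True
    let ?f = "h \<circ> inv_into U \<phi>"
    obtain W where W: "open W" "e \<in> W" "smooth_map \<A> W std_atlas h" using True by (auto simp: smooth_at_def)
    define N where "N = \<phi> ` (U \<inter> W)"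
    have N: "open N" "\<phi> e \<in> N"
      unfolding N_def using chart_image_open[OF atlas c(1), of "U \<inter> W"] cA(1) W c(2) by auto
    have f: "smooth_on N ?f"
      using W(3) c(1) unfolding smooth_map_std_iff[OF atlas W(1)] N_def by auto
    have smN: "smooth_on N (\<eta> X)" for X
      by (rule smooth_on_subset[OF sm]) (auto simp: N_def)
    have LF: "lvec X (\<lambda>x. left_field G Y x h) =
       frechet_derivative ?f (at (\<phi> e)) (frechet_derivative (\<eta> Y) (at (\<phi> e)) (\<eta> X (\<phi> e))) +
       frechet_derivative (\<lambda>b. frechet_derivative ?f (at b) (\<eta> Y (\<phi> e))) (at (\<phi> e)) (\<eta> X (\<phi> e))" for X Y
    proof -
      have "lvec X (\<lambda>x. left_field G Y x h)
        = frechet_derivative ((\<lambda>x. left_field G Y x h) \<circ> inv_into U \<phi>) (at (\<phi> e)) (\<eta> X (\<phi> e))"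
        using \<eta>[OF c(2), of X] by (simp add: left_field_one coord_vector_apply[OF smooth_at_left_field[OF True]])
      also have "frechet_derivative ((\<lambda>x. left_field G Y x h) \<circ> inv_into U \<phi>) (at (\<phi> e))
        = frechet_derivative (\<lambda>b. frechet_derivative ?f (at b) (\<eta> Y b)) (at (\<phi> e))"
      proof (rule frechet_derivative_cong_open[OF N])
        fix b assume "b \<in> N"
        then obtain x where x: "b = \<phi> x" "x \<in> U" "x \<in> W" by (auto simp: N_def)
        then show "((\<lambda>x. left_field G Y x h) \<circ> inv_into U \<phi>) b = frechet_derivative ?f (at b) (\<eta> Y b)"
          using cA(3) \<eta>[OF x(2), of Y] coord_vector_apply[OF smooth_atI[OF W(3,1) x(3)]] by simp
      qed
      also have "\<dots> = (\<lambda>\<xi>. frechet_derivative ?f (at (\<phi> e)) (frechet_derivative (\<eta> Y) (at (\<phi> e)) \<xi>) +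
          frechet_derivative (\<lambda>b. frechet_derivative ?f (at b) (\<eta> Y (\<phi> e))) (at (\<phi> e)) \<xi>)"
        by (rule frechet_derivative_at[OF has_derivative_along_field[OF N f smN], symmetric])
      finally show ?thesis .
    qed
    have "linear (frechet_derivative ?f (at (\<phi> e)))"
      by (rule linear_frechet_derivative[OF smooth_on_differentiable[OF f N(2)]])
    then show ?thesis
      using True smooth_on_second_derivative_commute[OF N(1) f N(2), of "\<eta> Y (\<phi> e)" "\<eta> X (\<phi> e)"]
      by (simp add: LF coord_vector_apply w_def linear_diff)
  next
    case False
    then show ?thesis by (simp add: coord_vector_def)
  qed
  then have "?B = coord_vector \<A> (U, \<phi>) e w" by (rule ext)
  then show ?thesis using coord_vector_in_tangent_space[OF c] by simp
qed

text \<open>\<open>bracket\<close> is defined through the inverse of \<open>lvec\<close>, which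
  carries information only on tangent vectors at the identity; \<open>lie_commutator_tangent\<close>
  says that the commutator is one.\<close>

lemma vec_bracket:
  assumes "smooth_at \<A> e h"
  shows "lvec (br X Y) h = lvec X (\<lambda>x. left_field G Y x h) - lvec Y (\<lambda>x. left_field G X x h)"
  unfolding bracket_def vec_inv[OF lie_commutator_tangent] using assms by simp

text \<open>Left invariance moves the commutator formula from the identity to \<open>x\<close>, with
  \<open>h \<circ> mul x\<close> in place of \<open>h\<close>. The inner functions are compared only
  where \<open>h\<close> is smooth, hence the appeal to locality of tangent vectors.\<close>

lemma left_field_bracket:
  assumes h: "smooth_at \<A> x h"
  shows "left_field G (br X Y) x h =
    left_field G X x (\<lambda>y. left_field G Y y h) - left_field G Y x (\<lambda>y. left_field G X y h)"
proof -
  have h': "smooth_at \<A> (mul x e) h" using h by (simp add: group_laws)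
  have he: "smooth_at \<A> e (h \<circ> mul x)"
    by (rule smooth_at_compose[OF atlas atlas smooth_left_mul open_UNIV UNIV_I h'])
  obtain W where W: "open W" "x \<in> W" "smooth_map \<A> W std_atlas h" using h by (auto simp: smooth_at_def)
  have o: "open (UNIV \<inter> mul x -` W)"
    by (rule open_preimage_continuous_on[OF smooth_map_continuous_on[OF smooth_left_mul] open_UNIV W(1)])
  have *: "left_field G X x (\<lambda>y. left_field G Y y h) = lvec X (\<lambda>y. left_field G Y y (h \<circ> mul x))" for X Y
  proof -
    have "left_field G X x (\<lambda>y. left_field G Y y h) = lvec X ((\<lambda>y. left_field G Y y h) \<circ> mul x)"
      using smooth_at_left_field[OF h] by (simp add: left_field_apply[of X])
    also have "\<dots> = lvec X (\<lambda>y. left_field G Y y (h \<circ> mul x))"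
    proof (rule tangent_vector_local[OF atlas vec_tangent o])
      show "e \<in> UNIV \<inter> mul x -` W" using W(2) by (simp add: group_laws)
      fix y assume "y \<in> UNIV \<inter> mul x -` W"
      then have "smooth_at \<A> (mul x y) h" using smooth_atI[OF W(3,1)] by simp
      then show "((\<lambda>y. left_field G Y y h) \<circ> mul x) y = left_field G Y y (h \<circ> mul x)"
        by (simp add: left_field_left_mul)
    qed
    finally show ?thesis .
  qed
  show ?thesis
    unfolding * using h vec_bracket[OF he] by (simp add: left_field_apply[of "br X Y"])
qed

lemma vec_eqI:
  assumes "\<And>h. smooth_at \<A> e h \<Longrightarrow> lvec X h = lvec Y h"
  shows "X = Y"
proof (rule injD[OF inj_vec], rule ext)
  fix h show "lvec X h = lvec Y h"
    using assms tangent_vector_not_smooth[OF vec_tangent] by (cases "smooth_at \<A> e h") auto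
qed

lemma bracket_antisym: "br X Y = - br Y X"
proof (rule vec_eqI)
  fix h assume "smooth_at \<A> e h"
  then show "lvec (br X Y) h = lvec (- br Y X) h"
    using linear_neg[OF linear_vec[of h], of "br Y X"] by (simp add: vec_bracket)
qed

lemma bracket_add_right: "br X (Y + Z) = br X Y + br X Z"
proof (rule vec_eqI)
  fix h assume h: "smooth_at \<A> e h"
  have "lvec X (\<lambda>x. left_field G (Y + Z) x h) = lvec X (\<lambda>x. left_field G Y x h) + lvec X (\<lambda>x. left_field G Z x h)"
    unfolding linear_add[OF linear_left_field]
    by (rule tangent_vector_add[OF atlas vec_tangent smooth_at_left_field[OF h] smooth_at_left_field[OF h]])
  then show "lvec (br X (Y + Z)) h = lvec (br X Y + br X Z) h"
    by (simp add: vec_bracket[OF h] vec_linear)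
qed

lemma bracket_scaleR_right: "br X (r *\<^sub>R Y) = r *\<^sub>R br X Y"
proof (rule vec_eqI)
  fix h assume h: "smooth_at \<A> e h"
  have "lvec X (\<lambda>x. left_field G (r *\<^sub>R Y) x h) = r * lvec X (\<lambda>x. left_field G Y x h)"
    unfolding linear_scale[OF linear_left_field] real_scaleR_def
    by (rule tangent_vector_cmult[OF atlas vec_tangent smooth_at_left_field[OF h]])
  then show "lvec (br X (r *\<^sub>R Y)) h = lvec (r *\<^sub>R br X Y) h"
    by (simp add: vec_bracket[OF h] vec_linear right_diff_distrib)
qed

lemma linear_bracket_right: "linear (br X)"
  by (rule linearI) (simp_all add: bracket_add_right bracket_scaleR_right)

lemma linear_bracket_left: "linear (\<lambda>X. br X Y)"
proof (rule linearI)
  show "br (X + X') Y = br X Y + br X' Y" for X X'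
    using bracket_antisym[of "X + X'" Y] bracket_antisym[of X Y] bracket_antisym[of X' Y]
    by (simp add: bracket_add_right)
  show "br (r *\<^sub>R X) Y = r *\<^sub>R br X Y" for r X
    using bracket_antisym[of "r *\<^sub>R X" Y] bracket_antisym[of X Y] by (simp add: bracket_scaleR_right)
qed

text \<open>The Jacobi identity of commutators of operators: \<open>left_field_bracket\<close>
  expands inner brackets away from the identity, \<open>vec_bracket\<close> the outer ones at it.
  This form says that ad X is a derivation, which gives ad [X,Y] = [ad X, ad Y].\<close>

lemma jacobi: "br X (br Y Z) = br (br X Y) Z + br Y (br X Z)"
proof (rule vec_eqI)
  fix h assume h: "smooth_at \<A> e h"
  let ?L = "\<lambda>X h x. left_field G X x h"
  obtain W where W: "open W" "e \<in> W" "smooth_map \<A> W std_atlas h" using h by (auto simp: smooth_at_def)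
  have sm: "smooth_at \<A> e (?L X h)" "smooth_at \<A> e (?L X (?L Y h))" for X Y
    by (intro smooth_at_left_field h)+
  have *: "lvec X (?L (br Y Z) h) = lvec X (?L Y (?L Z h)) - lvec X (?L Z (?L Y h))" for X Y Z
  proof -
    have "lvec X (?L (br Y Z) h) = lvec X (\<lambda>x. ?L Y (?L Z h) x - ?L Z (?L Y h) x)"
      by (rule tangent_vector_local[OF atlas vec_tangent W(1,2)])
        (rule left_field_bracket[OF smooth_atI[OF W(3,1)]])
    also have "\<dots> = lvec X (?L Y (?L Z h)) - lvec X (?L Z (?L Y h))"
      by (rule tangent_vector_diff[OF atlas vec_tangent sm(2) sm(2)])
    finally show ?thesis .
  qed
  show "lvec (br X (br Y Z)) h = lvec (br (br X Y) Z + br Y (br X Z)) h"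
    by (simp add: vec_linear vec_bracket[OF h] vec_bracket[OF sm(1)] *)
qed

end

text \<open>Expanding in the orthonormal \<open>Basis\<close> turns both traces into one double sum
  of products of matrix entries.\<close>

lemma trace_commute:
  fixes f g :: "'a::euclidean_space \<Rightarrow> 'a"
  assumes "linear f" "linear g"
  shows "(\<Sum>b\<in>Basis. f (g b) \<bullet> b) = (\<Sum>b\<in>Basis. g (f b) \<bullet> b)"
proof -
  have *: "f (g b) \<bullet> b = (\<Sum>c\<in>Basis. (g b \<bullet> c) * (f c \<bullet> b))" if "linear f" for f g :: "'a \<Rightarrow> 'a" and b
  proof -
    have "f (g b) = (\<Sum>c\<in>Basis. (g b \<bullet> c) *\<^sub>R f c)"
      using linear_sum[OF that, of "\<lambda>c. (g b \<bullet> c) *\<^sub>R c" Basis] linear_scale[OF that]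
      by (simp add: euclidean_representation)
    then show ?thesis by (simp add: inner_sum_left)
  qed
  have "(\<Sum>b\<in>Basis. f (g b) \<bullet> b) = (\<Sum>b\<in>Basis. \<Sum>c\<in>Basis. (g b \<bullet> c) * (f c \<bullet> b))"
    using *[OF assms(1), of g] by simp
  also have "\<dots> = (\<Sum>c\<in>Basis. \<Sum>b\<in>Basis. (f c \<bullet> b) * (g b \<bullet> c))"
    by (subst sum.swap) (simp add: mult.commute)
  also have "\<dots> = (\<Sum>c\<in>Basis. g (f c) \<bullet> c)"
    using *[OF assms(2), of f] by simp
  finally show ?thesis .
qed

section \<open>Invariance of the Killing form\<close>

context lie
begin

lemma killing_sym: "killing G X Y = killing G Y X"
  unfolding killing_def by (rule trace_commute[OF linear_bracket_right linear_bracket_right])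

text \<open>With ad [X,Y] = [ad X, ad Y], the two sides differ only in the traces of ad Y ad X ad Z
  and ad X ad Z ad Y, which agree by cyclic permutation.\<close>

lemma killing_invariant: "killing G (br X Y) Z = killing G X (br Y Z)"
proof -
  have ad: "br (br X Y) B = br X (br Y B) - br Y (br X B)" for X Y B
    using jacobi[of X Y B] by simp
  have "(\<Sum>b\<in>Basis. br Y (br X (br Z b)) \<bullet> b) = (\<Sum>b\<in>Basis. br X (br Z (br Y b)) \<bullet> b)"
    using trace_commute[OF linear_bracket_right[of Y] linear_compose[OF linear_bracket_right[of Z] linear_bracket_right[of X]]]
    by (simp add: o_def)
  then show ?thesis
    unfolding killing_def ad[of X Y] ad[of Y Z] linear_diff[OF linear_bracket_right] inner_diff_left sum_subtractf
    by simp
qed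

lemma linear_killing: "linear (\<lambda>X. killing G X Y)" "linear (killing G X)"
proof -
  show 1: "linear (\<lambda>X. killing G X Y)" for Y
    unfolding killing_def
    by (rule linearI) (simp_all add: linear_add[OF linear_bracket_left] linear_scale[OF linear_bracket_left]
        inner_add_left sum.distrib sum_distrib_left)
  show "linear (killing G X)"
    using 1[of X] by (subst ext[of "killing G X" "\<lambda>Y. killing G Y X", OF killing_sym])
qed

end

section \<open>The Maurer--Cartan equation\<close>

lemma smooth_map_from_chart:
  assumes A: "smooth_atlas \<A>" and c: "(U, \<phi>) \<in> \<A>" and W: "open W" "W \<subseteq> U"
    and f: "smooth_on (\<phi> ` W) (f \<circ> inv_into U \<phi>)"
  shows "smooth_map \<A> W std_atlas f"
proof (rule smooth_mapI[OF A smooth_atlas_std])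
  fix p assume p: "p \<in> W"
  show "\<exists>U \<phi> U' \<psi> N. (U, \<phi>) \<in> \<A> \<and> (U', \<psi>) \<in> std_atlas \<and> open N \<and> p \<in> N \<and> N \<subseteq> U \<and>
        f ` N \<subseteq> U' \<and> smooth_on (\<phi> ` N) (\<psi> \<circ> f \<circ> inv_into U \<phi>)"
    using c W p f
    by (intro exI[of _ U] exI[of _ \<phi>] exI[of _ UNIV] exI[of _ id] exI[of _ W]) (simp add: std_atlas_iff)
qed

context lie
begin

context
  fixes \<M> :: "('m::{t2_space,second_countable_topology}, 'd::euclidean_space) chart set" and g :: "'m \<Rightarrow> 'g" and W
  assumes M: "smooth_atlas \<M>" and g: "smooth_map \<M> W \<A> g" and W: "open W"
begin

abbreviation "mcp \<equiv> pullback \<A> g (mc_form G)"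

lemma left_field_mc_pullback:
  assumes "p \<in> W" "v \<in> tangent_space \<M> p"
  shows "left_field G (mcp p v) (g p) = pushforward \<A> g p v"
  unfolding pullback_def
  by (rule left_field_mc[OF pushforward_in_tangent_space[OF M atlas g W assms]])

text \<open>An element of the Lie algebra is determined by its invariant field at
  \<open>g p\<close>. For the value of \<open>mcp\<close> this field sends \<open>h\<close> to the
  coordinate vector applied to h \<circ> g, which is linear in the components
  \<open>w\<close>.\<close>

lemma linear_mc_pullback:
  assumes p: "p \<in> W" "p \<in> U" and c: "(U, \<phi>) \<in> \<M>"
  shows "linear (\<lambda>w. mcp p (coord_vector \<M> (U, \<phi>) p w))"
proof -
  note t = coord_vector_in_tangent_space[OF c p(2)]
  have *: "mcp p (coord_vector \<M> (U, \<phi>) p w) = X"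
    if "\<And>h. smooth_at \<A> (g p) h \<Longrightarrow> left_field G X (g p) h = coord_vector \<M> (U, \<phi>) p w (h \<circ> g)" for w X
  proof -
    have "left_field G X (g p) = pushforward \<A> g p (coord_vector \<M> (U, \<phi>) p w)"
    proof
      fix h show "left_field G X (g p) h = pushforward \<A> g p (coord_vector \<M> (U, \<phi>) p w) h"
        using that[of h] by (cases "smooth_at \<A> (g p) h") (simp_all add: pushforward_def left_field_apply)
    qed
    then show ?thesis unfolding pullback_def by (metis mc_left_field)
  qed
  have LF: "left_field G (mcp p (coord_vector \<M> (U, \<phi>) p w)) (g p) h = coord_vector \<M> (U, \<phi>) p w (h \<circ> g)"
    if "smooth_at \<A> (g p) h" for h w
    using that left_field_mc_pullback[OF p(1) t, of w] by (simp add: pushforward_def)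
  show ?thesis
    by (rule linearI; rule *)
      (simp_all add: linear_add[OF linear_left_field] linear_scale[OF linear_left_field] LF
        linear_add[OF linear_coord_vector[OF M c p(2)]] linear_scale[OF linear_coord_vector[OF M c p(2)]])
qed

text \<open>In a chart \<open>\<phi>1\<close> of the group around the identity, the value of \<open>g\<^sup>-\<^sup>1dg\<close> at \<open>a\<close> is the
  derivative of \<open>b \<mapsto> \<phi>1 (g(a)\<^sup>-\<^sup>1 g(b))\<close> at \<open>b = a\<close>.\<close>

lemma smooth_mc_pullback:
  assumes c: "(U, \<phi>) \<in> \<M>"
  shows "smooth_on (\<phi> ` (U \<inter> W)) (\<lambda>a. mcp (inv_into U \<phi> a) (coord_vector \<M> (U, \<phi>) (inv_into U \<phi> a) w))"
proof -
  note cM = smooth_atlasD[OF M c]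
  obtain U1 \<phi>1 where c1: "(U1, \<phi>1) \<in> \<A>" "e \<in> U1" using ex_chart[OF atlas] .
  note cA1 = smooth_atlasD[OF atlas c1(1)]
  have UW: "open (U \<inter> W)" "U \<inter> W \<subseteq> U" using cM(1) W by auto
  define N where "N = \<phi> ` (U \<inter> W)"
  have N: "open N" unfolding N_def by (rule chart_image_open[OF M c UW])
  have gN: "smooth_map std_atlas N \<A> (g \<circ> inv_into U \<phi>)"
    by (rule smooth_map_compose[OF smooth_atlas_std M atlas N W _ smooth_map_subset[OF smooth_map_chart(2)[OF M c]] g])
      (use cM(3) in \<open>auto simp: N_def\<close>)
  define T where "T = N \<times> N"
  have T: "open T" unfolding T_def by (intro open_Times N)
  have 1: "smooth_map std_atlas T \<A> ((g \<circ> inv_into U \<phi>) \<circ> fst)"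
    using T by (intro smooth_map_compose[OF smooth_atlas_std smooth_atlas_std atlas _ N _ _ gN])
      (auto simp: T_def smooth_map_std_std_iff smooth_on_linear bounded_linear_fst)
  have 2: "smooth_map std_atlas T \<A> ((g \<circ> inv_into U \<phi>) \<circ> snd)"
    using T by (intro smooth_map_compose[OF smooth_atlas_std smooth_atlas_std atlas _ N _ _ gN])
      (auto simp: T_def smooth_map_std_std_iff smooth_on_linear bounded_linear_snd)
  have 3: "smooth_map std_atlas T \<A> (lg_inv G \<circ> ((g \<circ> inv_into U \<phi>) \<circ> fst))"
    by (rule smooth_map_compose[OF smooth_atlas_std atlas atlas T open_UNIV subset_UNIV 1 smooth_inv])
  \<comment> \<open>In coordinates the pair (a, b) goes to \<open>g(a)\<^sup>-\<^sup>1 g(b)\<close>,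
    which is smooth in both variables jointly and equals the identity on the diagonal.\<close>
  define P where "P = (\<lambda>z. mul ((lg_inv G \<circ> ((g \<circ> inv_into U \<phi>) \<circ> fst)) z) (((g \<circ> inv_into U \<phi>) \<circ> snd) z))"
  have P: "smooth_map std_atlas T \<A> P"
    unfolding P_def by (rule smooth_mul[OF smooth_atlas_std T 3 2])
  define S where "S = T \<inter> P -` U1"
  have S: "open S"
    unfolding S_def by (rule open_preimage_continuous_on[OF smooth_map_continuous_on[OF P] T cA1(1)])
  define K where "K = \<phi>1 \<circ> P"
  have "smooth_map std_atlas S std_atlas K"
    unfolding K_def
    by (rule smooth_map_compose[OF smooth_atlas_std atlas smooth_atlas_std S cA1(1) _ smooth_map_subset[OF P]
          smooth_map_chart(1)[OF atlas c1(1)]]) (auto simp: S_def)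
  then have K: "smooth_on S K" by (simp add: smooth_map_std_std_iff)
  have inS: "(a, a) \<in> S" if "a \<in> N" for a
    using that c1 by (simp add: S_def T_def P_def group_laws)
  \<comment> \<open>Passage from components at the identity in the chart \<phi>1 to the Lie algebra;
    being linear, it preserves smoothness.\<close>
  define L where "L = (\<lambda>u. inv lvec (coord_vector \<A> (U1, \<phi>1) e u))"
  have vecL: "lvec (L u) = coord_vector \<A> (U1, \<phi>1) e u" for u
    unfolding L_def by (rule vec_inv[OF coord_vector_in_tangent_space[OF c1]])
  have "linear L"
    by (rule linearI; rule vec_eqI)
      (simp_all add: vec_linear vecL linear_add[OF linear_coord_vector[OF atlas c1]] linear_scale[OF linear_coord_vector[OF atlas c1]])
  then have L: "bounded_linear L" by (simp add: linear_conv_bounded_linear)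
  have eq: "mcp (inv_into U \<phi> a) (coord_vector \<M> (U, \<phi>) (inv_into U \<phi> a) w) = L (frechet_derivative K (at (a, a)) (0, w))"
    if a: "a \<in> N" for a
  proof -
    obtain p where p: "a = \<phi> p" "p \<in> U" "p \<in> W" using a by (auto simp: N_def)
    have pa: "inv_into U \<phi> a = p" using p cM(3) by simp
    have lg: "smooth_map \<M> W \<A> (mul (lg_inv G (g p)) \<circ> g)"
      by (rule smooth_map_compose[OF M atlas atlas W open_UNIV subset_UNIV g smooth_left_mul])
    have lgp: "(mul (lg_inv G (g p)) \<circ> g) p = e" by (simp add: group_laws)
    have "pushforward \<A> (mul (lg_inv G (g p))) (g p) (pushforward \<A> g p (coord_vector \<M> (U, \<phi>) p w))
      = pushforward \<A> (mul (lg_inv G (g p)) \<circ> g) p (coord_vector \<M> (U, \<phi>) p w)"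
      by (rule pushforward_compose[OF atlas atlas smooth_left_mul open_UNIV UNIV_I])
    also have "\<dots> = coord_vector \<A> (U1, \<phi>1) ((mul (lg_inv G (g p)) \<circ> g) p)
       (frechet_derivative (\<phi>1 \<circ> (mul (lg_inv G (g p)) \<circ> g) \<circ> inv_into U \<phi>) (at (\<phi> p)) w)"
      by (rule pushforward_coord_vector[OF M atlas lg W p(3) c p(2) c1(1)]) (simp only: lgp c1(2))
    also have "\<phi>1 \<circ> (mul (lg_inv G (g p)) \<circ> g) \<circ> inv_into U \<phi> = (\<lambda>b. K (a, b))"
      by (simp add: K_def P_def o_def pa)
    also have "frechet_derivative (\<lambda>b. K (a, b)) (at (\<phi> p)) = (\<lambda>w. frechet_derivative K (at (a, a)) (0, w))"
    proof -
      have "((\<lambda>b. (a, b)) has_derivative (\<lambda>w. (0, w))) (at a)"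
        by (auto intro!: derivative_eq_intros)
      from has_derivative_compose[OF this smooth_on_has_derivative[OF K inS[OF a]]]
      show ?thesis unfolding p(1)[symmetric] by (rule frechet_derivative_at[symmetric])
    qed
    finally have *: "pushforward \<A> (mul (lg_inv G (g p))) (g p) (pushforward \<A> g p (coord_vector \<M> (U, \<phi>) p w))
      = coord_vector \<A> (U1, \<phi>1) e (frechet_derivative K (at (a, a)) (0, w))"
      unfolding lgp .
    show ?thesis unfolding pa pullback_def mc_form_def * L_def ..
  qed
  have "smooth_on N (\<lambda>a. (a, a))" by (intro smooth_on_Pair smooth_on_ident N)
  then have "smooth_on N (\<lambda>a. frechet_derivative K (at (a, a)) (0, w))"
    by (rule smooth_on_compose[OF N S _ _ smooth_on_deriv[OF K, of "(0, w)"], rotated]) (use inS in auto)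
  then have "smooth_on N (\<lambda>a. L (frechet_derivative K (at (a, a)) (0, w)))"
    by (rule smooth_on_bounded_linear[OF L N])
  then have "smooth_on N (\<lambda>a. mcp (inv_into U \<phi> a) (coord_vector \<M> (U, \<phi>) (inv_into U \<phi> a) w))"
    by (rule smooth_on_cong[OF N, THEN iffD2, rotated]) (rule eq)
  then show ?thesis by (simp add: N_def)
qed

text \<open>For a function \<open>h\<close> on the group and left-invariant fields \<open>X\<^sub>i\<close> belonging to a basis,
  \<open>d(h \<circ> g) = \<Sum>i. \<omega>\<^sup>i (X\<^sub>i h) \<circ> g\<close> with \<open>\<omega> = g\<^sup>-\<^sup>1dg\<close>; the structure equation is the symmetry of the second
  derivatives of \<open>h \<circ> g\<close>.\<close>

lemma structure_equation:
  assumes c: "(U, \<phi>) \<in> \<M>" and p: "p \<in> U" "p \<in> W"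
  defines "\<omega> \<equiv> \<lambda>w a. mcp (inv_into U \<phi> a) (coord_vector \<M> (U, \<phi>) (inv_into U \<phi> a) w)"
  shows "frechet_derivative (\<omega> w) (at (\<phi> p)) u - frechet_derivative (\<omega> u) (at (\<phi> p)) w + br (\<omega> u (\<phi> p)) (\<omega> w (\<phi> p)) = 0"
proof (rule left_field_eq_0D[of "g p"])
  fix h assume "smooth_at \<A> (g p) h"
  then obtain W' where W': "open W'" "g p \<in> W'" "smooth_map \<A> W' std_atlas h" by (auto simp: smooth_at_def)
  note cM = smooth_atlasD[OF M c]
  define Q where "Q = (W \<inter> g -` W') \<inter> U"
  have Q: "open Q" "p \<in> Q" "Q \<subseteq> U" "Q \<subseteq> W" "g ` Q \<subseteq> W'"
    using open_preimage_continuous_on[OF smooth_map_continuous_on[OF g] W W'(1)] cM(1) p W'(2)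
    by (auto simp: Q_def)
  define N where "N = \<phi> ` Q"
  have N: "open N" unfolding N_def by (rule chart_image_open[OF M c Q(1,3)])
  have pN: "\<phi> p \<in> N" using Q(2) by (simp add: N_def)
  define \<gamma> where "\<gamma> = g \<circ> inv_into U \<phi>"
  have \<gamma>p: "\<gamma> (\<phi> p) = g p" using p cM(3) by (simp add: \<gamma>_def)
  have \<omega>: "smooth_on N (\<omega> w)" for w
    unfolding \<omega>_def by (rule smooth_on_subset[OF smooth_mc_pullback[OF c]]) (use Q in \<open>auto simp: N_def\<close>)
  have sm: "smooth_on N (k \<circ> \<gamma>)" if "smooth_map \<A> W' std_atlas k" for k
  proof -
    have "smooth_map \<M> Q std_atlas (k \<circ> g)"
      by (rule smooth_map_compose[OF M atlas smooth_atlas_std Q(1) W'(1) Q(5) smooth_map_subset[OF g Q(4)] that])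
    then have "smooth_on (\<phi> ` (U \<inter> Q)) (k \<circ> g \<circ> inv_into U \<phi>)"
      using c unfolding smooth_map_std_iff[OF M Q(1)] by blast
    moreover have "U \<inter> Q = Q" using Q(3) by blast
    ultimately show ?thesis by (simp add: N_def \<gamma>_def o_assoc)
  qed
  have D: "frechet_derivative (k \<circ> \<gamma>) (at a) w = left_field G (\<omega> w a) (\<gamma> a) k"
    if k: "smooth_map \<A> W' std_atlas k" and a: "a \<in> N" for k a w
  proof -
    obtain q where q: "a = \<phi> q" "q \<in> Q" using a by (auto simp: N_def)
    have qU: "q \<in> U" "q \<in> W" "g q \<in> W'" using q Q by auto
    have qa: "inv_into U \<phi> a = q" using q qU cM(3) by simp
    have kq: "smooth_at \<A> (g q) k" by (rule smooth_atI[OF k W'(1) qU(3)])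
    have kgq: "smooth_at \<M> q (k \<circ> g)" by (rule smooth_at_compose[OF M atlas g W qU(2) kq])
    have "left_field G (\<omega> w a) (\<gamma> a) k = pushforward \<A> g q (coord_vector \<M> (U, \<phi>) q w) k"
      unfolding \<omega>_def \<gamma>_def o_def qa
      by (rule fun_cong[OF left_field_mc_pullback[OF qU(2) coord_vector_in_tangent_space[OF c qU(1)]]])
    also have "\<dots> = frechet_derivative (k \<circ> \<gamma>) (at a) w"
      using kq kgq by (simp add: pushforward_def coord_vector_apply q(1) \<gamma>_def o_assoc)
    finally show ?thesis by simp
  qed
  have lf: "smooth_map \<A> W' std_atlas (\<lambda>x. left_field G X x h)" for X
    by (rule smooth_left_field[OF W'(1,3)])
  have exp: "left_field G X x h = (\<Sum>i\<in>Basis. (X \<bullet> i) * left_field G i x h)" for X x h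
    using linear_sum[OF linear_left_field[of x h], of "\<lambda>i. (X \<bullet> i) *\<^sub>R i" Basis] linear_scale[OF linear_left_field[of x h]]
    by (simp add: euclidean_representation)
  \<comment> \<open>Differentiating d(h \<circ> g) once more gives two kinds of terms: those in
    which \<omega> is differentiated, and iterated invariant fields applied to
    \<open>h\<close>.\<close>
  have DD: "frechet_derivative (\<lambda>a. frechet_derivative (h \<circ> \<gamma>) (at a) w) (at (\<phi> p)) u
    = left_field G (frechet_derivative (\<omega> w) (at (\<phi> p)) u) (g p) h
      + left_field G (\<omega> u (\<phi> p)) (g p) (\<lambda>x. left_field G (\<omega> w (\<phi> p)) x h)" for u w
  proof -
    let ?k = "\<lambda>i. (\<lambda>x. left_field G i x h) \<circ> \<gamma>"
    have "((\<lambda>a. \<Sum>i\<in>Basis. (\<omega> w a \<bullet> i) * ?k i a) has_derivative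
       (\<lambda>u. \<Sum>i\<in>Basis. (\<omega> w (\<phi> p) \<bullet> i) * frechet_derivative (?k i) (at (\<phi> p)) u + (frechet_derivative (\<omega> w) (at (\<phi> p)) u \<bullet> i) * ?k i (\<phi> p))) (at (\<phi> p))"
    proof (rule has_derivative_sum, rule has_derivative_mult)
      fix i
      show "((\<lambda>a. \<omega> w a \<bullet> i) has_derivative (\<lambda>u. frechet_derivative (\<omega> w) (at (\<phi> p)) u \<bullet> i)) (at (\<phi> p))"
        by (rule bounded_linear.has_derivative[OF bounded_linear_inner_left smooth_on_has_derivative[OF \<omega> pN]])
      show "(?k i has_derivative frechet_derivative (?k i) (at (\<phi> p))) (at (\<phi> p))"
        by (rule smooth_on_has_derivative[OF sm[OF lf] pN])
    qed
    moreover have "(\<Sum>i\<in>Basis. (\<omega> w a \<bullet> i) * ?k i a) = frechet_derivative (h \<circ> \<gamma>) (at a) w" if "a \<in> N" for a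
      unfolding D[OF W'(3) that] using exp[of "\<omega> w a" "\<gamma> a" h] by simp
    ultimately have "((\<lambda>a. frechet_derivative (h \<circ> \<gamma>) (at a) w) has_derivative
       (\<lambda>u. \<Sum>i\<in>Basis. (\<omega> w (\<phi> p) \<bullet> i) * frechet_derivative (?k i) (at (\<phi> p)) u + (frechet_derivative (\<omega> w) (at (\<phi> p)) u \<bullet> i) * ?k i (\<phi> p))) (at (\<phi> p))"
      by (rule has_derivative_transform_within_open[OF _ N pN])
    from fun_cong[OF frechet_derivative_at[OF this, symmetric], of u]
    have 1: "frechet_derivative (\<lambda>a. frechet_derivative (h \<circ> \<gamma>) (at a) w) (at (\<phi> p)) u
      = (\<Sum>i\<in>Basis. (\<omega> w (\<phi> p) \<bullet> i) * frechet_derivative (?k i) (at (\<phi> p)) u)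
        + (\<Sum>i\<in>Basis. (frechet_derivative (\<omega> w) (at (\<phi> p)) u \<bullet> i) * ?k i (\<phi> p))"
      by (simp only: sum.distrib)
    have 2: "(\<Sum>i\<in>Basis. (frechet_derivative (\<omega> w) (at (\<phi> p)) u \<bullet> i) * ?k i (\<phi> p))
      = left_field G (frechet_derivative (\<omega> w) (at (\<phi> p)) u) (g p) h"
      using exp[of "frechet_derivative (\<omega> w) (at (\<phi> p)) u" "g p" h] by (simp add: \<gamma>p)
    have k2: "frechet_derivative (?k X) (at (\<phi> p)) u = left_field G (\<omega> u (\<phi> p)) (g p) (\<lambda>x. left_field G X x h)" for X
      using D[OF lf pN] by (simp add: \<gamma>p)
    \<comment> \<open>Reassembles the basis fields: the derivative is linear in the element that
      defines the field.\<close>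
    have "frechet_derivative (?k X) (at (\<phi> p)) u = (\<Sum>i\<in>Basis. (X \<bullet> i) * frechet_derivative (?k i) (at (\<phi> p)) u)" for X
    proof -
      have "((\<lambda>a. \<Sum>i\<in>Basis. (X \<bullet> i) * ?k i a) has_derivative
         (\<lambda>u. \<Sum>i\<in>Basis. (X \<bullet> i) * frechet_derivative (?k i) (at (\<phi> p)) u)) (at (\<phi> p))"
        by (rule has_derivative_sum, rule has_derivative_mult_right) (rule smooth_on_has_derivative[OF sm[OF lf] pN])
      moreover have "(\<lambda>a. \<Sum>i\<in>Basis. (X \<bullet> i) * ?k i a) = ?k X"
        by (rule ext) (simp add: exp[of X _ h])
      ultimately have "(?k X has_derivative (\<lambda>u. \<Sum>i\<in>Basis. (X \<bullet> i) * frechet_derivative (?k i) (at (\<phi> p)) u)) (at (\<phi> p))"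
        by (simp only:)
      from fun_cong[OF frechet_derivative_at[OF this, symmetric], of u] show ?thesis .
    qed
    from this[of "\<omega> w (\<phi> p)"] show ?thesis
      unfolding 1 2 k2 by simp
  qed
  \<comment> \<open>Exchanging \<open>u\<close> and \<open>w\<close> and subtracting leaves the
    derivatives of \<omega> and, through \<open>left_field_bracket\<close>, the bracket
    term.\<close>
  have "frechet_derivative (\<lambda>a. frechet_derivative (h \<circ> \<gamma>) (at a) w) (at (\<phi> p)) u
    = frechet_derivative (\<lambda>a. frechet_derivative (h \<circ> \<gamma>) (at a) u) (at (\<phi> p)) w"
    by (rule smooth_on_second_derivative_commute[OF N sm[OF W'(3)] pN])
  then show "left_field G (frechet_derivative (\<omega> w) (at (\<phi> p)) u - frechet_derivative (\<omega> u) (at (\<phi> p)) w +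
      br (\<omega> u (\<phi> p)) (\<omega> w (\<phi> p))) (g p) h = 0"
    unfolding DD linear_add[OF linear_left_field] linear_diff[OF linear_left_field]
      left_field_bracket[OF smooth_atI[OF W'(3,1,2)]]
    by simp
qed

text \<open>Translation of \<open>structure_equation\<close> into \<open>ext_deriv\<close>: the
  values of the form on coordinate fields with constant components are smooth near \<open>p\<close>,
  and on smooth functions \<open>dvec\<close> is the ordinary derivative in the chart.\<close>

lemma maurer_cartan_pullback: "maurer_cartan_eq G \<M> W mcp"
  unfolding maurer_cartan_eq_def
proof clarify
  fix U \<phi> p u w assume c: "(U, \<phi>) \<in> \<M>" and p: "p \<in> W" "p \<in> fst (U, \<phi>)"
  have p': "p \<in> U" "p \<in> U \<inter> W" using p by auto
  note cM = smooth_atlasD[OF M c]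
  let ?f = "\<lambda>w q. mcp q (coord_vector \<M> (U, \<phi>) q w)"
  have o: "open (U \<inter> W)" using cM(1) W by auto
  have sm: "smooth_map \<M> (U \<inter> W) std_atlas (?f w)" for w
    using smooth_mc_pullback[OF c, of w] by (intro smooth_map_from_chart[OF M c o]) (auto simp: o_def)
  have d: "dvec (coord_vector \<M> (U, \<phi>) p u) (?f w)
     = frechet_derivative (\<lambda>a. mcp (inv_into U \<phi> a) (coord_vector \<M> (U, \<phi>) (inv_into U \<phi> a) w)) (at (\<phi> p)) u" for u w
    using dvec_coord_vector[OF M c p'(1) sm o p'(2), of u w] by (simp add: o_def)
  show "ext_deriv \<M> mcp (U, \<phi>) p u w + br (mcp p (coord_vector \<M> (U, \<phi>) p u)) (mcp p (coord_vector \<M> (U, \<phi>) p w)) = 0"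
    unfolding ext_deriv_def d using structure_equation[OF c p'(1) p(1), of w u] p'(1) cM(3) by simp
qed

end

end

section \<open>Global primitives on simply connected spaces\<close>

text \<open>\<open>P W f\<close> says that \<open>f\<close> is a primitive on the open set \<open>W\<close>. Functions on a parameter space \<open>K\<close> that
  are locally, up to constants, pullbacks of primitives along \<open>h\<close> replace the lifts to a covering space.\<close>

locale local_primitives =
  fixes P :: "'m::topological_space set \<Rightarrow> ('m \<Rightarrow> 'v::ab_group_add) \<Rightarrow> bool"
  assumes ex_primitive: "\<exists>W f. open W \<and> p \<in> W \<and> P W f"
    and primitive_unique: "P W f \<Longrightarrow> P W' f' \<Longrightarrow> p \<in> W \<Longrightarrow> p \<in> W' \<Longrightarrow>
      \<exists>N c. open N \<and> p \<in> N \<and> (\<forall>q\<in>N. f q = f' q + c)"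
    and primitive_open: "P W f \<Longrightarrow> open W"
begin

definition lift_along :: "('a::topological_space \<Rightarrow> 'm) \<Rightarrow> 'a set \<Rightarrow> ('a \<Rightarrow> 'v) \<Rightarrow> bool" where
  "lift_along h K \<Phi> \<longleftrightarrow> continuous_on K h \<and>
    (\<forall>x\<in>K. \<exists>W f c N. P W f \<and> open N \<and> x \<in> N \<and> (\<forall>y\<in>N \<inter> K. h y \<in> W \<and> \<Phi> y = f (h y) + c))"

lemma lift_alongE:
  assumes "lift_along h K \<Phi>" "x \<in> K"
  obtains W f N c where "P W f" "open N" "x \<in> N" "\<And>y. y \<in> N \<Longrightarrow> y \<in> K \<Longrightarrow> h y \<in> W" "\<And>y. y \<in> N \<Longrightarrow> y \<in> K \<Longrightarrow> \<Phi> y = f (h y) + c"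
  using assms unfolding lift_along_def by (metis IntI)

text \<open>Change of parameter. It covers restriction to a subset, the edges of a square, reversal,
  and the two halves of a joined path.\<close>

lemma lift_along_compose:
  assumes l: "lift_along h K \<Phi>" and s: "continuous_on K' s" "s ` K' \<subseteq> K"
    and eq: "\<And>x. x \<in> K' \<Longrightarrow> h' x = h (s x)"
  shows "lift_along h' K' (\<lambda>x. \<Phi> (s x))"
  unfolding lift_along_def
proof (intro conjI ballI)
  have "continuous_on K' (\<lambda>x. h (s x))"
    using l s by (auto simp: lift_along_def intro: continuous_on_compose2)
  then show "continuous_on K' h'" by (rule continuous_on_eq) (simp add: eq)
  fix x assume x: "x \<in> K'"
  then have "s x \<in> K" using s by auto
  then obtain W f c N where W: "P W f" "open N" "s x \<in> N" "\<And>y. y \<in> N \<Longrightarrow> y \<in> K \<Longrightarrow> h y \<in> W" "\<And>y. y \<in> N \<Longrightarrow> y \<in> K \<Longrightarrow> \<Phi> y = f (h y) + c"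
    using lift_alongE[OF l] by metis
  obtain N' where N': "open N'" "N' \<inter> K' = s -` N \<inter> K'"
    using s(1) W(2) unfolding continuous_on_open_invariant by blast
  have "h' y \<in> W \<and> \<Phi> (s y) = f (h' y) + c" if "y \<in> N' \<inter> K'" for y
  proof -
    have "s y \<in> N" "s y \<in> K" "y \<in> K'" using that N'(2) s(2) by auto
    then show ?thesis using W(4,5) eq by simp
  qed
  moreover have "x \<in> N'" using x W(3) N'(2) by blast
  ultimately show "\<exists>W f c N. P W f \<and> open N \<and> x \<in> N \<and> (\<forall>y\<in>N \<inter> K'. h' y \<in> W \<and> \<Phi> (s y) = f (h' y) + c)"
    using W(1) N'(1) by blast
qed

lemma lift_along_primitive:
  assumes "P W f" "continuous_on K h" "h ` K \<subseteq> W"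
  shows "lift_along h K (\<lambda>x. f (h x))"
  unfolding lift_along_def
proof (intro conjI ballI assms(2))
  fix x assume "x \<in> K"
  show "\<exists>W f' c N. P W f' \<and> open N \<and> x \<in> N \<and> (\<forall>y\<in>N \<inter> K. h y \<in> W \<and> f (h y) = f' (h y) + c)"
    using assms by (intro exI[of _ W] exI[of _ f] exI[of _ 0] exI[of _ UNIV]) auto
qed

text \<open>Brings two lifts at a common point to the same primitive \<open>f\<close>: the constant
  by which their primitives differ near \<open>h x\<close> is absorbed into \<open>c'\<close>.
  Separate domains are allowed for the sake of gluing.\<close>

lemma lift_along_locally_unique:
  assumes l: "lift_along h K \<Phi>" "lift_along h K' \<Phi>'" and x: "x \<in> K" "x \<in> K'" and h: "continuous_on (K \<union> K') h"
  obtains N W f c c' where "open N" "x \<in> N" "P W f"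
    "\<And>y. y \<in> N \<Longrightarrow> y \<in> K \<Longrightarrow> h y \<in> W \<and> \<Phi> y = f (h y) + c"
    "\<And>y. y \<in> N \<Longrightarrow> y \<in> K' \<Longrightarrow> h y \<in> W \<and> \<Phi>' y = f (h y) + c'"
proof -
  obtain W f c N where W: "P W f" "open N" "x \<in> N" "\<And>y. y \<in> N \<Longrightarrow> y \<in> K \<Longrightarrow> h y \<in> W" "\<And>y. y \<in> N \<Longrightarrow> y \<in> K \<Longrightarrow> \<Phi> y = f (h y) + c"
    using lift_alongE[OF l(1) x(1)] by metis
  obtain W' f' c' N' where W': "P W' f'" "open N'" "x \<in> N'" "\<And>y. y \<in> N' \<Longrightarrow> y \<in> K' \<Longrightarrow> h y \<in> W'" "\<And>y. y \<in> N' \<Longrightarrow> y \<in> K' \<Longrightarrow> \<Phi>' y = f' (h y) + c'"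
    using lift_alongE[OF l(2) x(2)] by metis
  obtain O' d where O': "open O'" "h x \<in> O'" "\<forall>q\<in>O'. f' q = f q + d"
    using primitive_unique[OF W'(1) W(1)] W W' x by metis
  have "open (O' \<inter> W)" "h x \<in> O' \<inter> W" using O' primitive_open[OF W(1)] W x by auto
  then obtain N'' where N'': "open N''" "N'' \<inter> (K \<union> K') = h -` (O' \<inter> W) \<inter> (K \<union> K')"
    using h unfolding continuous_on_open_invariant by blast
  show thesis
  proof (rule that[of "N \<inter> N' \<inter> N''" W f c "d + c'"])
    show "open (N \<inter> N' \<inter> N'')" using W W' N'' by auto
    show "x \<in> N \<inter> N' \<inter> N''" using W W' N''(2) x \<open>h x \<in> O' \<inter> W\<close> by blast
    show "P W f" by fact
    show "h y \<in> W \<and> \<Phi> y = f (h y) + c" if "y \<in> N \<inter> N' \<inter> N''" "y \<in> K" for y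
      using that W by auto
    show "h y \<in> W \<and> \<Phi>' y = f (h y) + (d + c')" if "y \<in> N \<inter> N' \<inter> N''" "y \<in> K'" for y
    proof -
      have "h y \<in> O' \<inter> W" using that N''(2) by blast
      then show ?thesis using that W' O' by (simp add: add.assoc)
    qed
  qed
qed

text \<open>On a common patch both lifts are the same primitive plus constants, so their difference
  is locally constant, and constant by connectedness.\<close>

lemma lift_along_unique:
  assumes l: "lift_along h K \<Phi>" "lift_along h K \<Phi>'" and K: "connected K" and xy: "x \<in> K" "y \<in> K"
  shows "\<Phi> x - \<Phi>' x = \<Phi> y - \<Phi>' y"
proof (rule connected_local_const[OF K xy, of "\<lambda>x. \<Phi> x - \<Phi>' x"], rule ballI)
  fix z assume z: "z \<in> K"
  have "continuous_on (K \<union> K) h" using l by (simp add: lift_along_def)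
  from lift_along_locally_unique[OF l z z this]
  obtain N W f c c' where N: "open N" "z \<in> N"
    "\<And>y. y \<in> N \<Longrightarrow> y \<in> K \<Longrightarrow> h y \<in> W \<and> \<Phi> y = f (h y) + c"
    "\<And>y. y \<in> N \<Longrightarrow> y \<in> K \<Longrightarrow> h y \<in> W \<and> \<Phi>' y = f (h y) + c'" by metis
  show "\<forall>\<^sub>F y in at z within K. \<Phi> z - \<Phi>' z = \<Phi> y - \<Phi>' y"
    unfolding eventually_at_topological
    by (rule exI[of _ N]) (use N z in auto)
qed

text \<open>On the connected intersection the two lifts differ by a constant, which is added to the
  second one. Closedness gives a point outside one of the sets a neighbourhood that avoids it; at
  common points both lifts are compared with one primitive.\<close>

lemma lift_along_glue:
  assumes l: "lift_along h K1 \<Phi>1" "lift_along h K2 \<Phi>2" and cl: "closed K1" "closed K2"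
    and K: "connected (K1 \<inter> K2)" and h: "continuous_on (K1 \<union> K2) h"
  shows "\<exists>\<Phi>. lift_along h (K1 \<union> K2) \<Phi>"
proof -
  have sub: "lift_along h (K1 \<inter> K2) \<Phi>1" "lift_along h (K1 \<inter> K2) \<Phi>2"
    using lift_along_compose[OF l(1), of "K1 \<inter> K2" "\<lambda>x. x" h] lift_along_compose[OF l(2), of "K1 \<inter> K2" "\<lambda>x. x" h] by auto
  obtain c where c: "\<And>x. x \<in> K1 \<inter> K2 \<Longrightarrow> \<Phi>1 x = \<Phi>2 x + c"
  proof (cases "K1 \<inter> K2 = {}")
    case False
    then obtain x0 where "x0 \<in> K1 \<inter> K2" by blast
    have "\<Phi>1 x = \<Phi>2 x + (\<Phi>1 x0 - \<Phi>2 x0)" if "x \<in> K1 \<inter> K2" for x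
      unfolding lift_along_unique[OF sub K \<open>x0 \<in> K1 \<inter> K2\<close> that] by simp
    then show ?thesis using that by blast
  qed auto
  define \<Phi> where "\<Phi> = (\<lambda>x. if x \<in> K1 then \<Phi>1 x else \<Phi>2 x + c)"
  have \<Phi>2: "\<Phi> x = \<Phi>2 x + c" if "x \<in> K2" for x using c that by (auto simp: \<Phi>_def)
  have "\<exists>W f c N. P W f \<and> open N \<and> x \<in> N \<and> (\<forall>y\<in>N \<inter> (K1 \<union> K2). h y \<in> W \<and> \<Phi> y = f (h y) + c)"
    if x: "x \<in> K1 \<union> K2" for x
  proof -
    consider (a) "x \<in> K1" "x \<notin> K2" | (b) "x \<in> K2" "x \<notin> K1" | (c) "x \<in> K1" "x \<in> K2" using x by blast
    then show ?thesis
    proof cases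
      case a
      obtain W f d N where W: "P W f" "open N" "x \<in> N" "\<And>y. y \<in> N \<Longrightarrow> y \<in> K1 \<Longrightarrow> h y \<in> W" "\<And>y. y \<in> N \<Longrightarrow> y \<in> K1 \<Longrightarrow> \<Phi>1 y = f (h y) + d"
        using lift_alongE[OF l(1) a(1)] by metis
      show ?thesis
        using W a cl by (intro exI[of _ W] exI[of _ f] exI[of _ d] exI[of _ "N \<inter> - K2"]) (auto simp: \<Phi>_def)
    next
      case b
      obtain W f d N where W: "P W f" "open N" "x \<in> N" "\<And>y. y \<in> N \<Longrightarrow> y \<in> K2 \<Longrightarrow> h y \<in> W" "\<And>y. y \<in> N \<Longrightarrow> y \<in> K2 \<Longrightarrow> \<Phi>2 y = f (h y) + d"
        using lift_alongE[OF l(2) b(1)] by metis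
      show ?thesis
        using W b cl by (intro exI[of _ W] exI[of _ f] exI[of _ "d + c"] exI[of _ "N \<inter> - K1"]) (auto simp: \<Phi>2 add.assoc)
    next
      case c
      obtain N W f d d' where N: "open N" "x \<in> N" "P W f"
        "\<And>y. y \<in> N \<Longrightarrow> y \<in> K1 \<Longrightarrow> h y \<in> W \<and> \<Phi>1 y = f (h y) + d"
        "\<And>y. y \<in> N \<Longrightarrow> y \<in> K2 \<Longrightarrow> h y \<in> W \<and> \<Phi>2 y = f (h y) + d'"
        using lift_along_locally_unique[OF l c h] by metis
      \<comment> \<open>Both formulas hold at \<open>x\<close> itself, which forces the constants of
        the two sides to match.\<close>
      have "f (h x) + d = f (h x) + d' + c" using N(4,5)[OF N(2)] c \<Phi>2[OF c(2)] by (simp add: \<Phi>_def)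
      then have d: "d = d' + c" by (simp add: add.assoc)
      have "h y \<in> W \<and> \<Phi> y = f (h y) + d" if "y \<in> N \<inter> (K1 \<union> K2)" for y
      proof (cases "y \<in> K1")
        case True
        then show ?thesis using that N(4)[of y] by (simp add: \<Phi>_def)
      next
        case False
        then show ?thesis using that N(5)[of y] \<Phi>2[of y] by (simp add: d add.assoc)
      qed
      then show ?thesis using N by blast
    qed
  qed
  then have "lift_along h (K1 \<union> K2) \<Phi>"
    unfolding lift_along_def using h by simp
  then show ?thesis by blast
qed

text \<open>Each small rectangle is mapped into the domain of one primitive. Two bisection arguments
  glue the pieces: vertically to strips of full height, horizontally to the square. Each overlap is
  a segment, hence connected.\<close>

lemma ex_lift_square:
  fixes h :: "real \<times> real \<Rightarrow> 'm"
  assumes h: "continuous_on ({0..1} \<times> {0..1}) h"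
  shows "\<exists>\<Phi>. lift_along h ({0..1} \<times> {0..1}) \<Phi>"
proof -
  define ok where "ok = (\<lambda>a b c d. \<exists>\<Phi>. lift_along h ({a..b} \<times> {c..d}) \<Phi>)"
  have glue2: "ok a b c d" if "ok a b c x" "ok a b x d" "0 \<le> a" "b \<le> 1" "0 \<le> c" "d \<le> 1" "c \<le> x" "x \<le> d" for a b c d x
  proof -
    have "{a..b} \<times> {c..d} = {a..b} \<times> {c..x} \<union> {a..b} \<times> {x..d}" using that by auto
    moreover have "{a..b} \<times> {c..x} \<inter> {a..b} \<times> {x..d} = {a..b} \<times> {x}" using that by auto
    moreover have "continuous_on ({a..b} \<times> {c..d}) h" using that by (intro continuous_on_subset[OF h]) auto
    moreover have "connected ({a..b} \<times> {x})" by (intro connected_Times) auto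
    ultimately show ?thesis
      using that(1,2) lift_along_glue[of h "{a..b} \<times> {c..x}" _ "{a..b} \<times> {x..d}"]
      unfolding ok_def by (metis closed_Times closed_atLeastAtMost)
  qed
  have glue1: "ok a b c d" if "ok a x c d" "ok x b c d" "0 \<le> a" "b \<le> 1" "0 \<le> c" "d \<le> 1" "a \<le> x" "x \<le> b" for a b c d x
  proof -
    have "{a..b} \<times> {c..d} = {a..x} \<times> {c..d} \<union> {x..b} \<times> {c..d}" using that by auto
    moreover have "{a..x} \<times> {c..d} \<inter> {x..b} \<times> {c..d} = {x} \<times> {c..d}" using that by auto
    moreover have "continuous_on ({a..b} \<times> {c..d}) h" using that by (intro continuous_on_subset[OF h]) auto
    moreover have "connected ({x} \<times> {c..d})" by (intro connected_Times) auto
    ultimately show ?thesis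
      using that(1,2) lift_along_glue[of h "{a..x} \<times> {c..d}" _ "{x..b} \<times> {c..d}"]
      unfolding ok_def by (metis closed_Times closed_atLeastAtMost)
  qed
  have local: "\<exists>\<delta>>0. \<forall>a b c d. a \<le> x \<and> x \<le> b \<and> b - a < \<delta> \<and> c \<le> y \<and> y \<le> d \<and> d - c < \<delta> \<and> 0 \<le> a \<and> b \<le> 1 \<and> 0 \<le> c \<and> d \<le> 1 \<longrightarrow> ok a b c d"
    if xy: "x \<in> {0..1}" "y \<in> {0..1}" for x y
  proof -
    obtain W f where W: "open W" "h (x, y) \<in> W" "P W f" using ex_primitive by blast
    obtain N where N: "open N" "N \<inter> ({0..1} \<times> {0..1}) = h -` W \<inter> ({0..1} \<times> {0..1})"
      using h W(1) unfolding continuous_on_open_invariant by blast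
    then have "(x, y) \<in> N" using xy W by auto
    then obtain A B where AB: "open A" "open B" "x \<in> A" "y \<in> B" "A \<times> B \<subseteq> N"
      using N(1) by (metis open_prod_elim mem_Sigma_iff)
    obtain r1 where r1: "r1 > 0" "ball x r1 \<subseteq> A" using AB open_contains_ball by blast
    obtain r2 where r2: "r2 > 0" "ball y r2 \<subseteq> B" using AB open_contains_ball by blast
    have "ok a b c d" if *: "a \<le> x" "x \<le> b" "b - a < min r1 r2" "c \<le> y" "y \<le> d" "d - c < min r1 r2" "0 \<le> a" "b \<le> 1" "0 \<le> c" "d \<le> 1" for a b c d
    proof -
      have "{a..b} \<subseteq> ball x r1" "{c..d} \<subseteq> ball y r2" using * by (auto simp: dist_real_def)
      then have "{a..b} \<times> {c..d} \<subseteq> N" using AB(5) r1 r2 by blast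
      moreover have "{a..b} \<times> {c..d} \<subseteq> {0..1} \<times> {0..1}" using * by auto
      ultimately have "h ` ({a..b} \<times> {c..d}) \<subseteq> W" "continuous_on ({a..b} \<times> {c..d}) h"
        using N(2) continuous_on_subset[OF h] by auto
      then show ?thesis unfolding ok_def using lift_along_primitive[OF W(3)] by blast
    qed
    then show ?thesis using r1 r2 by (intro exI[of _ "min r1 r2"]) auto
  qed
  have strip: "\<exists>\<delta>>0. \<forall>a b. a \<le> x \<and> x \<le> b \<and> b - a < \<delta> \<and> 0 \<le> a \<and> b \<le> 1 \<longrightarrow> ok a b 0 1" if x: "x \<in> {0..1}" for x
  proof -
    \<comment> \<open>The admissible width \<delta> may depend on the interval [c, d]; gluing two
      intervals takes the smaller of their widths.\<close>
    define Q where "Q = (\<lambda>c d. 0 \<le> c \<and> d \<le> 1 \<longrightarrow> (\<exists>\<delta>>0. \<forall>a b. a \<le> x \<and> x \<le> b \<and> b - a < \<delta> \<and> 0 \<le> a \<and> b \<le> 1 \<longrightarrow> ok a b c d))"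
    have "Q 0 1"
    proof (rule Bolzano)
      fix c z d :: real assume Q: "Q c z" "Q z d" and o: "c \<le> z" "z \<le> d"
      show "Q c d"
        unfolding Q_def
      proof
        assume cd: "0 \<le> c \<and> d \<le> 1"
        obtain \<delta>1 where 1: "\<delta>1 > 0" "\<forall>a b. a \<le> x \<and> x \<le> b \<and> b - a < \<delta>1 \<and> 0 \<le> a \<and> b \<le> 1 \<longrightarrow> ok a b c z"
          using Q(1) cd o unfolding Q_def by auto
        obtain \<delta>2 where 2: "\<delta>2 > 0" "\<forall>a b. a \<le> x \<and> x \<le> b \<and> b - a < \<delta>2 \<and> 0 \<le> a \<and> b \<le> 1 \<longrightarrow> ok a b z d"
          using Q(2) cd o unfolding Q_def by auto
        show "\<exists>\<delta>>0. \<forall>a b. a \<le> x \<and> x \<le> b \<and> b - a < \<delta> \<and> 0 \<le> a \<and> b \<le> 1 \<longrightarrow> ok a b c d"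
        proof (intro exI[of _ "min \<delta>1 \<delta>2"] conjI allI impI)
          show "0 < min \<delta>1 \<delta>2" using 1 2 by simp
          fix a b assume ab: "a \<le> x \<and> x \<le> b \<and> b - a < min \<delta>1 \<delta>2 \<and> 0 \<le> a \<and> b \<le> 1"
          then have "ok a b c z" "ok a b z d" using 1(2) 2(2) by auto
          then show "ok a b c d" by (rule glue2) (use ab cd o in auto)
        qed
      qed
    next
      fix y :: real assume "0 \<le> y" "y \<le> 1"
      then have "y \<in> {0..1}" by simp
      from local[OF x this] obtain \<delta> where \<delta>: "\<delta> > 0" "\<And>a b c d. a \<le> x \<and> x \<le> b \<and> b - a < \<delta> \<and> c \<le> y \<and> y \<le> d \<and> d - c < \<delta> \<and> 0 \<le> a \<and> b \<le> 1 \<and> 0 \<le> c \<and> d \<le> 1 \<Longrightarrow> ok a b c d"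
        by blast
      show "\<exists>\<delta>>0. \<forall>c d. c \<le> y \<and> y \<le> d \<and> d - c < \<delta> \<longrightarrow> Q c d"
        unfolding Q_def using \<delta> by blast
    qed simp
    then show ?thesis by (simp add: Q_def)
  qed
  define R where "R = (\<lambda>a b. 0 \<le> a \<and> b \<le> 1 \<longrightarrow> ok a b 0 1)"
  have "R 0 1"
  proof (rule Bolzano)
    fix a z b :: real assume "R a z" "R z b" "a \<le> z" "z \<le> b"
    then show "R a b" unfolding R_def by (auto intro: glue1)
  next
    fix x :: real assume "0 \<le> x" "x \<le> 1"
    then have "x \<in> {0..1}" by simp
    from strip[OF this] show "\<exists>\<delta>>0. \<forall>a b. a \<le> x \<and> x \<le> b \<and> b - a < \<delta> \<longrightarrow> R a b"
      unfolding R_def by blast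
  qed simp
  then show ?thesis by (simp add: R_def ok_def)
qed

text \<open>A path is a square that is constant in its first coordinate.\<close>

lemma ex_lift_path:
  assumes "path \<gamma>"
  shows "\<exists>\<Phi>. lift_along \<gamma> {0..1} \<Phi>"
proof -
  have "continuous_on ({0..1} \<times> {0..1}) (\<lambda>z::real \<times> real. \<gamma> (snd z))"
    using assms unfolding path_def by (rule continuous_on_compose2) (auto intro: continuous_intros)
  then obtain \<Phi> where l: "lift_along (\<lambda>z::real \<times> real. \<gamma> (snd z)) ({0..1} \<times> {0..1}) \<Phi>"
    using ex_lift_square by blast
  have "lift_along \<gamma> {0..1} (\<lambda>t. \<Phi> (0, t))"
    by (rule lift_along_compose[OF l]) (auto intro!: continuous_intros)
  then show ?thesis by blast
qed

lemma lift_along_unique_diff: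
  assumes "lift_along \<gamma> {0..1::real} \<Phi>" "lift_along \<gamma> {0..1} \<Phi>'"
  shows "\<Phi> 1 - \<Phi> 0 = \<Phi>' 1 - \<Phi>' 0"
  using lift_along_unique[OF assms, of 0 1] by (simp add: algebra_simps)

lemma lift_along_const_diff:
  assumes l: "lift_along \<gamma> {0..1::real} \<Phi>" and c: "\<And>t. t \<in> {0..1} \<Longrightarrow> \<gamma> t = x"
  shows "\<Phi> 1 = \<Phi> 0"
proof -
  obtain W f where W: "open W" "x \<in> W" "P W f" using ex_primitive by blast
  have "lift_along \<gamma> {0..1} (\<lambda>t. f (\<gamma> t))"
    using l W c by (intro lift_along_primitive[OF W(3)]) (auto simp: lift_along_def)
  from lift_along_unique_diff[OF l this] show ?thesis using c by simp
qed

text \<open>The homotopy is lifted over the square. Every stage is a loop, so the edges traced by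
  its start and its end are the same path, and the lift has equal increments along them; therefore
  the increments along \<open>p\<close> and \<open>q\<close> agree.\<close>

lemma homotopic_loops_lift:
  assumes hom: "homotopic_loops UNIV p q" and l: "lift_along p {0..1} \<Phi>" "lift_along q {0..1} \<Psi>"
  shows "\<Phi> 1 - \<Phi> 0 = \<Psi> 1 - \<Psi> 0"
proof -
  obtain h where h: "continuous_on ({0..1::real} \<times> {0..1::real}) h" "\<forall>x\<in>{0..1}. h (0, x) = p x" "\<forall>x\<in>{0..1}. h (1, x) = q x"
    "\<forall>t\<in>{0..1}. pathfinish (h \<circ> Pair t) = pathstart (h \<circ> Pair t)"
    using hom unfolding homotopic_loops by blast
  obtain H where H: "lift_along h ({0..1} \<times> {0..1}) H" using ex_lift_square[OF h(1)] by blast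
  have "lift_along p {0..1} (\<lambda>t. H (0, t))" "lift_along q {0..1} (\<lambda>t. H (1, t))"
    using h by (auto intro!: lift_along_compose[OF H] continuous_intros)
  then have 1: "\<Phi> 1 - \<Phi> 0 = H (0, 1) - H (0, 0)" "\<Psi> 1 - \<Psi> 0 = H (1, 1) - H (1, 0)"
    using lift_along_unique_diff[OF l(1)] lift_along_unique_diff[OF l(2)] by auto
  have 2: "lift_along (\<lambda>s. h (s, 0)) {0..1} (\<lambda>s. H (s, 0))"
    by (rule lift_along_compose[OF H]) (auto intro!: continuous_intros)
  have 3: "lift_along (\<lambda>s. h (s, 0)) {0..1} (\<lambda>s. H (s, 1))"
    using h(4) by (intro lift_along_compose[OF H]) (auto intro!: continuous_intros simp: pathfinish_def pathstart_def)
  show ?thesis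
    unfolding 1 using lift_along_unique_diff[OF 2 3] by (simp add: algebra_simps)
qed

lemma lift_along_joinpaths:
  assumes l: "lift_along (g1 +++ g2) {0..1} \<Phi>" and g: "pathfinish g1 = pathstart g2"
  shows "lift_along g1 {0..1} (\<lambda>t. \<Phi> (t / 2))" "lift_along g2 {0..1} (\<lambda>t. \<Phi> ((1 + t) / 2))"
proof -
  show "lift_along g1 {0..1} (\<lambda>t. \<Phi> (t / 2))"
    by (rule lift_along_compose[OF l]) (auto intro!: continuous_intros simp: joinpaths_def)
  show "lift_along g2 {0..1} (\<lambda>t. \<Phi> ((1 + t) / 2))"
  proof (rule lift_along_compose[OF l])
    \<comment> \<open>At t = 0 the parameter is 1/2, where the join still takes its value from
      \<open>g1\<close>; the assumption on the end points identifies it with the start of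
      \<open>g2\<close>.\<close>
    show "g2 t = (g1 +++ g2) ((1 + t) / 2)" if "t \<in> {0..1}" for t
      using that g by (cases "t = 0") (auto simp: joinpaths_def pathfinish_def pathstart_def add_divide_distrib)
  qed (auto intro!: continuous_intros)
qed

text \<open>The loop formed by \<gamma>1 and the reversed \<gamma>2 is homotopic to a constant loop,
  along which a lift has no increment; splitting the increment at parameter 1/2 gives the
  claim.\<close>

lemma lift_along_path_independent:
  assumes sc: "simply_connected (UNIV :: 'm set)"
    and \<gamma>: "path \<gamma>1" "path \<gamma>2" "pathstart \<gamma>1 = pathstart \<gamma>2" "pathfinish \<gamma>1 = pathfinish \<gamma>2"
    and l: "lift_along \<gamma>1 {0..1} \<Phi>1" "lift_along \<gamma>2 {0..1} \<Phi>2"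
  shows "\<Phi>1 1 - \<Phi>1 0 = \<Phi>2 1 - \<Phi>2 0"
proof -
  let ?p = "\<gamma>1 +++ reversepath \<gamma>2" and ?q = "\<lambda>t::real. pathstart \<gamma>1"
  have p: "path ?p" "pathfinish ?p = pathstart ?p" using \<gamma> by auto
  have q: "path ?q" "pathfinish ?q = pathstart ?q" by (auto simp: path_def pathfinish_def pathstart_def)
  obtain \<Phi> where \<Phi>: "lift_along ?p {0..1} \<Phi>" using ex_lift_path[OF p(1)] by blast
  obtain \<Psi> where \<Psi>: "lift_along ?q {0..1} \<Psi>" using ex_lift_path[OF q(1)] by blast
  have "homotopic_loops UNIV ?p ?q" using sc p q unfolding simply_connected_def by blast
  from homotopic_loops_lift[OF this \<Phi> \<Psi>] have 0: "\<Phi> 1 = \<Phi> 0"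
    using lift_along_const_diff[OF \<Psi>] by simp
  have j: "pathfinish \<gamma>1 = pathstart (reversepath \<gamma>2)" using \<gamma> by simp
  note 12 = lift_along_joinpaths[OF \<Phi> j]
  have "lift_along (reversepath \<gamma>2) {0..1} (\<lambda>t. \<Phi>2 (1 - t))"
    by (rule lift_along_compose[OF l(2)]) (auto intro!: continuous_intros simp: reversepath_def)
  from lift_along_unique_diff[OF 12(2) this] have "\<Phi>2 0 - \<Phi>2 1 = \<Phi> 1 - \<Phi> (1 / 2)" by simp
  moreover have "\<Phi>1 1 - \<Phi>1 0 = \<Phi> (1 / 2) - \<Phi> 0" using lift_along_unique_diff[OF 12(1) l(1)] by simp
  ultimately have "\<Phi>1 1 - \<Phi>1 0 = - (\<Phi>2 0 - \<Phi>2 1)" using 0 by simp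
  then show ?thesis by simp
qed

text \<open>Monodromy argument: \<open>F q\<close> is the increment of a lift along a chosen path
  from \<open>a\<close> to \<open>q\<close>. For \<open>q\<close> near \<open>p\<close>, path
  independence allows the chosen path to be replaced by one through \<open>p\<close> that continues
  inside \<open>N\<close>, where the increment is that of a single primitive.\<close>

theorem simply_connected_global_primitive:
  assumes sc: "simply_connected (UNIV :: 'm set)"
    and lpc: "\<And>(p::'m) W. open W \<Longrightarrow> p \<in> W \<Longrightarrow> \<exists>N. open N \<and> p \<in> N \<and> N \<subseteq> W \<and> path_connected N"
  shows "\<exists>F. \<forall>p. \<exists>N W f c. open N \<and> p \<in> N \<and> N \<subseteq> W \<and> P W f \<and> (\<forall>q\<in>N. F q = f q + c)"
proof -
  fix a :: 'm
  \<comment> \<open>\<open>simply_connected\<close> speaks of loops only; a homotopy between the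
    constant loops at \<open>a\<close> and \<open>q\<close> moves its starting point along a path
    from one to the other.\<close>
  have ex_path: "\<exists>\<gamma>. path \<gamma> \<and> pathstart \<gamma> = a \<and> pathfinish \<gamma> = q" for q
  proof -
    have "homotopic_loops UNIV (\<lambda>_::real. a) (\<lambda>_. q)"
      using sc unfolding simply_connected_def by (simp add: path_def pathfinish_def pathstart_def)
    then obtain h where h: "continuous_on ({0..1::real} \<times> {0..1::real}) h" "\<forall>x\<in>{0..1}. h (0, x) = a" "\<forall>x\<in>{0..1}. h (1, x) = q"
      unfolding homotopic_loops by blast
    have "path (\<lambda>t. h (t, 0))"
      unfolding path_def by (rule continuous_on_compose2[OF h(1)]) (auto intro!: continuous_intros)
    with h show ?thesis by (intro exI[of _ "\<lambda>t. h (t, 0)"]) (auto simp: pathfinish_def pathstart_def)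
  qed
  then obtain \<Gamma> where \<Gamma>: "\<And>q. path (\<Gamma> q)" "\<And>q. pathstart (\<Gamma> q) = a" "\<And>q. pathfinish (\<Gamma> q) = q" by metis
  obtain \<Lambda> where \<Lambda>: "\<And>q. lift_along (\<Gamma> q) {0..1} (\<Lambda> q)" using ex_lift_path[OF \<Gamma>(1)] by metis
  define F where "F = (\<lambda>q. \<Lambda> q 1 - \<Lambda> q 0)"
  have "\<exists>N W f c. open N \<and> p \<in> N \<and> N \<subseteq> W \<and> P W f \<and> (\<forall>q\<in>N. F q = f q + c)" for p
  proof -
    obtain W f where W: "open W" "p \<in> W" "P W f" using ex_primitive by blast
    obtain N where N: "open N" "p \<in> N" "N \<subseteq> W" "path_connected N" using lpc[OF W(1,2)] by blast
    have "F q = f q + (F p - f p)" if q: "q \<in> N" for q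
    proof -
      obtain \<delta> where \<delta>: "path \<delta>" "path_image \<delta> \<subseteq> N" "pathstart \<delta> = p" "pathfinish \<delta> = q"
        using N q unfolding path_connected_def by blast
      let ?\<gamma> = "\<Gamma> p +++ \<delta>"
      have \<gamma>: "path ?\<gamma>" "pathstart ?\<gamma> = a" "pathfinish ?\<gamma> = q" using \<Gamma> \<delta> by auto
      obtain \<Phi> where \<Phi>: "lift_along ?\<gamma> {0..1} \<Phi>" using ex_lift_path[OF \<gamma>(1)] by blast
      have j: "pathfinish (\<Gamma> p) = pathstart \<delta>" using \<Gamma> \<delta> by simp
      note 12 = lift_along_joinpaths[OF \<Phi> j]
      have \<delta>l: "lift_along \<delta> {0..1} (\<lambda>t. f (\<delta> t))"
        using \<delta> N by (intro lift_along_primitive[OF W(3)]) (auto simp: path_def path_image_def)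
      have "F q = \<Phi> 1 - \<Phi> 0"
        unfolding F_def by (rule lift_along_path_independent[OF sc \<Gamma>(1) \<gamma>(1) _ _ \<Lambda> \<Phi>]) (use \<Gamma> \<gamma> in auto)
      moreover have "F p = \<Phi> (1/2) - \<Phi> 0"
        unfolding F_def using lift_along_unique_diff[OF \<Lambda>[of p] 12(1)] by simp
      moreover have "f q - f p = \<Phi> 1 - \<Phi> (1/2)"
        using lift_along_unique_diff[OF \<delta>l 12(2)] \<delta> by (simp add: pathfinish_def pathstart_def)
      ultimately have "F q - F p = f q - f p" by simp
      then show ?thesis by (simp add: algebra_simps)
    qed
    then show ?thesis using N W by blast
  qed
  then show ?thesis by blast
qed

end

section \<open>The Cartan decomposition\<close>

lemma component_eqI:
  assumes "subspace S" "subspace T" "S \<inter> T = {0}" "Y \<in> S" "X - Y \<in> T"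
  shows "component S T X = Y"
  unfolding component_def
proof (rule the_equality)
  show "Y \<in> S \<and> X - Y \<in> T" using assms by simp
  fix Z assume Z: "Z \<in> S \<and> X - Z \<in> T"
  have "Y - Z \<in> S" using Z assms subspace_diff by blast
  moreover have "(X - Z) - (X - Y) \<in> T" using Z assms subspace_diff by blast
  then have "Y - Z \<in> T" by simp
  ultimately have "Y - Z \<in> S \<inter> T" by (rule IntI)
  then show "Z = Y" by (simp add: assms(3))
qed

locale involution = lie G
  for G :: "('g::{t2_space,second_countable_topology}, 'e::euclidean_space, 'l::euclidean_space) lie_grp" +
  fixes \<sigma> :: "'g \<Rightarrow> 'g"
  assumes \<sigma>_smooth: "smooth_map \<A> UNIV \<A> \<sigma>"
    and \<sigma>_mul: "\<sigma> (mul x y) = mul (\<sigma> x) (\<sigma> y)"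
    and \<sigma>_\<sigma>: "\<sigma> \<circ> \<sigma> = id"
begin

abbreviation "d\<sigma> \<equiv> lie_deriv G \<sigma>"

lemma \<sigma>_one: "\<sigma> e = e"
  using \<sigma>_mul[of e e] inv_mul_cancel[of "\<sigma> e" "\<sigma> e"] by (simp add: group_laws)

lemma vec_d\<sigma>: "lvec (d\<sigma> X) = pushforward \<A> \<sigma> e (lvec X)"
  unfolding lie_deriv_def
  by (rule vec_inv)
    (use pushforward_in_tangent_space[OF atlas atlas \<sigma>_smooth open_UNIV UNIV_I vec_tangent] \<sigma>_one in simp)

lemma vec_d\<sigma>_apply: "smooth_at \<A> e h \<Longrightarrow> lvec (d\<sigma> X) h = lvec X (h \<circ> \<sigma>)"
  by (simp add: vec_d\<sigma> pushforward_def \<sigma>_one)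

lemma smooth_at_\<sigma>: "smooth_at \<A> (\<sigma> x) h \<Longrightarrow> smooth_at \<A> x (h \<circ> \<sigma>)"
  by (rule smooth_at_compose[OF atlas atlas \<sigma>_smooth open_UNIV UNIV_I])

lemma linear_d\<sigma>: "linear d\<sigma>"
  by (rule linearI; rule vec_eqI) (simp_all add: vec_d\<sigma>_apply vec_linear)

lemma d\<sigma>_d\<sigma>: "d\<sigma> (d\<sigma> X) = X"
proof (rule vec_eqI)
  fix h assume h: "smooth_at \<A> e h"
  have "smooth_at \<A> e (h \<circ> \<sigma>)" using smooth_at_\<sigma>[of e h] h by (simp add: \<sigma>_one)
  then show "lvec (d\<sigma> (d\<sigma> X)) h = lvec X h"
    using h by (simp add: vec_d\<sigma>_apply o_assoc[symmetric] \<sigma>_\<sigma>)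
qed

text \<open>A homomorphism intertwines left translations,
  \<open>\<sigma> \<circ> mul x = mul (\<sigma> x) \<circ> \<sigma>\<close>, so it relates invariant
  fields to invariant fields and their commutators to each other.\<close>

lemma d\<sigma>_bracket: "d\<sigma> (br X Y) = br (d\<sigma> X) (d\<sigma> Y)"
proof (rule vec_eqI)
  fix h assume h: "smooth_at \<A> e h"
  obtain W where W: "open W" "e \<in> W" "smooth_map \<A> W std_atlas h" using h by (auto simp: smooth_at_def)
  have o: "open (UNIV \<inter> \<sigma> -` W)"
    by (rule open_preimage_continuous_on[OF smooth_map_continuous_on[OF \<sigma>_smooth] open_UNIV W(1)])
  have h\<sigma>: "smooth_at \<A> e (h \<circ> \<sigma>)" using smooth_at_\<sigma>[of e h] h by (simp add: \<sigma>_one)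
  have *: "lvec (d\<sigma> X) (\<lambda>x. left_field G (d\<sigma> Y) x h) = lvec X (\<lambda>x. left_field G Y x (h \<circ> \<sigma>))" for X Y
  proof -
    have "lvec (d\<sigma> X) (\<lambda>x. left_field G (d\<sigma> Y) x h) = lvec X ((\<lambda>x. left_field G (d\<sigma> Y) x h) \<circ> \<sigma>)"
      by (rule vec_d\<sigma>_apply[OF smooth_at_left_field[OF h]])
    also have "\<dots> = lvec X (\<lambda>x. left_field G Y x (h \<circ> \<sigma>))"
    proof (rule tangent_vector_local[OF atlas vec_tangent o])
      show "e \<in> UNIV \<inter> \<sigma> -` W" using W(2) by (simp add: \<sigma>_one)
      fix x assume "x \<in> UNIV \<inter> \<sigma> -` W"
      then have hx: "smooth_at \<A> (\<sigma> x) h" using smooth_atI[OF W(3,1)] by simp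
      then have "smooth_at \<A> (mul (\<sigma> x) e) h" by (simp add: group_laws)
      then have hm: "smooth_at \<A> e (h \<circ> mul (\<sigma> x))"
        by (rule smooth_at_compose[OF atlas atlas smooth_left_mul open_UNIV UNIV_I])
      have "(h \<circ> mul (\<sigma> x)) \<circ> \<sigma> = (h \<circ> \<sigma>) \<circ> mul x" by (simp add: fun_eq_iff \<sigma>_mul)
      then show "((\<lambda>x. left_field G (d\<sigma> Y) x h) \<circ> \<sigma>) x = left_field G Y x (h \<circ> \<sigma>)"
        using hx smooth_at_\<sigma>[OF hx] vec_d\<sigma>_apply[OF hm, of Y] by (simp add: left_field_apply)
    qed
    finally show ?thesis .
  qed
  show "lvec (d\<sigma> (br X Y)) h = lvec (br (d\<sigma> X) (d\<sigma> Y)) h"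
    by (simp add: vec_d\<sigma>_apply[OF h] vec_bracket[OF h] vec_bracket[OF h\<sigma>] *)
qed

end

locale cartan_tableau_setting = involution G \<sigma>
  for G :: "('g::{t2_space,second_countable_topology}, 'e::euclidean_space, 'l::euclidean_space) lie_grp" and \<sigma> +
  fixes \<gg>\<^sub>0 \<gg>\<^sub>1 \<aa> \<mm> \<bb> \<nn> :: "'l set" and A :: "'k::finite \<Rightarrow> 'l"
  assumes g0_eq: "\<gg>\<^sub>0 = {X. lie_deriv G \<sigma> X = X}" and g1_eq: "\<gg>\<^sub>1 = {X. lie_deriv G \<sigma> X = - X}"
    and abelian: "abelian_subspace G \<aa>" and a_sub: "\<aa> \<subseteq> \<gg>\<^sub>1"
    and m_eq: "\<mm> = \<gg>\<^sub>1 \<inter> killing_perp G \<aa>" and g1_sum: "direct_sum \<gg>\<^sub>1 \<aa> \<mm>"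
    and b_eq: "\<bb> = \<gg>\<^sub>0 \<inter> killing_perp G (centralizer_in G \<gg>\<^sub>0 \<aa>)" and g0_sum: "direct_sum \<gg>\<^sub>0 \<bb> \<nn>"
    and inj_A: "inj A" and indep_A: "independent (range A)" and span_A: "span (range A) = \<aa>"
begin

lemma subspaces: "subspace \<gg>\<^sub>0" "subspace \<gg>\<^sub>1" "subspace \<aa>" "subspace \<mm>" "subspace \<bb>" "subspace \<nn>"
proof -
  show "subspace \<gg>\<^sub>0" "subspace \<gg>\<^sub>1"
    unfolding g0_eq g1_eq
    by (rule subspaceI; simp add: linear_0[OF linear_d\<sigma>] linear_add[OF linear_d\<sigma>] linear_scale[OF linear_d\<sigma>])+
  show "subspace \<aa>" "subspace \<mm>" "subspace \<bb>" "subspace \<nn>"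
    using g1_sum g0_sum by (simp_all add: direct_sum_def)
qed

lemma sub_g: "\<mm> \<subseteq> \<gg>\<^sub>1" "\<bb> \<subseteq> \<gg>\<^sub>0" "\<nn> \<subseteq> \<gg>\<^sub>0"
proof -
  show "\<mm> \<subseteq> \<gg>\<^sub>1" "\<bb> \<subseteq> \<gg>\<^sub>0" using m_eq b_eq by auto
  show "\<nn> \<subseteq> \<gg>\<^sub>0"
  proof
    fix x assume "x \<in> \<nn>"
    then have "0 + x \<in> {x + y |x y. x \<in> \<bb> \<and> y \<in> \<nn>}" using subspace_0[OF subspaces(5)] by blast
    then show "x \<in> \<gg>\<^sub>0" using g0_sum by (simp add: direct_sum_def)
  qed
qed

text \<open>\<open>d\<sigma>\<close> respects the bracket, so its eigenvalues 1 and -1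
  multiply.\<close>

lemma bracket_g: "X \<in> \<gg>\<^sub>0 \<Longrightarrow> Y \<in> \<gg>\<^sub>0 \<Longrightarrow> br X Y \<in> \<gg>\<^sub>0" "X \<in> \<gg>\<^sub>1 \<Longrightarrow> Y \<in> \<gg>\<^sub>0 \<Longrightarrow> br X Y \<in> \<gg>\<^sub>1"
  "X \<in> \<gg>\<^sub>1 \<Longrightarrow> Y \<in> \<gg>\<^sub>1 \<Longrightarrow> br X Y \<in> \<gg>\<^sub>0"
  unfolding g0_eq g1_eq
  by (simp_all add: d\<sigma>_bracket linear_neg[OF linear_bracket_right] linear_neg[OF linear_bracket_left])

lemma g0_int_g1: "X \<in> \<gg>\<^sub>0 \<Longrightarrow> X \<in> \<gg>\<^sub>1 \<Longrightarrow> X = 0"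
proof -
  assume "X \<in> \<gg>\<^sub>0" "X \<in> \<gg>\<^sub>1"
  then have "X = - X" unfolding g0_eq g1_eq by simp
  then have "X + X = 0" using eq_neg_iff_add_eq_0 by blast
  then have "2 *\<^sub>R X = 0" by (simp only: scaleR_2)
  then show "X = 0" by simp
qed

lemma decompose:
  obtains x y z w where "x \<in> \<aa>" "y \<in> \<mm>" "z \<in> \<bb>" "w \<in> \<nn>" "X = x + y + z + w"
proof -
  \<comment> \<open>Projections onto the two eigenspaces of the involution
    \<open>d\<sigma>\<close>.\<close>
  have "(1/2) *\<^sub>R (X - d\<sigma> X) \<in> \<gg>\<^sub>1" "(1/2) *\<^sub>R (X + d\<sigma> X) \<in> \<gg>\<^sub>0"
    unfolding g0_eq g1_eq
    by (simp_all add: linear_scale[OF linear_d\<sigma>] linear_diff[OF linear_d\<sigma>] linear_add[OF linear_d\<sigma>] d\<sigma>_d\<sigma> algebra_simps)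
  moreover have "X = (1/2) *\<^sub>R (X - d\<sigma> X) + (1/2) *\<^sub>R (X + d\<sigma> X)"
    by (simp add: algebra_simps flip: scaleR_add_left)
  ultimately obtain P Q where PQ: "P \<in> \<gg>\<^sub>1" "Q \<in> \<gg>\<^sub>0" "X = P + Q" by blast
  then obtain x y z w where "x \<in> \<aa>" "y \<in> \<mm>" "P = x + y" "z \<in> \<bb>" "w \<in> \<nn>" "Q = z + w"
    using g1_sum g0_sum unfolding direct_sum_def by blast
  then show thesis using that[of x y z w] PQ(3) by (simp add: add.assoc)
qed

text \<open>A relation separates into its parts in the eigenspaces \<open>\<gg>\<^sub>1\<close> and
  \<open>\<gg>\<^sub>0\<close>, and each of these is a direct sum of two of the four
  summands.\<close>

lemma decompose_0:
  assumes "x \<in> \<aa>" "y \<in> \<mm>" "z \<in> \<bb>" "w \<in> \<nn>" and 0: "x + y + z + w = 0"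
  shows "x = 0" "y = 0" "z = 0" "w = 0"
proof -
  have "x + y \<in> \<gg>\<^sub>1" "z + w \<in> \<gg>\<^sub>0" using assms a_sub sub_g subspaces by (auto intro: subspace_add)
  moreover have "(x + y) + (z + w) = 0" using 0 by (simp add: add.assoc)
  then have "x + y = - (z + w)" by (rule eq_neg_iff_add_eq_0[THEN iffD2])
  then have "x + y \<in> \<gg>\<^sub>0" using \<open>z + w \<in> \<gg>\<^sub>0\<close> subspace_neg[OF subspaces(1)] by metis
  ultimately have xy: "x + y = 0" using g0_int_g1 by blast
  with 0 have zw: "z + w = 0" by (simp add: add.assoc)
  have "x = - y" "z = - w" using xy zw by (auto intro: eq_neg_iff_add_eq_0[THEN iffD2])
  then have "x \<in> \<aa> \<inter> \<mm>" "z \<in> \<bb> \<inter> \<nn>" using assms subspace_neg subspaces by auto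
  then show "x = 0" "z = 0" using g1_sum g0_sum by (auto simp: direct_sum_def)
  then show "y = 0" "w = 0" using xy zw by auto
qed

lemma span_Un3:
  assumes "subspace S" "subspace T" "subspace U"
  shows "span (S \<union> T \<union> U) = {x + y + z |x y z. x \<in> S \<and> y \<in> T \<and> z \<in> U}"
  unfolding span_Un using assms by (auto simp: span_eq_iff[THEN iffD2])

abbreviation "\<pi>\<^sub>\<aa> \<equiv> component \<aa> (span (\<mm> \<union> \<bb> \<union> \<nn>))"
abbreviation "\<pi>\<^sub>\<mm> \<equiv> component \<mm> (span (\<aa> \<union> \<bb> \<union> \<nn>))"
abbreviation "\<pi>\<^sub>\<bb> \<equiv> component \<bb> (span (\<aa> \<union> \<mm> \<union> \<nn>))"
abbreviation "\<pi>\<^sub>\<nn> \<equiv> component \<nn> (span (\<aa> \<union> \<mm> \<union> \<bb>))"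

text \<open>\<open>component\<close> is a definite description, so its value is fixed once the
  complement is known to meet the summand in 0 only; \<open>decompose_0\<close> yields this for each
  of the four summands.\<close>

lemma components:
  assumes "x \<in> \<aa>" "y \<in> \<mm>" "z \<in> \<bb>" "w \<in> \<nn>"
  shows "\<pi>\<^sub>\<aa> (x + y + z + w) = x" "\<pi>\<^sub>\<mm> (x + y + z + w) = y" "\<pi>\<^sub>\<bb> (x + y + z + w) = z" "\<pi>\<^sub>\<nn> (x + y + z + w) = w"
proof -
  note neg = subspace_neg[OF subspaces(3)] subspace_neg[OF subspaces(4)] subspace_neg[OF subspaces(5)] subspace_neg[OF subspaces(6)]
  note zero = subspace_0[OF subspaces(3)] subspace_0[OF subspaces(4)] subspace_0[OF subspaces(5)] subspace_0[OF subspaces(6)]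
  note d0 = decompose_0
  show "\<pi>\<^sub>\<aa> (x + y + z + w) = x"
  proof (rule component_eqI)
    show "\<aa> \<inter> span (\<mm> \<union> \<bb> \<union> \<nn>) = {0}"
    proof (intro equalityI subsetI)
      fix v assume "v \<in> \<aa> \<inter> span (\<mm> \<union> \<bb> \<union> \<nn>)"
      then obtain p q r where v: "v \<in> \<aa>" "p \<in> \<mm>" "q \<in> \<bb>" "r \<in> \<nn>" "v = p + q + r"
        unfolding span_Un3[OF subspaces(4,5,6)] by blast
      have "- v + p + q + r = 0" by (simp add: v(5) algebra_simps)
      then show "v \<in> {0}" using d0(1)[OF neg(1)[OF v(1)] v(2,3,4)] by simp
    qed (use zero span_zero in auto)
    have "x + y + z + w - x = y + z + w" by (simp add: algebra_simps)
    then show "x + y + z + w - x \<in> span (\<mm> \<union> \<bb> \<union> \<nn>)"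
      unfolding span_Un3[OF subspaces(4,5,6)] using assms by blast
  qed (use assms subspaces in auto)
  show "\<pi>\<^sub>\<mm> (x + y + z + w) = y"
  proof (rule component_eqI)
    show "\<mm> \<inter> span (\<aa> \<union> \<bb> \<union> \<nn>) = {0}"
    proof (intro equalityI subsetI)
      fix v assume "v \<in> \<mm> \<inter> span (\<aa> \<union> \<bb> \<union> \<nn>)"
      then obtain p q r where v: "v \<in> \<mm>" "p \<in> \<aa>" "q \<in> \<bb>" "r \<in> \<nn>" "v = p + q + r"
        unfolding span_Un3[OF subspaces(3,5,6)] by blast
      have "p + - v + q + r = 0" by (simp add: v(5) algebra_simps)
      then show "v \<in> {0}" using d0(2)[OF v(2) neg(2)[OF v(1)] v(3,4)] by simp
    qed (use zero span_zero in auto)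
    have "x + y + z + w - y = x + z + w" by (simp add: algebra_simps)
    then show "x + y + z + w - y \<in> span (\<aa> \<union> \<bb> \<union> \<nn>)"
      unfolding span_Un3[OF subspaces(3,5,6)] using assms by blast
  qed (use assms subspaces in auto)
  show "\<pi>\<^sub>\<bb> (x + y + z + w) = z"
  proof (rule component_eqI)
    show "\<bb> \<inter> span (\<aa> \<union> \<mm> \<union> \<nn>) = {0}"
    proof (intro equalityI subsetI)
      fix v assume "v \<in> \<bb> \<inter> span (\<aa> \<union> \<mm> \<union> \<nn>)"
      then obtain p q r where v: "v \<in> \<bb>" "p \<in> \<aa>" "q \<in> \<mm>" "r \<in> \<nn>" "v = p + q + r"
        unfolding span_Un3[OF subspaces(3,4,6)] by blast
      have "p + q + - v + r = 0" by (simp add: v(5) algebra_simps)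
      then show "v \<in> {0}" using d0(3)[OF v(2,3) neg(3)[OF v(1)] v(4)] by simp
    qed (use zero span_zero in auto)
    have "x + y + z + w - z = x + y + w" by (simp add: algebra_simps)
    then show "x + y + z + w - z \<in> span (\<aa> \<union> \<mm> \<union> \<nn>)"
      unfolding span_Un3[OF subspaces(3,4,6)] using assms by blast
  qed (use assms subspaces in auto)
  show "\<pi>\<^sub>\<nn> (x + y + z + w) = w"
  proof (rule component_eqI)
    show "\<nn> \<inter> span (\<aa> \<union> \<mm> \<union> \<bb>) = {0}"
    proof (intro equalityI subsetI)
      fix v assume "v \<in> \<nn> \<inter> span (\<aa> \<union> \<mm> \<union> \<bb>)"
      then obtain p q r where v: "v \<in> \<nn>" "p \<in> \<aa>" "q \<in> \<mm>" "r \<in> \<bb>" "v = p + q + r"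
        unfolding span_Un3[OF subspaces(3,4,5)] by blast
      have "p + q + r + - v = 0" by (simp add: v(5) algebra_simps)
      then show "v \<in> {0}" using d0(4)[OF v(2,3,4) neg(4)[OF v(1)]] by simp
    qed (use zero span_zero in auto)
    have "x + y + z + w - w = x + y + z" by (simp add: algebra_simps)
    then show "x + y + z + w - w \<in> span (\<aa> \<union> \<mm> \<union> \<bb>)"
      unfolding span_Un3[OF subspaces(3,4,5)] using assms by blast
  qed (use assms subspaces in auto)
qed

lemma linear_\<pi>\<^sub>\<aa>: "linear \<pi>\<^sub>\<aa>"
proof (rule linearI)
  fix X Y r
  obtain x y z w where 1: "x \<in> \<aa>" "y \<in> \<mm>" "z \<in> \<bb>" "w \<in> \<nn>" "X = x + y + z + w" by (rule decompose)
  obtain x' y' z' w' where 2: "x' \<in> \<aa>" "y' \<in> \<mm>" "z' \<in> \<bb>" "w' \<in> \<nn>" "Y = x' + y' + z' + w'" by (rule decompose)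
  have "X + Y = (x + x') + (y + y') + (z + z') + (w + w')" using 1 2 by (simp add: algebra_simps)
  then show "\<pi>\<^sub>\<aa> (X + Y) = \<pi>\<^sub>\<aa> X + \<pi>\<^sub>\<aa> Y"
    using components(1) 1 2 subspaces subspace_add by metis
  have "r *\<^sub>R X = r *\<^sub>R x + r *\<^sub>R y + r *\<^sub>R z + r *\<^sub>R w" using 1 by (simp add: algebra_simps)
  then show "\<pi>\<^sub>\<aa> (r *\<^sub>R X) = r *\<^sub>R \<pi>\<^sub>\<aa> X"
    using components(1) 1 subspaces subspace_scale by metis
qed

lemma \<pi>\<^sub>\<aa>_in: "\<pi>\<^sub>\<aa> X \<in> \<aa>"
proof -
  obtain x y z w where 1: "x \<in> \<aa>" "y \<in> \<mm>" "z \<in> \<bb>" "w \<in> \<nn>" "X = x + y + z + w" by (rule decompose)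
  then show ?thesis using components(1) by simp
qed

lemma \<pi>\<^sub>\<aa>_m: "Y \<in> \<mm> \<Longrightarrow> \<pi>\<^sub>\<aa> Y = 0"
  using components(1)[OF subspace_0[OF subspaces(3)] _ subspace_0[OF subspaces(5)] subspace_0[OF subspaces(6)], of Y] by simp

lemma \<pi>\<^sub>\<aa>_g0: "X \<in> \<gg>\<^sub>0 \<Longrightarrow> \<pi>\<^sub>\<aa> X = 0"
proof -
  assume "X \<in> \<gg>\<^sub>0"
  then obtain z w where "z \<in> \<bb>" "w \<in> \<nn>" "X = z + w" using g0_sum unfolding direct_sum_def by blast
  then show ?thesis using components(1)[OF subspace_0[OF subspaces(3)] subspace_0[OF subspaces(4)]] by simp
qed

text \<open>With K the Killing form, K([B,X],B') = -K(X,[B,B']), which vanishes because \<aa> is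
  abelian.\<close>

lemma bracket_a_g0_in_m:
  assumes "B \<in> \<aa>" "X \<in> \<gg>\<^sub>0"
  shows "br B X \<in> \<mm>"
proof -
  have "killing G (br B X) B' = 0" if "B' \<in> \<aa>" for B'
  proof -
    have "killing G (br B X) B' = - killing G (br X B) B'"
      using bracket_antisym[of B X] linear_neg[OF linear_killing(1)] by metis
    also have "\<dots> = - killing G X (br B B')" by (simp add: killing_invariant)
    also have "\<dots> = 0" using that assms(1) abelian linear_0[OF linear_killing(2)] by (simp add: abelian_subspace_def)
    finally show ?thesis .
  qed
  moreover have "br B X \<in> \<gg>\<^sub>1" using bracket_g(2) assms a_sub by blast
  ultimately show ?thesis unfolding m_eq killing_perp_def by blast
qed

text \<open>With K the Killing form, K([B,Y],X) = -K(Y,[B,X]), and [B,X] = 0 for \<open>X\<close> in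
  the centralizer. The choice of \<bb> as the orthogonal complement of the centralizer is made for
  this.\<close>

lemma bracket_a_m_in_b:
  assumes "B \<in> \<aa>" "Y \<in> \<mm>"
  shows "br B Y \<in> \<bb>"
proof -
  have "killing G (br B Y) X = 0" if "X \<in> centralizer_in G \<gg>\<^sub>0 \<aa>" for X
  proof -
    have "br B X = 0" using that assms(1) bracket_antisym[of B X] by (simp add: centralizer_in_def)
    moreover have "killing G (br B Y) X = - killing G (br Y B) X"
      using bracket_antisym[of B Y] linear_neg[OF linear_killing(1)] by metis
    ultimately show ?thesis using linear_0[OF linear_killing(2)] by (simp add: killing_invariant)
  qed
  moreover have "br B Y \<in> \<gg>\<^sub>0" using bracket_g(3) assms a_sub sub_g by blast
  ultimately show ?thesis unfolding b_eq killing_perp_def by blast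
qed

text \<open>The Pfaffian equations assembled into a single one. In the converse, [x,Y] lies in \<bb>
  for x in \<aa>, so it contributes to no other component and the equation splits. The sign of the
  tableau is absorbed by -[Y,x] = [x,Y].\<close>

lemma pfaffian_value_iff:
  assumes Y: "Y \<in> \<mm>"
  shows "\<pi>\<^sub>\<bb> X - cartan_tableau G Y (\<pi>\<^sub>\<aa> X) = 0 \<and> \<pi>\<^sub>\<mm> X = 0 \<and> \<pi>\<^sub>\<nn> X = 0 \<longleftrightarrow> X = \<pi>\<^sub>\<aa> X + br (\<pi>\<^sub>\<aa> X) Y"
proof -
  have ct: "cartan_tableau G Y B = br B Y" for B
    using bracket_antisym[of B Y] by (simp add: cartan_tableau_def)
  obtain x y z w where 1: "x \<in> \<aa>" "y \<in> \<mm>" "z \<in> \<bb>" "w \<in> \<nn>" "X = x + y + z + w" by (rule decompose)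
  note c = components[OF 1(1-4), folded 1(5)]
  have "X = x + br x Y \<Longrightarrow> z = br x Y \<and> y = 0 \<and> w = 0"
    using components[OF 1(1) subspace_0[OF subspaces(4)] bracket_a_m_in_b[OF 1(1) Y] subspace_0[OF subspaces(6)]] c by simp
  then show ?thesis unfolding ct c using 1(5) by auto
qed

lemma \<pi>\<^sub>\<aa>_tableau:
  assumes "B \<in> \<aa>" "Y \<in> \<mm>"
  shows "\<pi>\<^sub>\<aa> (B + br B Y) = B"
  using components(1)[OF assms(1) subspace_0[OF subspaces(4)] bracket_a_m_in_b[OF assms] subspace_0[OF subspaces(6)]] by simp

text \<open>The quadratic term of the structure equation has four parts: [B,C] = 0, the two mixed
  brackets lie in \<mm>, and the last one lies in \<open>\<gg>\<^sub>0\<close>; none has a component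
  in \<aa>.\<close>

lemma \<pi>\<^sub>\<aa>_bracket_tableau:
  assumes B: "B \<in> \<aa>" "C \<in> \<aa>" and Y: "Y \<in> \<mm>"
  shows "\<pi>\<^sub>\<aa> (br (B + br B Y) (C + br C Y)) = 0"
proof -
  have g0: "br B Y \<in> \<gg>\<^sub>0" "br C Y \<in> \<gg>\<^sub>0" using bracket_a_m_in_b B Y sub_g by blast+
  have "br B C = 0" using abelian B by (simp add: abelian_subspace_def)
  moreover have "\<pi>\<^sub>\<aa> (br B (br C Y)) = 0" by (rule \<pi>\<^sub>\<aa>_m[OF bracket_a_g0_in_m[OF B(1) g0(2)]])
  moreover have "\<pi>\<^sub>\<aa> (br (br B Y) C) = 0"
    unfolding bracket_antisym[of "br B Y" C]
    by (rule \<pi>\<^sub>\<aa>_m[OF subspace_neg[OF subspaces(4) bracket_a_g0_in_m[OF B(2) g0(1)]]])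
  moreover have "\<pi>\<^sub>\<aa> (br (br B Y) (br C Y)) = 0" by (rule \<pi>\<^sub>\<aa>_g0[OF bracket_g(1)[OF g0]])
  ultimately show ?thesis
    by (simp add: linear_add[OF linear_bracket_left] linear_add[OF linear_bracket_right] linear_add[OF linear_\<pi>\<^sub>\<aa>])
qed

text \<open>Inverse of \<open>coords A\<close> on \<aa>. Being linear and injective, it gives access
  to the definite description in \<open>coords\<close>: equations between coordinates are proved
  after applying it.\<close>

definition comb :: "real ^ 'k \<Rightarrow> 'l" where
  "comb c = (\<Sum>i\<in>UNIV. (c $ i) *\<^sub>R A i)"

lemma linear_comb: "linear comb"
  by (rule linearI) (simp_all add: comb_def scaleR_add_left sum.distrib scaleR_sum_right)

lemma inj_comb: "inj comb"
proof (rule linear_injective_0[OF linear_comb, THEN iffD2], intro allI impI)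
  fix c assume "comb c = 0"
  then have "(\<Sum>x\<in>range A. (c $ inv A x) *\<^sub>R x) = 0"
    using inj_A by (subst sum.reindex) (simp_all add: comb_def)
  then have "c $ inv A (A i) = 0" for i
    using independentD[OF indep_A, of "range A" "\<lambda>x. c $ inv A x" "A i"] by simp
  then show "c = 0" using inj_A by (simp add: vec_eq_iff)
qed

lemma range_comb: "range comb = \<aa>"
proof
  show "range comb \<subseteq> \<aa>"
  proof clarify
    fix c show "comb c \<in> \<aa>"
      unfolding comb_def span_A[symmetric] by (intro span_sum span_scale span_base) simp
  qed
  have "range A \<subseteq> range comb"
  proof clarify
    fix i
    have "comb (axis i 1) = (\<Sum>j\<in>UNIV. if j = i then A i else 0)"
      unfolding comb_def by (rule sum.cong) (auto simp: axis_def)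
    then have "A i = comb (axis i 1)" by simp
    then show "A i \<in> range comb" by blast
  qed
  then show "\<aa> \<subseteq> range comb"
    unfolding span_A[symmetric]
    by (rule span_minimal) (rule linear_subspace_image[OF linear_comb subspace_UNIV])
qed

lemma coords_comb: "coords A (comb c) = c"
  unfolding coords_def comb_def[symmetric] using inj_comb by (intro the_equality) (auto dest: injD)

lemma comb_coords: "X \<in> \<aa> \<Longrightarrow> comb (coords A X) = X"
  using range_comb coords_comb by (metis imageE)

text \<open>\<open>coords A\<close> is a definite description, without control outside \<aa>.
  Composed with the projection it becomes linear on the whole Lie algebra, so that derivatives pass
  through it.\<close>

definition cproj :: "'l \<Rightarrow> real ^ 'k" where
  "cproj = coords A \<circ> \<pi>\<^sub>\<aa>"

lemma linear_cproj: "linear cproj"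
  by (rule linearI; rule injD[OF inj_comb])
    (simp_all add: cproj_def linear_add[OF linear_comb] linear_scale[OF linear_comb] comb_coords \<pi>\<^sub>\<aa>_in
      linear_add[OF linear_\<pi>\<^sub>\<aa>] linear_scale[OF linear_\<pi>\<^sub>\<aa>] subspace_add[OF subspaces(3)] subspace_scale[OF subspaces(3)])

lemma \<pi>\<^sub>\<aa>_a: "X \<in> \<aa> \<Longrightarrow> \<pi>\<^sub>\<aa> X = X"
  using components(1)[OF _ subspace_0[OF subspaces(4)] subspace_0[OF subspaces(5)] subspace_0[OF subspaces(6)], of X] by simp

lemma coords_eq_cproj: "X \<in> \<aa> \<Longrightarrow> coords A X = cproj X"
  by (simp add: cproj_def \<pi>\<^sub>\<aa>_a)

end

section \<open>Integral manifolds\<close>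

text \<open>Preimages of small coordinate balls serve as neighbourhoods. They keep the last piece of
  a path within the domain of one primitive in
  \<open>simply_connected_global_primitive\<close>.\<close>

lemma manifold_locally_path_connected:
  fixes \<M> :: "('m::{t2_space,second_countable_topology}, 'd::euclidean_space) chart set" and p :: 'm
  assumes M: "smooth_atlas \<M>" and W: "open W" "p \<in> W"
  shows "\<exists>N. open N \<and> p \<in> N \<and> N \<subseteq> W \<and> path_connected N"
proof -
  obtain U \<phi> where c: "(U, \<phi>) \<in> \<M>" "p \<in> U" using ex_chart[OF M] .
  note cM = smooth_atlasD[OF M c(1)]
  have "open (\<phi> ` (U \<inter> W))" using chart_image_open[OF M c(1)] cM(1) W(1) by (simp add: open_Int)
  moreover have "\<phi> p \<in> \<phi> ` (U \<inter> W)" using c W by blast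
  ultimately obtain r where r: "r > 0" "ball (\<phi> p) r \<subseteq> \<phi> ` (U \<inter> W)" using open_contains_ball by blast
  let ?N = "inv_into U \<phi> ` ball (\<phi> p) r"
  have "?N = U \<inter> \<phi> -` ball (\<phi> p) r"
  proof (intro equalityI subsetI)
    fix q assume "q \<in> ?N"
    then obtain x where x: "x \<in> ball (\<phi> p) r" "q = inv_into U \<phi> x" by blast
    then obtain q' where q': "x = \<phi> q'" "q' \<in> U" using r(2) by blast
    then show "q \<in> U \<inter> \<phi> -` ball (\<phi> p) r" using x cM(3) by simp
  next
    fix q assume q: "q \<in> U \<inter> \<phi> -` ball (\<phi> p) r"
    then have "q = inv_into U \<phi> (\<phi> q)" using cM(3) by simp
    then show "q \<in> ?N" using q by blast
  qed
  then have "open ?N" using open_preimage_continuous_on[OF cM(4,1)] by simp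
  moreover have "p \<in> ?N" using c(2) cM(3) r(1) by (intro image_eqI[of _ _ "\<phi> p"]) auto
  moreover have "?N \<subseteq> W"
  proof
    fix q assume "q \<in> ?N"
    then obtain x where x: "x \<in> ball (\<phi> p) r" "q = inv_into U \<phi> x" by blast
    then obtain q' where "x = \<phi> q'" "q' \<in> U" "q' \<in> W" using r(2) by blast
    then show "q \<in> W" using x cM(3) by simp
  qed
  moreover have "path_connected ?N"
    by (rule path_connected_continuous_image[OF continuous_on_subset[OF cM(5)] convex_imp_path_connected[OF convex_ball]])
      (use r in auto)
  ultimately show ?thesis by blast
qed

section \<open>Integral manifolds and framings in terms of the pulled-back Maurer--Cartan
  form\<close>

context cartan_tableau_setting
begin

context
  fixes \<M> :: "('m::{t2_space,second_countable_topology}, real ^ 'k) chart set"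
  assumes M: "smooth_atlas \<M>"
begin

text \<open>The map (g, V) followed by the projection to the group is \<open>g\<close>, so by
  functoriality of the push-forward the form on the product only sees \<open>g\<close>.\<close>

lemma mc_Y_pushforward:
  "mc_Y G (g p, V p) (pushforward (Y_atlas G) (\<lambda>q. (g q, V q)) p v) = mcp g p v"
proof -
  have "pushforward \<A> fst (g p, V p) (pushforward (prod_atlas \<A> std_atlas) (\<lambda>q. (g q, V q)) p v) = pushforward \<A> (fst \<circ> (\<lambda>q. (g q, V q))) p v"
    by (rule pushforward_compose[OF smooth_atlas_prod[OF atlas smooth_atlas_std] atlas
        smooth_map_fst_snd(1)[OF atlas smooth_atlas_std] open_UNIV UNIV_I])
  then show ?thesis by (simp add: mc_Y_def pullback_def Y_atlas_def o_def)
qed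

text \<open>Working form of the definition: the Pfaffian equations become one equation for the
  pulled-back form \<open>mcp g\<close>. The translation needs \<open>V p\<close> in \<mm>, hence
  the case distinction on \<open>immersed_in_Y\<close>.\<close>

lemma integral_manifold_iff:
  "integral_manifold G A \<aa> \<mm> \<bb> \<nn> \<M> UNIV g V \<longleftrightarrow>
    immersed_in_Y G \<mm> \<M> UNIV g V \<and>
    (\<forall>p. \<forall>v\<in>tangent_space \<M> p. mcp g p v = \<pi>\<^sub>\<aa> (mcp g p v) + br (\<pi>\<^sub>\<aa> (mcp g p v)) (V p)) \<and>
    (\<forall>p. \<exists>v :: 'k \<Rightarrow> 'm tvec. (\<forall>j. v j \<in> tangent_space \<M> p) \<and> det (\<chi> i j. coords A (\<pi>\<^sub>\<aa> (mcp g p (v j))) $ i) \<noteq> 0)"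
proof -
  have A: "(\<forall>\<eta>\<in>pfaffian_system G \<aa> \<mm> \<bb> \<nn>. \<forall>p\<in>UNIV. \<forall>v\<in>tangent_space \<M> p.
        pullback (Y_atlas G) (\<lambda>q. (g q, V q)) \<eta> p v = 0) \<longleftrightarrow>
    (\<forall>p. \<forall>v\<in>tangent_space \<M> p. \<pi>\<^sub>\<bb> (mcp g p v) - cartan_tableau G (V p) (\<pi>\<^sub>\<aa> (mcp g p v)) = 0 \<and> \<pi>\<^sub>\<mm> (mcp g p v) = 0 \<and> \<pi>\<^sub>\<nn> (mcp g p v) = 0)"
    unfolding pfaffian_system_def pullback_def[of "Y_atlas G"] theta_a_def theta_b_def theta_m_def theta_n_def
      ball_simps mc_Y_pushforward by simp blast
  have B: "pullback (Y_atlas G) (\<lambda>q. (g q, V q)) (theta_a G \<aa> \<mm> \<bb> \<nn>) p v = \<pi>\<^sub>\<aa> (mcp g p v)" for p v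
    unfolding pullback_def[of "Y_atlas G"] theta_a_def mc_Y_pushforward ..
  show ?thesis
  proof (cases "immersed_in_Y G \<mm> \<M> UNIV g V")
    case True
    then have V: "V p \<in> \<mm>" for p by (simp add: immersed_in_Y_def)
    show ?thesis
      unfolding integral_manifold_def A B pfaffian_value_iff[OF V] by (simp only: ball_UNIV)
  qed (simp add: integral_manifold_def)
qed

lemma immersed_in_Y_smooth:
  assumes "immersed_in_Y G \<mm> \<M> UNIV g V"
  shows "smooth_map \<M> UNIV \<A> g" "smooth_map \<M> UNIV std_atlas V" "V p \<in> \<mm>"
proof -
  note Y = smooth_atlas_prod[OF atlas smooth_atlas_std]
  have s: "smooth_map \<M> UNIV (prod_atlas \<A> std_atlas) (\<lambda>p. (g p, V p))"
    using assms by (simp add: immersed_in_Y_def immersion_def Y_atlas_def)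
  have "smooth_map \<M> UNIV \<A> (fst \<circ> (\<lambda>p. (g p, V p)))"
    by (rule smooth_map_compose[OF M Y atlas open_UNIV open_UNIV subset_UNIV s smooth_map_fst_snd(1)[OF atlas smooth_atlas_std]])
  then show "smooth_map \<M> UNIV \<A> g" by (simp add: o_def)
  have "smooth_map \<M> UNIV std_atlas (snd \<circ> (\<lambda>p. (g p, V p)))"
    by (rule smooth_map_compose[OF M Y smooth_atlas_std open_UNIV open_UNIV subset_UNIV s smooth_map_fst_snd(2)[OF atlas smooth_atlas_std]])
  then show "smooth_map \<M> UNIV std_atlas V" by (simp add: o_def)
  show "V p \<in> \<mm>" using assms by (simp add: immersed_in_Y_def)
qed

lemma local_diffeo_into_smooth:
  assumes f: "local_diffeo_into \<M> W A \<aa> f" and W: "open W"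
  shows "smooth_map \<M> W std_atlas (\<lambda>p. coords A (f p))" "smooth_map \<M> W std_atlas f"
proof -
  show 1: "smooth_map \<M> W std_atlas (\<lambda>p. coords A (f p))"
    using f by (intro smooth_map_local[OF M smooth_atlas_std]) (auto simp: local_diffeo_into_def local_diffeo_def)
  have "bounded_linear comb" using linear_comb by (simp add: linear_conv_bounded_linear)
  from smooth_map_bounded_linear[OF M W this 1] show "smooth_map \<M> W std_atlas f"
    by (rule smooth_map_cong[OF M smooth_atlas_std W]) (use f in \<open>auto simp: local_diffeo_into_def comb_coords\<close>)
qed

text \<open>The derivative of the smooth local inverse is a right inverse \<open>E\<close> of
  \<open>D\<close>; domain and range have the same dimension, so \<open>D\<close> is also injective.
  \<open>comb\<close> turns coordinates back into values of \<open>f\<close> in the Lie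
  algebra.\<close>

lemma local_diffeo_into_derivative:
  assumes f: "local_diffeo_into \<M> W A \<aa> f" and W: "open W" "p \<in> W" and c: "(U, \<phi>) \<in> \<M>" "p \<in> U"
  obtains D where "linear D" "surj D" "inj D" "\<And>u. dvec (coord_vector \<M> (U, \<phi>) p u) f = comb (D u)"
proof -
  let ?F = "\<lambda>p. coords A (f p)"
  let ?Fh = "?F \<circ> inv_into U \<phi>"
  note cM = smooth_atlasD[OF M c(1)]
  note sm = local_diffeo_into_smooth[OF f W(1)]
  define D where "D = frechet_derivative ?Fh (at (\<phi> p))"
  have o: "open (\<phi> ` (U \<inter> W))" using chart_image_open[OF M c(1)] cM(1) W(1) by (simp add: open_Int)
  have pin: "\<phi> p \<in> \<phi> ` (U \<inter> W)" using c W by blast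
  have "smooth_on (\<phi> ` (U \<inter> W)) ?Fh"
    using sm(1) c(1) unfolding smooth_map_std_iff[OF M W(1)] by blast
  from smooth_on_has_derivative[OF this pin] have D: "(?Fh has_derivative D) (at (\<phi> p))" by (simp add: D_def)
  have linD: "linear D" using D has_derivative_linear by blast
  have "bounded_linear comb" using linear_comb by (simp add: linear_conv_bounded_linear)
  from bounded_linear.has_derivative[OF this D]
  have "((\<lambda>x. comb (?Fh x)) has_derivative (\<lambda>u. comb (D u))) (at (\<phi> p))" .
  moreover have "comb (?Fh x) = (f \<circ> inv_into U \<phi>) x" if "x \<in> \<phi> ` (U \<inter> W)" for x
    using that f cM(3) by (auto simp: local_diffeo_into_def comb_coords)
  ultimately have "((f \<circ> inv_into U \<phi>) has_derivative (\<lambda>u. comb (D u))) (at (\<phi> p))"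
    by (rule has_derivative_transform_within_open[OF _ o pin])
  from frechet_derivative_at[OF this, symmetric]
  have dv: "dvec (coord_vector \<M> (U, \<phi>) p u) f = comb (D u)" for u
    by (simp add: dvec_coord_vector[OF M c sm(2) W])
  obtain U' where U': "open U'" "p \<in> U'" "U' \<subseteq> W" "open (?F ` U')" "inj_on ?F U'"
    "smooth_map std_atlas (?F ` U') \<M> (inv_into U' ?F)"
    using f W(2) unfolding local_diffeo_into_def local_diffeo_def by blast
  let ?K = "inv_into U' ?F"
  \<comment> \<open>The part of the image on which the local inverse stays in the chart domain
    \<open>U\<close>.\<close>
  define N where "N = ?F ` U' \<inter> ?K -` U"
  have N: "open N" unfolding N_def
    by (rule open_preimage_continuous_on[OF smooth_map_continuous_on[OF U'(6)] U'(4) cM(1)])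
  have Kp: "?K (?F p) = p" by (rule inv_into_f_f[OF U'(5,2)])
  have FpN: "?F p \<in> N" using U'(2) c(2) Kp by (simp add: N_def)
  have "smooth_map std_atlas N std_atlas (\<phi> \<circ> ?K)"
    by (rule smooth_map_compose[OF smooth_atlas_std M smooth_atlas_std N cM(1) _ smooth_map_subset[OF U'(6)] smooth_map_chart(1)[OF M c(1)]])
      (auto simp: N_def)
  then have "smooth_on N (\<phi> \<circ> ?K)" by (simp add: smooth_map_std_std_iff)
  from smooth_on_has_derivative[OF this FpN] obtain E where E: "((\<phi> \<circ> ?K) has_derivative E) (at (?F p))" by blast
  have "(?Fh has_derivative D) (at ((\<phi> \<circ> ?K) (?F p)))" using D Kp by simp
  from has_derivative_compose[OF E this]
  have "((\<lambda>y. ?Fh ((\<phi> \<circ> ?K) y)) has_derivative (\<lambda>y. D (E y))) (at (?F p))" .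
  moreover have "?Fh ((\<phi> \<circ> ?K) y) = y" if "y \<in> N" for y
  proof -
    have y: "y \<in> ?F ` U'" "?K y \<in> U" using that by (auto simp: N_def)
    then have "?Fh ((\<phi> \<circ> ?K) y) = ?F (?K y)" using cM(3) by simp
    also have "\<dots> = y" by (rule f_inv_into_f[OF y(1)])
    finally show ?thesis .
  qed
  ultimately have "((\<lambda>y. y) has_derivative (\<lambda>y. D (E y))) (at (?F p))"
    by (rule has_derivative_transform_within_open[OF _ N FpN])
  from has_derivative_unique[OF this has_derivative_ident] have DE: "D (E y) = y" for y by (rule fun_cong)
  have "surj D" by (rule surjI[of D E]) (rule DE)
  moreover have "inj D" by (rule linear_surjective_imp_injective[OF linD \<open>surj D\<close> refl])
  ultimately show thesis using that linD dv by blast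
qed

lemma local_diffeo_into_dvec_in_a:
  assumes f: "local_diffeo_into \<M> W A \<aa> f" and W: "open W" "p \<in> W" and v: "v \<in> tangent_space \<M> p"
  shows "dvec v f \<in> \<aa>"
proof -
  obtain U \<phi> u where c: "(U, \<phi>) \<in> \<M>" "p \<in> U" "v = coord_vector \<M> (U, \<phi>) p u" using tangent_spaceE[OF v] .
  obtain D where "dvec (coord_vector \<M> (U, \<phi>) p u) f = comb (D u)"
    using local_diffeo_into_derivative[OF f W c(1,2)] by metis
  then show ?thesis using range_comb c(3) by auto
qed

lemma framing_\<pi>\<^sub>\<aa>:
  assumes f: "local_diffeo_into \<M> W A \<aa> f" and W: "open W" "p \<in> W" and fr: "framing_eq G \<M> W f g V" and V: "V p \<in> \<mm>"
    and v: "v \<in> tangent_space \<M> p"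
  shows "\<pi>\<^sub>\<aa> (mcp g p v) = dvec v f" "mcp g p v = \<pi>\<^sub>\<aa> (mcp g p v) + br (\<pi>\<^sub>\<aa> (mcp g p v)) (V p)"
proof -
  have eq: "mcp g p v = dvec v f + br (dvec v f) (V p)"
    using fr W(2) v by (simp add: framing_eq_def theta_def)
  then show 1: "\<pi>\<^sub>\<aa> (mcp g p v) = dvec v f"
    using \<pi>\<^sub>\<aa>_tableau[OF local_diffeo_into_dvec_in_a[OF f W v] V] by simp
  show "mcp g p v = \<pi>\<^sub>\<aa> (mcp g p v) + br (\<pi>\<^sub>\<aa> (mcp g p v)) (V p)" unfolding 1 by (rule eq)
qed

lemma framing_independence:
  assumes f: "local_diffeo_into \<M> W A \<aa> f" and W: "open W" "p \<in> W" and fr: "framing_eq G \<M> W f g V" and V: "V p \<in> \<mm>"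
  shows "\<exists>v :: 'k \<Rightarrow> 'm tvec. (\<forall>j. v j \<in> tangent_space \<M> p) \<and> det (\<chi> i j. coords A (\<pi>\<^sub>\<aa> (mcp g p (v j))) $ i) \<noteq> 0"
proof -
  obtain U \<phi> where c: "(U, \<phi>) \<in> \<M>" "p \<in> U" using ex_chart[OF M] .
  obtain D where D: "surj D" "\<And>u. dvec (coord_vector \<M> (U, \<phi>) p u) f = comb (D u)"
    using local_diffeo_into_derivative[OF f W c] by metis
  \<comment> \<open>Tangent vectors on which df takes the basis values \<open>A j\<close>, so that
    the matrix in the independence condition is the identity.\<close>
  define v where "v = (\<lambda>j. coord_vector \<M> (U, \<phi>) p (inv D (axis j 1)))"
  have v: "v j \<in> tangent_space \<M> p" for j
    unfolding v_def by (rule coord_vector_in_tangent_space[OF c])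
  have "coords A (\<pi>\<^sub>\<aa> (mcp g p (v j))) = axis j 1" for j
    unfolding framing_\<pi>\<^sub>\<aa>(1)[OF f W fr V v] unfolding v_def D(2) coords_comb by (rule surj_f_inv_f[OF D(1)])
  then have "(\<chi> i j. coords A (\<pi>\<^sub>\<aa> (mcp g p (v j))) $ i) = mat 1"
    by (simp add: vec_eq_iff mat_def axis_def)
  then have "det (\<chi> i j. coords A (\<pi>\<^sub>\<aa> (mcp g p (v j))) $ i) \<noteq> 0" by (simp only: det_I)
  with v show ?thesis by blast
qed

lemma integral_manifoldI_framing:
  assumes im: "immersed_in_Y G \<mm> \<M> UNIV g V"
    and loc: "\<And>p. \<exists>W f. open W \<and> p \<in> W \<and> local_diffeo_into \<M> W A \<aa> f \<and> framing_eq G \<M> W f g V"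
  shows "integral_manifold G A \<aa> \<mm> \<bb> \<nn> \<M> UNIV g V"
  unfolding integral_manifold_iff
proof (intro conjI allI ballI im)
  note V = immersed_in_Y_smooth(3)[OF im]
  fix p
  obtain W f where W: "open W" "p \<in> W" "local_diffeo_into \<M> W A \<aa> f" "framing_eq G \<M> W f g V"
    using loc by blast
  show "\<exists>v :: 'k \<Rightarrow> 'm tvec. (\<forall>j. v j \<in> tangent_space \<M> p) \<and> det (\<chi> i j. coords A (\<pi>\<^sub>\<aa> (mcp g p (v j))) $ i) \<noteq> 0"
    by (rule framing_independence[OF W(3,1,2,4) V])
  fix v assume "v \<in> tangent_space \<M> p"
  then show "mcp g p v = \<pi>\<^sub>\<aa> (mcp g p v) + br (\<pi>\<^sub>\<aa> (mcp g p v)) (V p)"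
    by (rule framing_\<pi>\<^sub>\<aa>(2)[OF W(3,1,2,4) V])
qed

text \<open>Two tangent vectors with the same push-forward have the same value under
  \<open>mcp g\<close>, hence under df, which is its component in \<aa>; and df is injective because
  \<open>f\<close> is a local diffeomorphism.\<close>

lemma immersedI_framed:
  assumes loc: "\<And>p. \<exists>W. open W \<and> p \<in> W \<and> framed_solution G A \<aa> \<mm> \<M> W g V"
  shows "immersed_in_Y G \<mm> \<M> UNIV g V"
proof -
  have *: "\<exists>W f. open W \<and> p \<in> W \<and> local_diffeo_into \<M> W A \<aa> f \<and> framing_eq G \<M> W f g V \<and>
      smooth_map \<M> W \<A> g \<and> smooth_map \<M> W std_atlas V \<and> V p \<in> \<mm>" for p
    using loc[of p] unfolding framed_solution_def generalized_solution_def by blast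
  have g: "smooth_map \<M> UNIV \<A> g"
    by (rule smooth_map_local[OF M atlas]) (use * in blast)
  have V: "smooth_map \<M> UNIV std_atlas V"
    by (rule smooth_map_local[OF M smooth_atlas_std]) (use * in blast)
  have "inj_on (pushforward (Y_atlas G) (\<lambda>p. (g p, V p)) p) (tangent_space \<M> p)" for p
  proof (rule inj_onI)
    fix v v' assume v: "v \<in> tangent_space \<M> p" "v' \<in> tangent_space \<M> p"
      and eq: "pushforward (Y_atlas G) (\<lambda>p. (g p, V p)) p v = pushforward (Y_atlas G) (\<lambda>p. (g p, V p)) p v'"
    obtain W f where W: "open W" "p \<in> W" "local_diffeo_into \<M> W A \<aa> f" "framing_eq G \<M> W f g V" "V p \<in> \<mm>"
      using *[of p] by blast
    have "mcp g p v = mcp g p v'"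
      using mc_Y_pushforward[of g p V v] mc_Y_pushforward[of g p V v'] eq by simp
    then have d: "dvec v f = dvec v' f"
      using framing_\<pi>\<^sub>\<aa>(1)[OF W(3,1,2,4,5) v(1)] framing_\<pi>\<^sub>\<aa>(1)[OF W(3,1,2,4,5) v(2)] by simp
    obtain U \<phi> where c: "(U, \<phi>) \<in> \<M>" "p \<in> U" using ex_chart[OF M] .
    obtain u u' where u: "v = coord_vector \<M> (U, \<phi>) p u" "v' = coord_vector \<M> (U, \<phi>) p u'"
      using v unfolding tangent_space_eq[OF M c] by blast
    obtain D where D: "inj D" "\<And>u. dvec (coord_vector \<M> (U, \<phi>) p u) f = comb (D u)"
      using local_diffeo_into_derivative[OF W(3,1,2) c] by metis
    have "comb (D u) = comb (D u')" using d unfolding u D(2) .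
    then have "u = u'" using injD[OF inj_comb] injD[OF D(1)] by blast
    then show "v = v'" by (simp add: u)
  qed
  moreover have "smooth_map \<M> UNIV (Y_atlas G) (\<lambda>p. (g p, V p))"
    unfolding Y_atlas_def by (rule smooth_map_Pair[OF M atlas smooth_atlas_std open_UNIV g V])
  moreover have "V p \<in> \<mm>" for p using *[of p] by blast
  ultimately show ?thesis by (simp add: immersed_in_Y_def immersion_def)
qed

text \<open>The Maurer--Cartan equation for \<open>theta\<close> is inherited from the pulled-back
  form: the two coincide on the open set \<open>W\<close>, and exterior derivatives are
  local.\<close>

lemma framed_solutionI:
  assumes W: "open W" and f: "local_diffeo_into \<M> W A \<aa> f" and fr: "framing_eq G \<M> W f g V"
    and g: "smooth_map \<M> W \<A> g" and V: "smooth_map \<M> W std_atlas V" "\<And>p. p \<in> W \<Longrightarrow> V p \<in> \<mm>"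
  shows "framed_solution G A \<aa> \<mm> \<M> W g V"
proof -
  have "maurer_cartan_eq G \<M> W (theta G f V)"
    unfolding maurer_cartan_eq_def
  proof clarify
    fix U \<phi> p u w assume c: "(U, \<phi>) \<in> \<M>" and p: "p \<in> W" "p \<in> fst (U, \<phi>)"
    have pU: "p \<in> U" using p by simp
    have o: "open (U \<inter> W)" using smooth_atlasD(1)[OF M c] W by auto
    have eq: "theta G f V q (coord_vector \<M> (U, \<phi>) q w) = mcp g q (coord_vector \<M> (U, \<phi>) q w)" if "q \<in> U \<inter> W" for q w
      using fr that coord_vector_in_tangent_space[OF c, of q w] by (simp add: framing_eq_def)
    have d: "dvec (coord_vector \<M> (U, \<phi>) p u) (\<lambda>q. theta G f V q (coord_vector \<M> (U, \<phi>) q w))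
      = dvec (coord_vector \<M> (U, \<phi>) p u) (\<lambda>q. mcp g q (coord_vector \<M> (U, \<phi>) q w))" for u w
      by (rule dvec_local[OF M coord_vector_in_tangent_space[OF c pU] o _ eq]) (use pU p in simp)
    have "ext_deriv \<M> (mcp g) (U, \<phi>) p u w + br (mcp g p (coord_vector \<M> (U, \<phi>) p u)) (mcp g p (coord_vector \<M> (U, \<phi>) p w)) = 0"
      using maurer_cartan_pullback[OF M g W] c p by (force simp: maurer_cartan_eq_def)
    then show "ext_deriv \<M> (theta G f V) (U, \<phi>) p u w
       + br (theta G f V p (coord_vector \<M> (U, \<phi>) p u)) (theta G f V p (coord_vector \<M> (U, \<phi>) p w)) = 0"
      using eq[of p] pU p(1) unfolding ext_deriv_def d by simp
  qed
  then show ?thesis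
    using f fr g V unfolding framed_solution_def generalized_solution_def by blast
qed

text \<open>\<open>\<pi>\<^sub>\<aa> (mcp g q v)\<close> is the pull-back of
  \<open>\<theta>\<^sub>\<aa>\<close>, so this is df = \<open>\<theta>\<^sub>\<aa>\<close> on
  \<open>W\<close>. Values in \<aa> are demanded separately, since df leaves open a local constant
  in the whole Lie algebra.\<close>

definition primitive :: "('m \<Rightarrow> 'g) \<Rightarrow> 'm set \<Rightarrow> ('m \<Rightarrow> 'l) \<Rightarrow> bool" where
  "primitive g W f \<longleftrightarrow> open W \<and> (\<forall>q\<in>W. f q \<in> \<aa>) \<and> smooth_map \<M> W std_atlas f \<and>
     (\<forall>q\<in>W. \<forall>v\<in>tangent_space \<M> q. dvec v f = \<pi>\<^sub>\<aa> (mcp g q v))"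

text \<open>The \<open>\<aa>\<close>-component of the structure equation says that \<open>\<theta>\<^sub>\<aa>\<close> is closed, because
  \<open>[\<aa>, \<gg>\<^sub>0] \<subseteq> \<mm>\<close>.\<close>

lemma ex_local_primitive:
  assumes g: "smooth_map \<M> UNIV \<A> g" and V: "\<And>p. V p \<in> \<mm>"
    and pf: "\<And>p v. v \<in> tangent_space \<M> p \<Longrightarrow> mcp g p v = \<pi>\<^sub>\<aa> (mcp g p v) + br (\<pi>\<^sub>\<aa> (mcp g p v)) (V p)"
  shows "\<exists>W f. open W \<and> p \<in> W \<and> primitive g W f"
proof -
  obtain U \<phi> where c: "(U, \<phi>) \<in> \<M>" "p \<in> U" using ex_chart[OF M] .
  note cM = smooth_atlasD[OF M c(1)]
  \<comment> \<open>A ball inside the chart image provides the convex domain for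
    \<open>poincare_lemma\<close>.\<close>
  obtain r where r: "r > 0" "ball (\<phi> p) r \<subseteq> \<phi> ` U" using cM(2) c(2) open_contains_ball by blast
  define S where "S = ball (\<phi> p) r"
  have S: "open S" "convex S" "\<phi> p \<in> S" "S \<subseteq> \<phi> ` U" using r by (auto simp: S_def)
  define \<omega> where "\<omega> = (\<lambda>w a. mcp g (inv_into U \<phi> a) (coord_vector \<M> (U, \<phi>) (inv_into U \<phi> a) w))"
  have \<pi>: "bounded_linear \<pi>\<^sub>\<aa>" using linear_\<pi>\<^sub>\<aa> by (simp add: linear_conv_bounded_linear)
  have sm\<omega>: "smooth_on S (\<omega> w)" for w
    unfolding \<omega>_def by (rule smooth_on_subset[OF smooth_mc_pullback[OF M g open_UNIV c(1)]]) (use S in auto)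
  have \<omega>tab: "\<omega> w a = \<pi>\<^sub>\<aa> (\<omega> w a) + br (\<pi>\<^sub>\<aa> (\<omega> w a)) (V (inv_into U \<phi> a))" if "a \<in> S" for w a
  proof -
    have "inv_into U \<phi> a \<in> U" using that S(4) by (meson inv_into_into subsetD)
    from pf[OF coord_vector_in_tangent_space[OF c(1) this]] show ?thesis by (simp only: \<omega>_def)
  qed
  have "\<exists>f. \<forall>x\<in>S. (f has_derivative (\<lambda>w. \<pi>\<^sub>\<aa> (\<omega> w x))) (at x)"
  proof (rule poincare_lemma[OF S(1-3)])
    fix x assume x: "x \<in> S"
    then obtain q where q: "x = \<phi> q" "q \<in> U" using S(4) by blast
    have qx: "inv_into U \<phi> x = q" using q cM(3) by simp
    show "linear (\<lambda>w. \<pi>\<^sub>\<aa> (\<omega> w x))"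
      unfolding \<omega>_def qx
      using linear_compose[OF linear_mc_pullback[OF M g open_UNIV UNIV_I q(2) c(1)] linear_\<pi>\<^sub>\<aa>] by (simp add: o_def)
    fix u w
    have D: "frechet_derivative (\<lambda>a. \<pi>\<^sub>\<aa> (\<omega> w a)) (at x) u = \<pi>\<^sub>\<aa> (frechet_derivative (\<omega> w) (at x) u)" for u w
      by (rule fun_cong[OF frechet_derivative_bounded_linear[OF \<pi> smooth_on_differentiable[OF sm\<omega> x]]])
    have "frechet_derivative (\<omega> w) (at x) u - frechet_derivative (\<omega> u) (at x) w + br (\<omega> u x) (\<omega> w x) = 0"
      using structure_equation[OF M g open_UNIV c(1) q(2) UNIV_I, of w u] unfolding \<omega>_def q(1) .
    then have "\<pi>\<^sub>\<aa> (frechet_derivative (\<omega> w) (at x) u) - \<pi>\<^sub>\<aa> (frechet_derivative (\<omega> u) (at x) w) + \<pi>\<^sub>\<aa> (br (\<omega> u x) (\<omega> w x)) = 0"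
      using linear_0[OF linear_\<pi>\<^sub>\<aa>] by (simp only: linear_add[OF linear_\<pi>\<^sub>\<aa>, symmetric] linear_diff[OF linear_\<pi>\<^sub>\<aa>, symmetric])
    moreover have "\<pi>\<^sub>\<aa> (br (\<omega> u x) (\<omega> w x)) = 0"
      using \<pi>\<^sub>\<aa>_bracket_tableau[OF \<pi>\<^sub>\<aa>_in \<pi>\<^sub>\<aa>_in V, of "\<omega> u x" "inv_into U \<phi> x" "\<omega> w x"] unfolding \<omega>tab[OF x, symmetric] .
    ultimately show "frechet_derivative (\<lambda>a. \<pi>\<^sub>\<aa> (\<omega> w a)) (at x) u = frechet_derivative (\<lambda>a. \<pi>\<^sub>\<aa> (\<omega> u a)) (at x) w"
      unfolding D by simp
  next
    show "smooth_on S (\<lambda>x. \<pi>\<^sub>\<aa> (\<omega> w x))" for w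
      by (rule smooth_on_bounded_linear[OF \<pi> S(1) sm\<omega>])
  qed
  then obtain F where F: "\<And>x. x \<in> S \<Longrightarrow> (F has_derivative (\<lambda>w. \<pi>\<^sub>\<aa> (\<omega> w x))) (at x)" by blast
  \<comment> \<open>\<open>F\<close> takes values in the whole Lie algebra; projecting puts them in
    \<aa> and does not change the derivative, whose values lie there already.\<close>
  define f where "f = (\<lambda>q. \<pi>\<^sub>\<aa> (F (\<phi> q)))"
  define W where "W = U \<inter> \<phi> -` S"
  have W: "open W" "p \<in> W" "W \<subseteq> U"
    unfolding W_def using open_preimage_continuous_on[OF cM(4,1) S(1)] c(2) S(3) by auto
  have \<phi>W: "\<phi> ` W = S" using S(4) by (auto simp: W_def)
  have feq: "\<pi>\<^sub>\<aa> (F x) = (f \<circ> inv_into U \<phi>) x" if "x \<in> S" for x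
    using that S(4) by (auto simp: f_def f_inv_into_f)
  have D: "((f \<circ> inv_into U \<phi>) has_derivative (\<lambda>w. \<pi>\<^sub>\<aa> (\<omega> w x))) (at x)" if x: "x \<in> S" for x
  proof -
    have "((\<lambda>x. \<pi>\<^sub>\<aa> (F x)) has_derivative (\<lambda>w. \<pi>\<^sub>\<aa> (\<pi>\<^sub>\<aa> (\<omega> w x)))) (at x)"
      by (rule bounded_linear.has_derivative[OF \<pi> F[OF x]])
    then have "((\<lambda>x. \<pi>\<^sub>\<aa> (F x)) has_derivative (\<lambda>w. \<pi>\<^sub>\<aa> (\<omega> w x))) (at x)"
      by (simp only: \<pi>\<^sub>\<aa>_a[OF \<pi>\<^sub>\<aa>_in])
    then show ?thesis by (rule has_derivative_transform_within_open[OF _ S(1) x feq])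
  qed
  have "smooth_on S (f \<circ> inv_into U \<phi>)"
    by (rule smooth_onI_has_derivative[OF S(1) D smooth_on_bounded_linear[OF \<pi> S(1) sm\<omega>]])
  then have smf: "smooth_map \<M> W std_atlas f"
    by (intro smooth_map_from_chart[OF M c(1) W(1,3)]) (simp add: \<phi>W)
  have "dvec v f = \<pi>\<^sub>\<aa> (mcp g q v)" if q: "q \<in> W" "v \<in> tangent_space \<M> q" for q v
  proof -
    have qU: "q \<in> U" "\<phi> q \<in> S" using q W by (auto simp: W_def)
    obtain u where u: "v = coord_vector \<M> (U, \<phi>) q u"
      using q(2) unfolding tangent_space_eq[OF M c(1) qU(1)] by blast
    have "dvec v f = \<pi>\<^sub>\<aa> (\<omega> u (\<phi> q))"
      unfolding u dvec_coord_vector[OF M c(1) qU(1) smf W(1) q(1)]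
      by (rule fun_cong[OF frechet_derivative_at[OF D[OF qU(2)], symmetric]])
    also have "\<omega> u (\<phi> q) = mcp g q v" using qU(1) cM(3) by (simp add: \<omega>_def u)
    finally show ?thesis .
  qed
  moreover have "f q \<in> \<aa>" for q unfolding f_def by (rule \<pi>\<^sub>\<aa>_in)
  ultimately have "primitive g W f" using W(1) smf by (simp add: primitive_def)
  with W(1,2) show ?thesis by blast
qed

text \<open>On a coordinate ball, which is convex, both primitives have the same derivative, so
  their difference is constant.\<close>

lemma primitive_locally_unique:
  assumes f: "primitive g W f" "primitive g W' f'" and p: "p \<in> W" "p \<in> W'"
  shows "\<exists>N c. open N \<and> p \<in> N \<and> (\<forall>q\<in>N. f q = f' q + c)"
proof -
  obtain U \<phi> where c: "(U, \<phi>) \<in> \<M>" "p \<in> U" using ex_chart[OF M] .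
  note cM = smooth_atlasD[OF M c(1)]
  have W: "open W" "open W'" "smooth_map \<M> W std_atlas f" "smooth_map \<M> W' std_atlas f'"
    and d: "\<And>q v. q \<in> W \<Longrightarrow> v \<in> tangent_space \<M> q \<Longrightarrow> dvec v f = \<pi>\<^sub>\<aa> (mcp g q v)"
      "\<And>q v. q \<in> W' \<Longrightarrow> v \<in> tangent_space \<M> q \<Longrightarrow> dvec v f' = \<pi>\<^sub>\<aa> (mcp g q v)"
    using f by (auto simp: primitive_def)
  have "open (\<phi> ` (U \<inter> W \<inter> W'))" using chart_image_open[OF M c(1), of "U \<inter> W \<inter> W'"] cM(1) W(1,2) by auto
  moreover have "\<phi> p \<in> \<phi> ` (U \<inter> W \<inter> W')" using c(2) p by blast
  ultimately obtain r where r: "r > 0" "ball (\<phi> p) r \<subseteq> \<phi> ` (U \<inter> W \<inter> W')" using open_contains_ball by blast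
  define S where "S = ball (\<phi> p) r"
  have der: "((\<lambda>x. (f \<circ> inv_into U \<phi>) x - (f' \<circ> inv_into U \<phi>) x) has_derivative (\<lambda>u. 0)) (at x within S)" if x: "x \<in> S" for x
  proof -
    obtain q where q: "x = \<phi> q" "q \<in> U" "q \<in> W" "q \<in> W'" using x r(2) by (auto simp: S_def)
    have "smooth_on (\<phi> ` (U \<inter> W)) (f \<circ> inv_into U \<phi>)" "smooth_on (\<phi> ` (U \<inter> W')) (f' \<circ> inv_into U \<phi>)"
      using W(3,4) c(1) unfolding smooth_map_std_iff[OF M W(1)] smooth_map_std_iff[OF M W(2)] by blast+
    then have "((f \<circ> inv_into U \<phi>) has_derivative frechet_derivative (f \<circ> inv_into U \<phi>) (at x)) (at x)"
      "((f' \<circ> inv_into U \<phi>) has_derivative frechet_derivative (f' \<circ> inv_into U \<phi>) (at x)) (at x)"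
      using q by (auto intro!: smooth_on_has_derivative)
    from has_derivative_diff[OF this]
    have "((\<lambda>x. (f \<circ> inv_into U \<phi>) x - (f' \<circ> inv_into U \<phi>) x) has_derivative
        (\<lambda>u. frechet_derivative (f \<circ> inv_into U \<phi>) (at x) u - frechet_derivative (f' \<circ> inv_into U \<phi>) (at x) u)) (at x)" .
    moreover have "frechet_derivative (f \<circ> inv_into U \<phi>) (at x) u = frechet_derivative (f' \<circ> inv_into U \<phi>) (at x) u" for u
      using d(1)[OF q(3) coord_vector_in_tangent_space[OF c(1) q(2), of u]]
        d(2)[OF q(4) coord_vector_in_tangent_space[OF c(1) q(2), of u]]
      by (simp add: dvec_coord_vector[OF M c(1) q(2) W(3,1) q(3)] dvec_coord_vector[OF M c(1) q(2) W(4,2) q(4)] q(1))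
    ultimately show ?thesis by (simp add: has_derivative_at_withinI)
  qed
  have "convex S" by (simp add: S_def)
  from has_derivative_zero_constant[OF this der]
  obtain k where k: "\<And>x. x \<in> S \<Longrightarrow> (f \<circ> inv_into U \<phi>) x - (f' \<circ> inv_into U \<phi>) x = k" by blast
  have "open (U \<inter> \<phi> -` S)" by (rule open_preimage_continuous_on[OF cM(4,1)]) (simp add: S_def)
  moreover have "p \<in> U \<inter> \<phi> -` S" using c(2) r(1) by (simp add: S_def)
  moreover have "f q = f' q + k" if "q \<in> U \<inter> \<phi> -` S" for q
    using k[of "\<phi> q"] that cM(3) by (simp add: algebra_simps)
  ultimately show ?thesis by blast
qed

lemma primitive_framing:
  assumes f: "primitive g W f"
    and pf: "\<And>p v. v \<in> tangent_space \<M> p \<Longrightarrow> mcp g p v = \<pi>\<^sub>\<aa> (mcp g p v) + br (\<pi>\<^sub>\<aa> (mcp g p v)) (V p)"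
  shows "framing_eq G \<M> W f g V"
  unfolding framing_eq_def theta_def
proof (intro ballI)
  fix p v assume "p \<in> W" "v \<in> tangent_space \<M> p"
  moreover from this have "dvec v f = \<pi>\<^sub>\<aa> (mcp g p v)" using f by (simp add: primitive_def)
  ultimately show "mcp g p v = dvec v f + br (dvec v f) (V p)" using pf[of v p] by simp
qed

text \<open>The independence condition makes the Jacobian of the coordinate expression of
  \<open>f\<close> invertible. \<open>smooth_local_inverse\<close> inverts this expression, and the
  inverse chart carries the result back to the manifold.\<close>

lemma primitive_local_diffeo:
  assumes f: "primitive g W f"
    and ind: "\<And>p. \<exists>v :: 'k \<Rightarrow> 'm tvec. (\<forall>j. v j \<in> tangent_space \<M> p) \<and> det (\<chi> i j. coords A (\<pi>\<^sub>\<aa> (mcp g p (v j))) $ i) \<noteq> 0"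
  shows "local_diffeo_into \<M> W A \<aa> f"
proof -
  have W: "open W" and fa: "\<And>q. q \<in> W \<Longrightarrow> f q \<in> \<aa>" and smf: "smooth_map \<M> W std_atlas f"
    and dv: "\<And>q v. q \<in> W \<Longrightarrow> v \<in> tangent_space \<M> q \<Longrightarrow> dvec v f = \<pi>\<^sub>\<aa> (mcp g q v)"
    using f by (auto simp: primitive_def)
  have cp: "bounded_linear cproj" using linear_cproj by (simp add: linear_conv_bounded_linear)
  let ?F = "\<lambda>p. coords A (f p)"
  have smF: "smooth_map \<M> W std_atlas ?F"
    by (rule smooth_map_cong[OF M smooth_atlas_std W smooth_map_bounded_linear[OF M W cp smf]])
      (simp add: coords_eq_cproj fa)
  have "\<exists>U'. open U' \<and> p \<in> U' \<and> U' \<subseteq> W \<and> open (?F ` U') \<and> inj_on ?F U' \<and>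
        smooth_map \<M> U' std_atlas ?F \<and> smooth_map std_atlas (?F ` U') \<M> (inv_into U' ?F)" if p: "p \<in> W" for p
  proof -
    obtain U \<phi> where c: "(U, \<phi>) \<in> \<M>" "p \<in> U" using ex_chart[OF M] .
    note cM = smooth_atlasD[OF M c(1)]
    define Q where "Q = \<phi> ` (U \<inter> W)"
    have Q: "open Q" unfolding Q_def using chart_image_open[OF M c(1)] cM(1) W by (simp add: open_Int)
    have pQ: "\<phi> p \<in> Q" using c(2) p by (auto simp: Q_def)
    let ?Fh = "?F \<circ> inv_into U \<phi>"
    have smFh: "smooth_on Q ?Fh" using smF c(1) unfolding smooth_map_std_iff[OF M W] Q_def by blast
    define D where "D = frechet_derivative ?Fh (at (\<phi> p))"
    have D: "(?Fh has_derivative D) (at (\<phi> p))" unfolding D_def by (rule smooth_on_has_derivative[OF smFh pQ])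
    have linD: "linear D" using D has_derivative_linear by blast
    \<comment> \<open>\<open>cproj\<close> replaces \<open>coords A\<close>, with which it agrees on
      \<aa>, so that the derivative can be pulled through a linear map.\<close>
    have DF: "D u = coords A (\<pi>\<^sub>\<aa> (mcp g p (coord_vector \<M> (U, \<phi>) p u)))" for u
    proof -
      have "D u = dvec (coord_vector \<M> (U, \<phi>) p u) ?F"
        unfolding D_def by (rule dvec_coord_vector[OF M c smF W p, symmetric])
      also have "\<dots> = dvec (coord_vector \<M> (U, \<phi>) p u) (\<lambda>q. cproj (f q))"
        by (rule dvec_local[OF M coord_vector_in_tangent_space[OF c] W p]) (simp add: coords_eq_cproj fa)
      also have "\<dots> = frechet_derivative ((\<lambda>q. cproj (f q)) \<circ> inv_into U \<phi>) (at (\<phi> p)) u"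
        by (rule dvec_coord_vector[OF M c smooth_map_bounded_linear[OF M W cp smf] W p])
      also have "\<dots> = frechet_derivative (\<lambda>x. cproj ((f \<circ> inv_into U \<phi>) x)) (at (\<phi> p)) u" by (simp add: o_def)
      also have "\<dots> = cproj (frechet_derivative (f \<circ> inv_into U \<phi>) (at (\<phi> p)) u)"
      proof (rule fun_cong[OF frechet_derivative_bounded_linear[OF cp]])
        have "smooth_on Q (f \<circ> inv_into U \<phi>)" using smf c(1) unfolding smooth_map_std_iff[OF M W] Q_def by blast
        then show "(f \<circ> inv_into U \<phi>) differentiable at (\<phi> p)" using pQ by (rule smooth_on_differentiable)
      qed
      also have "frechet_derivative (f \<circ> inv_into U \<phi>) (at (\<phi> p)) u = \<pi>\<^sub>\<aa> (mcp g p (coord_vector \<M> (U, \<phi>) p u))"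
        unfolding dvec_coord_vector[OF M c smf W p, symmetric] by (rule dv[OF p coord_vector_in_tangent_space[OF c]])
      finally show ?thesis by (simp add: coords_eq_cproj[OF \<pi>\<^sub>\<aa>_in])
    qed
    obtain v :: "'k \<Rightarrow> 'm tvec" where v: "\<And>j. v j \<in> tangent_space \<M> p" "det (\<chi> i j. coords A (\<pi>\<^sub>\<aa> (mcp g p (v j))) $ i) \<noteq> 0"
      using ind by blast
    have "\<exists>u. v j = coord_vector \<M> (U, \<phi>) p u" for j
      using v(1)[of j] unfolding tangent_space_eq[OF M c] by blast
    then obtain u where u: "\<And>j. v j = coord_vector \<M> (U, \<phi>) p (u j)" by metis
    have Dm: "D = (*v) (matrix D)" using linD by (simp add: matrix_vector_mul linear_matrix_vector_mul_eq)
    \<comment> \<open>Each \<open>v j\<close> has components \<open>u j\<close>, so the matrix of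
      the independence condition is the Jacobian times the matrix with columns \<open>u j\<close>; a
      nonzero determinant of the product forces one of the Jacobian.\<close>
    have "(\<chi> i j. coords A (\<pi>\<^sub>\<aa> (mcp g p (v j))) $ i) = matrix D ** (\<chi> k j. u j $ k)"
    proof -
      have "(matrix D ** (\<chi> k j. u j $ k)) $ i $ j = (matrix D *v u j) $ i" for i j
        by (simp add: matrix_matrix_mult_def matrix_vector_mult_def)
      then show ?thesis using fun_cong[OF Dm] by (simp add: vec_eq_iff u DF)
    qed
    then have "det (matrix D) \<noteq> 0" using v(2) by (auto simp: det_mul)
    then have "inj ((*v) (matrix D))" by (intro inj_matrix_vector_mult) (simp add: invertible_det_nz)
    then have "inj (frechet_derivative ?Fh (at (\<phi> p)))" unfolding D_def[symmetric] by (subst Dm)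
    from smooth_local_inverse[OF Q smFh pQ this]
    obtain R where R: "open R" "\<phi> p \<in> R" "R \<subseteq> Q" "open (?Fh ` R)" "inj_on ?Fh R" "smooth_on (?Fh ` R) (inv_into R ?Fh)"
      by blast
    define U' where "U' = U \<inter> \<phi> -` R"
    have U': "open U'" unfolding U'_def by (rule open_preimage_continuous_on[OF cM(4,1) R(1)])
    have pU': "p \<in> U'" using c(2) R(2) by (simp add: U'_def)
    have U'W: "U' \<subseteq> W"
    proof
      fix q assume q: "q \<in> U'"
      then obtain q' where "\<phi> q = \<phi> q'" "q' \<in> U" "q' \<in> W" using R(3) by (auto simp: U'_def Q_def)
      then show "q \<in> W" using q inj_onD[OF cM(3)] by (auto simp: U'_def)
    qed
    have \<phi>U': "\<phi> ` U' = R" using R(3) by (auto simp: U'_def Q_def)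
    have FFh: "?Fh (\<phi> q) = ?F q" if "q \<in> U'" for q using that cM(3) by (simp add: U'_def)
    have FU': "?F ` U' = ?Fh ` R" unfolding \<phi>U'[symmetric] image_image using FFh by (intro image_cong) auto
    have injU': "inj_on ?F U'"
    proof (rule inj_onI)
      fix q q' assume q: "q \<in> U'" "q' \<in> U'" "?F q = ?F q'"
      then have "?Fh (\<phi> q) = ?Fh (\<phi> q')" by (simp only: FFh)
      then have "\<phi> q = \<phi> q'" using inj_onD[OF R(5)] q \<phi>U' by blast
      then show "q = q'" using inj_onD[OF cM(3)] q by (auto simp: U'_def)
    qed
    have RU: "inv_into R ?Fh ` (?Fh ` R) \<subseteq> \<phi> ` U" using R(3) unfolding inv_into_image_cancel[OF R(5) order_refl] by (auto simp: Q_def)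
    have "smooth_map std_atlas (?Fh ` R) \<M> (inv_into U \<phi> \<circ> inv_into R ?Fh)"
      by (rule smooth_map_compose[OF smooth_atlas_std smooth_atlas_std M R(4) cM(2) RU _ smooth_map_chart(2)[OF M c(1)]])
        (unfold smooth_map_std_std_iff, rule R(6))
    then have "smooth_map std_atlas (?Fh ` R) \<M> (inv_into U' ?F)"
    proof (rule smooth_map_cong[OF smooth_atlas_std M R(4)])
      fix y assume "y \<in> ?Fh ` R"
      then obtain q where q: "y = ?F q" "q \<in> U'" unfolding FU'[symmetric] by blast
      have "inv_into R ?Fh y = \<phi> q" unfolding q(1) FFh[OF q(2), symmetric] using q(2) \<phi>U' by (intro inv_into_f_f R(5)) auto
      moreover have "inv_into U \<phi> (\<phi> q) = q" using q(2) cM(3) by (simp add: U'_def)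
      moreover have "inv_into U' ?F y = q" unfolding q(1) by (rule inv_into_f_f[OF injU' q(2)])
      ultimately show "(inv_into U \<phi> \<circ> inv_into R ?Fh) y = inv_into U' ?F y" by (simp only: o_apply)
    qed
    then show ?thesis
      using U' pU' U'W R(4) injU' smooth_map_subset[OF smF U'W] by (intro exI[of _ U']) (simp add: FU')
  qed
  then show ?thesis using fa unfolding local_diffeo_into_def local_diffeo_def by blast
qed

text \<open>Functions with df = \<open>\<theta>\<^sub>\<aa>\<close> exist near each point and are
  locally unique up to constants, which is what the path-lifting argument in
  \<open>local_primitives\<close> asks for.\<close>

lemma ex_global_primitive:
  assumes g: "smooth_map \<M> UNIV \<A> g" and V: "\<And>p. V p \<in> \<mm>"
    and pf: "\<And>p v. v \<in> tangent_space \<M> p \<Longrightarrow> mcp g p v = \<pi>\<^sub>\<aa> (mcp g p v) + br (\<pi>\<^sub>\<aa> (mcp g p v)) (V p)"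
    and sc: "simply_connected (UNIV :: 'm set)"
  shows "\<exists>f. primitive g UNIV f"
proof -
  interpret local_primitives "primitive g"
    by unfold_locales
      (rule ex_local_primitive[OF g V pf], assumption, rule primitive_locally_unique, assumption+, simp add: primitive_def)
  obtain F where F: "\<And>p. \<exists>N W f c. open N \<and> p \<in> N \<and> N \<subseteq> W \<and> primitive g W f \<and> (\<forall>q\<in>N. F q = f q + c)"
    using simply_connected_global_primitive[OF sc manifold_locally_path_connected[OF M]] by blast
  \<comment> \<open>Near each point \<open>F\<close> is a primitive plus a constant \<open>c\<close>
    anywhere in the Lie algebra; after projection the constant lies in \<aa>, and so do all
    values.\<close>
  define f where "f = (\<lambda>q. \<pi>\<^sub>\<aa> (F q))"
  have loc: "\<exists>N. open N \<and> p \<in> N \<and> smooth_map \<M> N std_atlas f \<and> (\<forall>v\<in>tangent_space \<M> p. dvec v f = \<pi>\<^sub>\<aa> (mcp g p v))" for p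
  proof -
    obtain N W h c where N: "open N" "p \<in> N" "N \<subseteq> W" "primitive g W h" "\<And>q. q \<in> N \<Longrightarrow> F q = h q + c"
      using F[of p] by blast
    have W: "open W" "smooth_map \<M> W std_atlas h" "p \<in> W" using N by (auto simp: primitive_def)
    have eq: "h q + \<pi>\<^sub>\<aa> c = f q" if "q \<in> N" for q
    proof -
      have "h q \<in> \<aa>" using N(3,4) that by (auto simp: primitive_def)
      then show ?thesis by (simp add: f_def N(5)[OF that] linear_add[OF linear_\<pi>\<^sub>\<aa>] \<pi>\<^sub>\<aa>_a)
    qed
    have sh: "smooth_map \<M> N std_atlas h" by (rule smooth_map_subset[OF W(2) N(3)])
    have sm: "smooth_map \<M> N std_atlas (\<lambda>q. h q + \<pi>\<^sub>\<aa> c)"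
      by (rule smooth_map_add[OF M N(1) sh smooth_map_const])
    have smf: "smooth_map \<M> N std_atlas f"
      by (rule smooth_map_cong[OF M smooth_atlas_std N(1) sm eq])
    have "dvec v f = \<pi>\<^sub>\<aa> (mcp g p v)" if v: "v \<in> tangent_space \<M> p" for v
    proof -
      obtain U \<phi> u where cv: "(U, \<phi>) \<in> \<M>" "p \<in> U" "v = coord_vector \<M> (U, \<phi>) p u" using tangent_spaceE[OF v] .
      have "smooth_on (\<phi> ` (U \<inter> N)) (h \<circ> inv_into U \<phi>)"
        using sh cv(1) unfolding smooth_map_std_iff[OF M N(1)] by blast
      then have "((h \<circ> inv_into U \<phi>) has_derivative frechet_derivative (h \<circ> inv_into U \<phi>) (at (\<phi> p))) (at (\<phi> p))"
        using cv(2) N(2) by (intro smooth_on_has_derivative) auto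
      from has_derivative_add_const[OF this, of "\<pi>\<^sub>\<aa> c"]
      have "(((\<lambda>q. h q + \<pi>\<^sub>\<aa> c) \<circ> inv_into U \<phi>) has_derivative frechet_derivative (h \<circ> inv_into U \<phi>) (at (\<phi> p))) (at (\<phi> p))"
        by (simp only: o_def)
      from frechet_derivative_at[OF this]
      have "dvec v (\<lambda>q. h q + \<pi>\<^sub>\<aa> c) = dvec v h"
        unfolding cv(3) dvec_coord_vector[OF M cv(1,2) sm N(1,2)] dvec_coord_vector[OF M cv(1,2) sh N(1,2)] by simp
      moreover have "dvec v (\<lambda>q. h q + \<pi>\<^sub>\<aa> c) = dvec v f" by (rule dvec_local[OF M v N(1,2) eq])
      moreover have "dvec v h = \<pi>\<^sub>\<aa> (mcp g p v)" using N(4) W(3) v by (simp add: primitive_def)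
      ultimately show ?thesis by simp
    qed
    with N(1,2) smf show ?thesis by blast
  qed
  have "smooth_map \<M> UNIV std_atlas f" by (rule smooth_map_local[OF M smooth_atlas_std]) (use loc in blast)
  moreover have "f q \<in> \<aa>" for q unfolding f_def by (rule \<pi>\<^sub>\<aa>_in)
  moreover have "dvec v f = \<pi>\<^sub>\<aa> (mcp g p v)" if "v \<in> tangent_space \<M> p" for p v using loc[of p] that by blast
  ultimately have "primitive g UNIV f" by (simp add: primitive_def)
  then show ?thesis by blast
qed

text \<open>For an integral manifold every primitive of \<open>\<theta>\<^sub>\<aa>\<close> is an
  admissible \<open>f\<close> (\<open>prim\<close>). Local primitives give the statements near each
  point, a global one those over a simply connected manifold. The way back is local in both cases,
  with \<open>UNIV\<close> as the neighbourhood of every point when \<open>f\<close> is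
  global.\<close>

theorem integral_manifold_characterization:
  "(integral_manifold G A \<aa> \<mm> \<bb> \<nn> \<M> UNIV g V \<longleftrightarrow>
      immersed_in_Y G \<mm> \<M> UNIV g V \<and>
      (\<forall>p. \<exists>W f. open W \<and> p \<in> W \<and> local_diffeo_into \<M> W A \<aa> f \<and> framing_eq G \<M> W f g V)) \<and>
   (integral_manifold G A \<aa> \<mm> \<bb> \<nn> \<M> UNIV g V \<longleftrightarrow>
      (\<forall>p. \<exists>W. open W \<and> p \<in> W \<and> framed_solution G A \<aa> \<mm> \<M> W g V)) \<and>
   (simply_connected (UNIV :: 'm set) \<longrightarrow>
      (integral_manifold G A \<aa> \<mm> \<bb> \<nn> \<M> UNIV g V \<longleftrightarrow>
         immersed_in_Y G \<mm> \<M> UNIV g V \<and>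
         (\<exists>f. local_diffeo_into \<M> UNIV A \<aa> f \<and> framing_eq G \<M> UNIV f g V)) \<and>
      (integral_manifold G A \<aa> \<mm> \<bb> \<nn> \<M> UNIV g V \<longleftrightarrow>
         framed_solution G A \<aa> \<mm> \<M> UNIV g V)) \<and>
   (framed_solution G A \<aa> \<mm> \<M> UNIV g V \<longrightarrow>
      integral_manifold G A \<aa> \<mm> \<bb> \<nn> \<M> UNIV g V)"
proof -
  let ?I = "integral_manifold G A \<aa> \<mm> \<bb> \<nn> \<M> UNIV g V"
  let ?im = "immersed_in_Y G \<mm> \<M> UNIV g V"
  let ?fr = "\<lambda>W f. local_diffeo_into \<M> W A \<aa> f \<and> framing_eq G \<M> W f g V"
  let ?fs = "\<lambda>W. framed_solution G A \<aa> \<mm> \<M> W g V"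
  have im: "?I \<Longrightarrow> ?im" by (simp add: integral_manifold_def)
  have pf: "mcp g p v = \<pi>\<^sub>\<aa> (mcp g p v) + br (\<pi>\<^sub>\<aa> (mcp g p v)) (V p)" if "?I" "v \<in> tangent_space \<M> p" for p v
    using that unfolding integral_manifold_iff by blast
  have prim: "?fr W f" if "?I" "primitive g W f" for W f
    using primitive_framing[OF that(2) pf[OF that(1)]] primitive_local_diffeo[OF that(2)] that(1)
    unfolding integral_manifold_iff by blast
  have 1: "\<exists>W f. open W \<and> p \<in> W \<and> ?fr W f" if I: "?I" for p
  proof -
    note s = immersed_in_Y_smooth[OF im[OF I]]
    obtain W f where "open W" "p \<in> W" "primitive g W f" using ex_local_primitive[OF s(1,3) pf[OF I]] by blast
    then show ?thesis using prim[OF I] by blast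
  qed
  have 2: "?fs W" if "?im" "open W" "?fr W f" for W f
    using that(2,3) immersed_in_Y_smooth[OF that(1)]
    by (intro framed_solutionI[of W f]) (auto intro: smooth_map_subset)
  have 3: "?I" if loc: "\<And>p. \<exists>W. open W \<and> p \<in> W \<and> ?fs W"
  proof (rule integral_manifoldI_framing[OF immersedI_framed[OF loc]])
    show "\<exists>W f. open W \<and> p \<in> W \<and> ?fr W f" for p
      using loc[of p] unfolding framed_solution_def generalized_solution_def by blast
  qed
  have 4: "\<exists>f. ?fr UNIV f" if I: "?I" and sc: "simply_connected (UNIV :: 'm set)"
  proof -
    note s = immersed_in_Y_smooth[OF im[OF I]]
    obtain f where "primitive g UNIV f" using ex_global_primitive[OF s(1,3) pf[OF I] sc] by blast
    then show ?thesis using prim[OF I] by blast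
  qed
  have 5: "?fs UNIV \<Longrightarrow> ?I" by (rule 3) (meson UNIV_I open_UNIV)
  have 6: "?I \<longleftrightarrow> ?im \<and> (\<forall>p. \<exists>W f. open W \<and> p \<in> W \<and> ?fr W f)"
    using im 1 integral_manifoldI_framing by (intro iffI conjI allI) (blast, blast, metis)
  have 7: "?I \<longleftrightarrow> (\<forall>p. \<exists>W. open W \<and> p \<in> W \<and> ?fs W)"
  proof
    assume I: "?I"
    show "\<forall>p. \<exists>W. open W \<and> p \<in> W \<and> ?fs W"
    proof
      fix p
      obtain W f where "open W" "p \<in> W" "?fr W f" using 1[OF I] by blast
      then show "\<exists>W. open W \<and> p \<in> W \<and> ?fs W" using 2[OF im[OF I]] by blast
    qed
  qed (rule 3, blast)
  have 8: "?I \<longleftrightarrow> ?im \<and> (\<exists>f. ?fr UNIV f)" and 9: "?I \<longleftrightarrow> ?fs UNIV" if sc: "simply_connected (UNIV :: 'm set)"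
  proof -
    show "?I \<longleftrightarrow> ?im \<and> (\<exists>f. ?fr UNIV f)"
    proof
      assume I: "?I"
      show "?im \<and> (\<exists>f. ?fr UNIV f)" using im[OF I] 4[OF I sc] by (rule conjI)
    next
      assume "?im \<and> (\<exists>f. ?fr UNIV f)"
      then show "?I" using 5 2[OF _ open_UNIV] by blast
    qed
    show "?I \<longleftrightarrow> ?fs UNIV"
    proof
      assume I: "?I"
      obtain f where "?fr UNIV f" using 4[OF I sc] by blast
      then show "?fs UNIV" by (rule 2[OF im[OF I] open_UNIV])
    qed (rule 5)
  qed
  show ?thesis using 5 6 7 8 9 by (intro conjI impI)
qed

end

end

theorem mainTheorem3:
  fixes G :: "('g::{t2_space,second_countable_topology}, 'e::euclidean_space, 'l::euclidean_space) lie_grp"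
    and G0 :: "'g set" and \<sigma> :: "'g \<Rightarrow> 'g"
    and \<gg>\<^sub>0 \<gg>\<^sub>1 \<aa> \<mm> \<bb> \<nn> :: "'l set"
    and A :: "'k::finite \<Rightarrow> 'l"
    and \<M> :: "('m::{t2_space,second_countable_topology}, real ^ 'k) chart set"
    and g :: "'m \<Rightarrow> 'g" and V :: "'m \<Rightarrow> 'l"
  assumes "symmetric_space G G0 \<sigma>" and "semisimple G"
    and "cartan_decomposition G G0 \<sigma> \<gg>\<^sub>0 \<gg>\<^sub>1"
    and "maximal_abelian G \<gg>\<^sub>1 \<aa>" and "dim \<aa> = CARD('k)"
    and "\<mm> = \<gg>\<^sub>1 \<inter> killing_perp G \<aa>" and "direct_sum \<gg>\<^sub>1 \<aa> \<mm>"
    and "\<bb> = \<gg>\<^sub>0 \<inter> killing_perp G (centralizer_in G \<gg>\<^sub>0 \<aa>)" and "direct_sum \<gg>\<^sub>0 \<bb> \<nn>"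
    and "inj A" and "independent (range A)" and "span (range A) = \<aa>"
    and "\<And>i. regular_element G G0 \<gg>\<^sub>1 (A i)"
    and "smooth_atlas \<M>"
  shows
    "(integral_manifold G A \<aa> \<mm> \<bb> \<nn> \<M> UNIV g V \<longleftrightarrow>
        immersed_in_Y G \<mm> \<M> UNIV g V \<and>
        (\<forall>p. \<exists>W f. open W \<and> p \<in> W \<and> local_diffeo_into \<M> W A \<aa> f \<and> framing_eq G \<M> W f g V)) \<and>
     (integral_manifold G A \<aa> \<mm> \<bb> \<nn> \<M> UNIV g V \<longleftrightarrow>
        (\<forall>p. \<exists>W. open W \<and> p \<in> W \<and> framed_solution G A \<aa> \<mm> \<M> W g V)) \<and>
     (simply_connected (UNIV :: 'm set) \<longrightarrow>
        (integral_manifold G A \<aa> \<mm> \<bb> \<nn> \<M> UNIV g V \<longleftrightarrow>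
           immersed_in_Y G \<mm> \<M> UNIV g V \<and>
           (\<exists>f. local_diffeo_into \<M> UNIV A \<aa> f \<and> framing_eq G \<M> UNIV f g V)) \<and>
        (integral_manifold G A \<aa> \<mm> \<bb> \<nn> \<M> UNIV g V \<longleftrightarrow>
           framed_solution G A \<aa> \<mm> \<M> UNIV g V)) \<and>
     (framed_solution G A \<aa> \<mm> \<M> UNIV g V \<longrightarrow>
        integral_manifold G A \<aa> \<mm> \<bb> \<nn> \<M> UNIV g V)"
proof -
  note sym = assms(1)[unfolded symmetric_space_def] and cart = assms(3)[unfolded cartan_decomposition_def]
    and abl = assms(4)[unfolded maximal_abelian_def]
  interpret involution G \<sigma>
    using sym by unfold_locales blast+
  interpret cartan_tableau_setting G \<sigma> \<gg>\<^sub>0 \<gg>\<^sub>1 \<aa> \<mm> \<bb> \<nn> A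
    using cart abl assms(6-12) by unfold_locales (blast | assumption)+
  show ?thesis by (rule integral_manifold_characterization[OF assms(14)])
qed

end
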